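(* Let $\beta\in\{1,\dots,n\}$, let $p,q\in\mathbb{C}^n$ be linearly independent, let $a,b\in\mathbb{C}^n$ with $b_\beta\neq0$, and for $1\le j\le n$ define $P_j,Q:\mathbf{U}(n)\to\mathbb{C}$ by $$P_j(z)=\sum_{k=1}^n p_k a_j z_{kj},\qquad Q(z)=\sum_{k=1}^n q_k b_\beta z_{k\beta}.$$ Let $W=\{z\in\mathbf{U}(n)\mid Q(z)\neq 0\}$, an open and dense subset of $\mathbf{U}(n)$, and let $f_j=P_j/Q:W\to\mathbb{C}$. Then for every positive integer $k$ the set $$\mathcal{E}_k=\{\tau(f_j)^k:W\to\mathbb{C}\mid 1\le j\le n,\ j\ne\beta\}$$ is an eigenfamily on $W$. The corresponding statement holds for the induced family (the restrictions to $W\cap\mathbf{SU}(n)$) on the special unitary group $\mathbf{SU}(n)$.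
   Context: $\mathbf{U}(n)$ and $\mathbf{SU}(n)$ carry the Riemannian metrics induced from the left-invariant metric on $\mathbf{GL}_n(\mathbb{C})$ given on $\mathbb{C}^{n\times n}$ by $g(Z,W)=\mathrm{Re}\,\mathrm{trace}(ZW^* )$; $z_{kj}$ are the matrix entries of $z$. For complex-valued functions, $\tau(f)=\mathrm{div}(\nabla f)$ (extended complex-linearly) and $\kappa(f,h)=g(\nabla f,\nabla h)$ with $g$ extended complex-bilinearly. A set $\mathcal{E}$ of complex-valued functions on a Riemannian manifold $M$ is an eigenfamily on $M$ if there exist $\lambda,\mu\in\mathbb{C}$ such that $\tau(\phi)=\lambda\phi$ and $\kappa(\phi,\psi)=\mu\,\phi\,\psi$ for all $\phi,\psi\in\mathcal{E}$. *)

theory Defs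
  imports "HOL-Analysis.Analysis"
begin

text \<open>
  A manifold is given as a subset \<open>M\<close> of a Euclidean space, and a Riemannian metric as a function
  \<open>g x v w\<close> of a point and two tangent vectors. The definitions are intended for smooth embedded
  submanifolds \<open>M\<close> (including relatively open subsets of these). Functions and vector fields
  on \<open>M\<close> are total functions on the ambient space. Their values outside \<open>M\<close> are never used, so
  restricting a function to a smaller manifold does not change the term.
\<close>

section \<open>Smooth maps, tangent spaces, differentials\<close>

text \<open>Class \<open>C\<^sup>k\<close> on an open subset \<open>S\<close> of a Euclidean space.\<close>

primrec Ck_on :: "nat \<Rightarrow> 'a::euclidean_space set \<Rightarrow> ('a \<Rightarrow> 'b::real_normed_vector) \<Rightarrow> bool" where
  "Ck_on 0 S f \<longleftrightarrow> continuous_on S f"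
| "Ck_on (Suc k) S f \<longleftrightarrow> (\<forall>x\<in>S. f differentiable (at x)) \<and>
     (\<forall>v. Ck_on k S (\<lambda>x. frechet_derivative f (at x) v))"

definition smooth_on :: "'a::euclidean_space set \<Rightarrow> ('a \<Rightarrow> 'b::real_normed_vector) \<Rightarrow> bool" where
  "smooth_on S f \<longleftrightarrow> (\<forall>k. Ck_on k S f)"

definition smooth_map :: "'a::euclidean_space set \<Rightarrow> ('a \<Rightarrow> 'b::real_normed_vector) \<Rightarrow> bool" where
  "smooth_map M f \<longleftrightarrow>
     (\<forall>x\<in>M. \<exists>U F. open U \<and> x \<in> U \<and> smooth_on U F \<and> (\<forall>y\<in>U \<inter> M. F y = f y))"

definition curve_through :: "'a::euclidean_space set \<Rightarrow> 'a \<Rightarrow> 'a \<Rightarrow> (real \<Rightarrow> 'a) \<Rightarrow> bool" where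
  "curve_through M x v \<gamma> \<longleftrightarrow>
     (\<exists>e>0. smooth_on {-e<..<e} \<gamma> \<and> \<gamma> ` {-e<..<e} \<subseteq> M) \<and>
     \<gamma> 0 = x \<and> (\<gamma> has_vector_derivative v) (at 0)"

definition tangent_space :: "'a::euclidean_space set \<Rightarrow> 'a \<Rightarrow> 'a set" where
  "tangent_space M x = {v. \<exists>\<gamma>. curve_through M x v \<gamma>}"

text \<open>The differential of \<open>f\<close> at \<open>x\<close>, applied to a tangent vector \<open>v\<close> of \<open>M\<close>.\<close>

definition diff_along ::
    "'a::euclidean_space set \<Rightarrow> ('a \<Rightarrow> 'b::real_normed_vector) \<Rightarrow> 'a \<Rightarrow> 'a \<Rightarrow> 'b" where
  "diff_along M f x v =
     (THE d. \<forall>\<gamma>. curve_through M x v \<gamma> \<longrightarrow> ((\<lambda>t. f (\<gamma> t)) has_vector_derivative d) (at 0))"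

definition vector_fields :: "'a::euclidean_space set \<Rightarrow> ('a \<Rightarrow> 'a) set" where
  "vector_fields M = {X. smooth_map M X \<and> (\<forall>x\<in>M. X x \<in> tangent_space M x)}"

text \<open>The Lie bracket \<open>[X, Y]\<close>, computed componentwise: the component of \<open>[X, Y]\<close> along an ambient
  coordinate function \<open>c\<close> is \<open>X (Y c) - Y (X c)\<close>.\<close>

definition lie_bracket ::
    "'a::euclidean_space set \<Rightarrow> ('a \<Rightarrow> 'a) \<Rightarrow> ('a \<Rightarrow> 'a) \<Rightarrow> 'a \<Rightarrow> 'a" where
  "lie_bracket M X Y x = diff_along M Y x (X x) - diff_along M X x (Y x)"


section \<open>Levi-Civita connection, gradient, divergence\<close>

text \<open>\<open>D x v Y\<close> is the covariant derivative at the point \<open>x\<close> of the vector field \<open>Y\<close> in the direction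
  of the tangent vector \<open>v\<close>. The conditions say, in order: \<open>D\<close> maps into the tangent spaces and
  preserves smoothness; it is linear in \<open>v\<close>, additive in \<open>Y\<close> and satisfies the Leibniz rule; it is
  torsion-free and compatible with \<open>g\<close>.\<close>

definition is_levi_civita ::
    "'a::euclidean_space set \<Rightarrow> ('a \<Rightarrow> 'a \<Rightarrow> 'a \<Rightarrow> real) \<Rightarrow>
     ('a \<Rightarrow> 'a \<Rightarrow> ('a \<Rightarrow> 'a) \<Rightarrow> 'a) \<Rightarrow> bool" where
  "is_levi_civita M g D \<longleftrightarrow>
     (\<forall>Y\<in>vector_fields M. \<forall>x\<in>M. \<forall>v\<in>tangent_space M x. D x v Y \<in> tangent_space M x) \<and>
     (\<forall>X\<in>vector_fields M. \<forall>Y\<in>vector_fields M. smooth_map M (\<lambda>x. D x (X x) Y)) \<and>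
     (\<forall>Y\<in>vector_fields M. \<forall>x\<in>M. \<forall>u\<in>tangent_space M x. \<forall>v\<in>tangent_space M x. \<forall>r s.
        D x (r *\<^sub>R u + s *\<^sub>R v) Y = r *\<^sub>R D x u Y + s *\<^sub>R D x v Y) \<and>
     (\<forall>Y\<in>vector_fields M. \<forall>Z\<in>vector_fields M. \<forall>x\<in>M. \<forall>v\<in>tangent_space M x.
        D x v (\<lambda>y. Y y + Z y) = D x v Y + D x v Z) \<and>
     (\<forall>f::'a \<Rightarrow> real. smooth_map M f \<longrightarrow>
        (\<forall>Y\<in>vector_fields M. \<forall>x\<in>M. \<forall>v\<in>tangent_space M x.
           D x v (\<lambda>y. f y *\<^sub>R Y y) = diff_along M f x v *\<^sub>R Y x + f x *\<^sub>R D x v Y)) \<and>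
     (\<forall>X\<in>vector_fields M. \<forall>Y\<in>vector_fields M. \<forall>x\<in>M.
        D x (X x) Y - D x (Y x) X = lie_bracket M X Y x) \<and>
     (\<forall>Y\<in>vector_fields M. \<forall>Z\<in>vector_fields M. \<forall>x\<in>M. \<forall>v\<in>tangent_space M x.
        diff_along M (\<lambda>y. g y (Y y) (Z y)) x v = g x (D x v Y) (Z x) + g x (Y x) (D x v Z))"

text \<open>On a Riemannian manifold the conditions determine \<open>D x v Y\<close> for \<open>x \<in> M\<close>, \<open>v\<close> tangent to \<open>M\<close> at
  \<open>x\<close> and \<open>Y\<close> a smooth vector field, so the choice is immaterial there.\<close>

definition levi_civita ::
    "'a::euclidean_space set \<Rightarrow> ('a \<Rightarrow> 'a \<Rightarrow> 'a \<Rightarrow> real) \<Rightarrow> 'a \<Rightarrow> 'a \<Rightarrow> ('a \<Rightarrow> 'a) \<Rightarrow> 'a" where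
  "levi_civita M g = (SOME D. is_levi_civita M g D)"

definition orthonormal_basis_at ::
    "'a::euclidean_space set \<Rightarrow> ('a \<Rightarrow> 'a \<Rightarrow> 'a \<Rightarrow> real) \<Rightarrow> 'a \<Rightarrow> 'a set \<Rightarrow> bool" where
  "orthonormal_basis_at M g x B \<longleftrightarrow>
     span B = tangent_space M x \<and> (\<forall>b\<in>B. \<forall>c\<in>B. g x b c = (if b = c then 1 else 0))"

text \<open>The divergence of \<open>V\<close> is the trace of the endomorphism of the tangent space sending \<open>v\<close> to the
  covariant derivative of \<open>V\<close> along \<open>v\<close>; it does not depend on the orthonormal basis.\<close>

definition divergence ::
    "'a::euclidean_space set \<Rightarrow> ('a \<Rightarrow> 'a \<Rightarrow> 'a \<Rightarrow> real) \<Rightarrow> ('a \<Rightarrow> 'a) \<Rightarrow> 'a \<Rightarrow> real" where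
  "divergence M g V x =
     (\<Sum>e\<in>(SOME B. orthonormal_basis_at M g x B). g x (levi_civita M g x e V) e)"

definition gradient ::
    "'a::euclidean_space set \<Rightarrow> ('a \<Rightarrow> 'a \<Rightarrow> 'a \<Rightarrow> real) \<Rightarrow> ('a \<Rightarrow> real) \<Rightarrow> 'a \<Rightarrow> 'a" where
  "gradient M g f x =
     (THE v. v \<in> tangent_space M x \<and> (\<forall>w\<in>tangent_space M x. g x v w = diff_along M f x w))"


section \<open>The operators \<open>\<tau>\<close> and \<open>\<kappa>\<close>, eigenfamilies\<close>

text \<open>For complex-valued \<open>f\<close> the gradient is the complexified tangent vector
  \<open>gradient (Re f) + \<i> gradient (Im f)\<close>; \<open>div\<close> is extended complex-linearly and \<open>g\<close>
  complex-bilinearly (not sesquilinearly).\<close>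

definition tau ::
    "'a::euclidean_space set \<Rightarrow> ('a \<Rightarrow> 'a \<Rightarrow> 'a \<Rightarrow> real) \<Rightarrow> ('a \<Rightarrow> complex) \<Rightarrow> 'a \<Rightarrow> complex" where
  "tau M g f x =
     Complex (divergence M g (gradient M g (\<lambda>y. Re (f y))) x)
             (divergence M g (gradient M g (\<lambda>y. Im (f y))) x)"

definition kappa ::
    "'a::euclidean_space set \<Rightarrow> ('a \<Rightarrow> 'a \<Rightarrow> 'a \<Rightarrow> real) \<Rightarrow>
     ('a \<Rightarrow> complex) \<Rightarrow> ('a \<Rightarrow> complex) \<Rightarrow> 'a \<Rightarrow> complex" where
  "kappa M g f h x =
     (let f1 = gradient M g (\<lambda>y. Re (f y)) x; f2 = gradient M g (\<lambda>y. Im (f y)) x;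
          h1 = gradient M g (\<lambda>y. Re (h y)) x; h2 = gradient M g (\<lambda>y. Im (h y)) x
      in Complex (g x f1 h1 - g x f2 h2) (g x f1 h2 + g x f2 h1))"

definition eigenfamily ::
    "'a::euclidean_space set \<Rightarrow> ('a \<Rightarrow> 'a \<Rightarrow> 'a \<Rightarrow> real) \<Rightarrow> ('a \<Rightarrow> complex) set \<Rightarrow> bool" where
  "eigenfamily M g E \<longleftrightarrow>
     (\<forall>\<phi>\<in>E. smooth_map M \<phi>) \<and>
     (\<exists>lam mu. \<forall>\<phi>\<in>E. \<forall>\<psi>\<in>E. \<forall>x\<in>M.
        tau M g \<phi> x = lam * \<phi> x \<and> kappa M g \<phi> \<psi> x = mu * \<phi> x * \<psi> x)"


section \<open>The unitary groups and their metric\<close>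

definition conj_transpose :: "complex^'n^'m \<Rightarrow> complex^'m^'n" where
  "conj_transpose A = (\<chi> i j. cnj (A $ j $ i))"

definition unitary_group :: "(complex^'n^'n) set" where
  "unitary_group = {z. z ** conj_transpose z = mat 1}"

definition special_unitary_group :: "(complex^'n^'n) set" where
  "special_unitary_group = {z \<in> unitary_group. det z = 1}"

text \<open>The left-invariant metric on \<open>GL\<^sub>n(\<complex>)\<close> which at the identity is \<open>Re (trace (Z W\<^sup>*))\<close>: tangent
  vectors at \<open>x\<close> are moved to the identity by left translation with \<open>x\<inverse>\<close>.\<close>

definition left_inv_metric ::
    "complex^'n^'n \<Rightarrow> complex^'n^'n \<Rightarrow> complex^'n^'n \<Rightarrow> real" where
  "left_inv_metric x Z W =
     Re (trace ((matrix_inv x ** Z) ** conj_transpose (matrix_inv x ** W)))"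

end

theory Submission
  imports Defs
begin

text \<open>
  For a submanifold \<open>M\<close> of a Euclidean space with orthogonal projections \<open>P\<close> onto its tangent spaces,
  the Levi-Civita connection is the projected directional derivative. Hence, with
  \<open>X\<^sub>b f (y) = df\<^sub>y (P\<^sub>y b)\<close> for \<open>b\<close> in an orthonormal basis of the ambient space,
  \<open>\<tau> f = \<Sum>\<^sub>b X\<^sub>b (X\<^sub>b f)\<close> and \<open>\<kappa> f h = \<Sum>\<^sub>b X\<^sub>b f X\<^sub>b h\<close>, so \<open>\<tau>\<close> and \<open>\<kappa>\<close> obey the usual product rules.
  On the unitary groups the metric is the Euclidean one and
  \<open>\<tau> z\<^sub>i\<^sub>j = l z\<^sub>i\<^sub>j\<close>, \<open>\<kappa> z\<^sub>i\<^sub>j z\<^sub>k\<^sub>l = - z\<^sub>i\<^sub>l z\<^sub>k\<^sub>j + c z\<^sub>i\<^sub>j z\<^sub>k\<^sub>l\<close>, where \<open>(l, c) = (- n, 0)\<close> for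
  \<open>U(n)\<close> and \<open>(- n + 1/n, 1/n)\<close> for \<open>SU(n)\<close>. With \<open>u = p\<^sup>t z\<close> and \<open>v = q\<^sup>t z\<close> the product rules give
  \<open>\<tau> (u\<^sub>j / v\<^sub>\<beta>) = 2 (u\<^sub>\<beta> v\<^sub>j - u\<^sub>j v\<^sub>\<beta>) / v\<^sub>\<beta>\<^sup>2\<close>, and these functions \<open>h\<close> satisfy \<open>\<tau> h = 0\<close> and
  \<open>\<kappa> h h' = - 2 h h'\<close>, whatever \<open>l\<close> and \<open>c\<close> are. Powers inherit the eigenfamily property.
\<close>

section \<open>Smooth maps\<close>

text \<open>The definitions choose: \<open>diff_along\<close> and \<open>gradient\<close> by
  \<open>THE\<close>, \<open>levi_civita\<close> and the orthonormal basis in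
  \<open>divergence\<close> by \<open>SOME\<close>. Nothing can be computed before these are pinned
  down: every candidate tangent direction needs a curve, the connection must be unique, and the
  trace must not depend on the basis. The projections settle the last two, and they provide vector
  fields with prescribed values at a point without charts or bump functions.

  That \<open>l\<close> and \<open>c\<close> do not matter has a reason. For holomorphic functions
  of the entries that are homogeneous of degrees d and d', the scalar parts of the two entry
  formulas contribute the factor l d + c d (d - 1) to \<tau> and c d d' to \<kappa>. The quotients
  u_j / v_\<beta> and the functions h have degree 0, so they only see the swapped product of
  entries, which is common to both groups. The numerator of h is a 2 x 2 minor, and for minors with
  a common column the swapped product reproduces the minors.\<close>

lemma Ck_on_imp_continuous_on: "Ck_on k S f \<Longrightarrow> continuous_on S f"
  by (cases k)
    (auto intro!: continuous_at_imp_continuous_on differentiable_imp_continuous_within)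

lemma Ck_on_subset: "Ck_on k S f \<Longrightarrow> T \<subseteq> S \<Longrightarrow> Ck_on k T f"
  by (induction k arbitrary: f) (auto intro: continuous_on_subset)

lemma Ck_on_cong:
  assumes "open S" "Ck_on k S f" "\<And>x. x \<in> S \<Longrightarrow> f x = g x"
  shows "Ck_on k S g"
  using assms
proof (induction k arbitrary: f g)
  case 0
  then show ?case by (metis Ck_on.simps(1) continuous_on_cong)
next
  case (Suc k)
  have der: "(g has_derivative frechet_derivative f (at x)) (at x)" if "x \<in> S" for x
    using has_derivative_transform_within_open[of f "frechet_derivative f (at x)" x UNIV S g]
      Suc.prems that frechet_derivative_works by force
  have eq: "frechet_derivative g (at x) = frechet_derivative f (at x)" if "x \<in> S" for x
    using frechet_derivative_at[OF der[OF that]] by simp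
  have "Ck_on k S (\<lambda>x. frechet_derivative g (at x) v)" for v
    by (rule Suc.IH[of "\<lambda>x. frechet_derivative f (at x) v"]) (use Suc.prems eq in auto)
  with der show ?case by (auto simp: differentiable_def)
qed

text \<open>The definition speaks of the operator \<open>frechet_derivative\<close>; here any known
  formula \<open>f'\<close> for the derivative may take its place. The closure properties below are
  inductions on \<open>k\<close> through this rule.\<close>

lemma Ck_on_SucI:
  assumes "open S" "\<And>x. x \<in> S \<Longrightarrow> (f has_derivative f' x) (at x)"
    "\<And>v. Ck_on k S (\<lambda>x. f' x v)"
  shows "Ck_on (Suc k) S f"
proof -
  have "Ck_on k S (\<lambda>x. frechet_derivative f (at x) v)" for v
    by (rule Ck_on_cong[OF assms(1) assms(3)[of v]]) (simp add: frechet_derivative_at[OF assms(2)])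
  with assms(2) show ?thesis by (auto simp: differentiable_def)
qed

lemma Ck_on_has_derivative:
  "Ck_on (Suc k) S f \<Longrightarrow> x \<in> S \<Longrightarrow> (f has_derivative frechet_derivative f (at x)) (at x)"
  using frechet_derivative_works by auto

text \<open>The product rule leaves one factor undifferentiated, so the induction for products has
  to lower the order of that factor by one.\<close>

lemma Ck_on_Suc_imp: "Ck_on (Suc k) S f \<Longrightarrow> Ck_on k S f"
proof (induction k arbitrary: f)
  case 0
  then show ?case using Ck_on_imp_continuous_on by (metis Ck_on.simps(1))
next
  case (Suc k)
  then show ?case by (metis Ck_on.simps(2))
qed

lemma Ck_on_const: "Ck_on k S (\<lambda>x. c)"
  by (induction k arbitrary: c) auto

lemma Ck_on_linear: "bounded_linear f \<Longrightarrow> open S \<Longrightarrow> Ck_on k S f"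
  by (cases k) (auto simp: linear_continuous_on Ck_on_const bounded_linear_imp_has_derivative
      intro!: Ck_on_SucI[of _ _ "\<lambda>_. f"] simp del: Ck_on.simps(2))

lemma Ck_on_bounded_linear:
  assumes "bounded_linear L" "open S" "Ck_on k S f"
  shows "Ck_on k S (\<lambda>x. L (f x))"
  using assms(3)
proof (induction k arbitrary: f)
  case 0
  then show ?case by (simp add: bounded_linear.continuous_on[OF assms(1)])
next
  case (Suc k)
  show ?case
  proof (rule Ck_on_SucI[OF assms(2)])
    show "((\<lambda>x. L (f x)) has_derivative (\<lambda>v. L (frechet_derivative f (at x) v))) (at x)"
      if "x \<in> S" for x
      by (rule bounded_linear.has_derivative[OF assms(1) Ck_on_has_derivative[OF Suc.prems that]])
  qed (use Suc in auto)
qed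

lemma Ck_on_add:
  assumes "open S" "Ck_on k S f" "Ck_on k S g"
  shows "Ck_on k S (\<lambda>x. f x + g x)"
  using assms(2,3)
proof (induction k arbitrary: f g)
  case 0
  then show ?case by (simp add: continuous_on_add)
next
  case (Suc k)
  show ?case
  proof (rule Ck_on_SucI[OF assms(1)])
    show "((\<lambda>x. f x + g x) has_derivative
        (\<lambda>v. frechet_derivative f (at x) v + frechet_derivative g (at x) v)) (at x)"
      if "x \<in> S" for x
      by (intro has_derivative_add Ck_on_has_derivative[OF Suc.prems(1) that]
          Ck_on_has_derivative[OF Suc.prems(2) that])
  qed (use Suc in auto)
qed

lemma Ck_on_bilinear:
  assumes "bounded_bilinear B" "open S" "Ck_on k S f" "Ck_on k S g"
  shows "Ck_on k S (\<lambda>x. B (f x) (g x))"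
  using assms(3,4)
proof (induction k arbitrary: f g)
  case 0
  then show ?case by (simp add: bounded_bilinear.continuous_on[OF assms(1)])
next
  case (Suc k)
  show ?case
  proof (rule Ck_on_SucI[OF assms(2)])
    show "((\<lambda>x. B (f x) (g x)) has_derivative
        (\<lambda>v. B (f x) (frechet_derivative g (at x) v) + B (frechet_derivative f (at x) v) (g x))) (at x)"
      if "x \<in> S" for x
      by (intro bounded_bilinear.FDERIV[OF assms(1)] Ck_on_has_derivative[OF Suc.prems(1) that]
          Ck_on_has_derivative[OF Suc.prems(2) that])
    show "Ck_on k S (\<lambda>x. B (f x) (frechet_derivative g (at x) v) +
        B (frechet_derivative f (at x) v) (g x))" for v
      using Suc.prems Ck_on_Suc_imp[OF Suc.prems(1)] Ck_on_Suc_imp[OF Suc.prems(2)]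
      by (intro Ck_on_add assms Suc.IH) auto
  qed
qed

text \<open>The derivative - (1/f) f' (1/f) contains only 1/f and f', so the induction hypothesis
  for 1/f itself closes the step.\<close>

lemma Ck_on_inverse:
  fixes f :: "'a::euclidean_space \<Rightarrow> 'b::real_normed_field"
  assumes "open S" "Ck_on k S f" "\<And>x. x \<in> S \<Longrightarrow> f x \<noteq> 0"
  shows "Ck_on k S (\<lambda>x. inverse (f x))"
  using assms(2)
proof (induction k)
  case 0
  then show ?case using assms(3) by (auto intro: continuous_on_inverse)
next
  case (Suc k)
  have inv: "Ck_on k S (\<lambda>x. inverse (f x))"
    using Suc Ck_on_Suc_imp by blast
  show ?case
  proof (rule Ck_on_SucI[OF assms(1)])
    show "((\<lambda>x. inverse (f x)) has_derivative
        (\<lambda>v. - (inverse (f x) * frechet_derivative f (at x) v * inverse (f x)))) (at x)"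
      if "x \<in> S" for x
      by (rule Deriv.has_derivative_inverse[OF assms(3)[OF that] Ck_on_has_derivative[OF Suc.prems that]])
    show "Ck_on k S (\<lambda>x. - (inverse (f x) * frechet_derivative f (at x) v * inverse (f x)))" for v
      by (intro Ck_on_bounded_linear[OF bounded_linear_minus[OF bounded_linear_ident]]
          Ck_on_bilinear[OF bounded_bilinear_mult] assms inv) (use Suc.prems in auto)
  qed
qed

lemma smooth_on_subset: "smooth_on S f \<Longrightarrow> T \<subseteq> S \<Longrightarrow> smooth_on T f"
  by (auto simp: smooth_on_def intro: Ck_on_subset)

lemma smooth_on_cong:
  "open S \<Longrightarrow> smooth_on S f \<Longrightarrow> (\<And>x. x \<in> S \<Longrightarrow> f x = g x) \<Longrightarrow> smooth_on S g"
  unfolding smooth_on_def by (metis Ck_on_cong)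

lemma smooth_on_imp_continuous_on: "smooth_on S f \<Longrightarrow> continuous_on S f"
  by (auto simp: smooth_on_def intro: Ck_on_imp_continuous_on)

lemma smooth_on_has_derivative:
  "smooth_on S f \<Longrightarrow> x \<in> S \<Longrightarrow> (f has_derivative frechet_derivative f (at x)) (at x)"
  by (auto simp: smooth_on_def intro: Ck_on_has_derivative)

lemma smooth_on_frechet_derivative:
  "smooth_on S f \<Longrightarrow> smooth_on S (\<lambda>x. frechet_derivative f (at x) v)"
  unfolding smooth_on_def by (metis Ck_on.simps(2))

lemma smooth_on_const: "smooth_on S (\<lambda>x. c)"
  by (simp add: smooth_on_def Ck_on_const)

lemma smooth_on_linear: "bounded_linear f \<Longrightarrow> open S \<Longrightarrow> smooth_on S f"
  by (simp add: smooth_on_def Ck_on_linear)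

lemma smooth_on_bounded_linear:
  "bounded_linear L \<Longrightarrow> open S \<Longrightarrow> smooth_on S f \<Longrightarrow> smooth_on S (\<lambda>x. L (f x))"
  by (simp add: smooth_on_def Ck_on_bounded_linear)

lemma smooth_on_add:
  "open S \<Longrightarrow> smooth_on S f \<Longrightarrow> smooth_on S g \<Longrightarrow> smooth_on S (\<lambda>x. f x + g x)"
  by (simp add: smooth_on_def Ck_on_add)

lemma smooth_on_bilinear:
  "bounded_bilinear B \<Longrightarrow> open S \<Longrightarrow> smooth_on S f \<Longrightarrow> smooth_on S g \<Longrightarrow>
    smooth_on S (\<lambda>x. B (f x) (g x))"
  by (simp add: smooth_on_def Ck_on_bilinear)

lemma smooth_on_inverse:
  fixes f :: "'a::euclidean_space \<Rightarrow> 'b::real_normed_field"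
  shows "open S \<Longrightarrow> smooth_on S f \<Longrightarrow> (\<And>x. x \<in> S \<Longrightarrow> f x \<noteq> 0) \<Longrightarrow> smooth_on S (\<lambda>x. inverse (f x))"
  by (simp add: smooth_on_def Ck_on_inverse)

lemma smooth_on_sum:
  assumes "open S" "\<And>i. i \<in> I \<Longrightarrow> smooth_on S (f i)"
  shows "smooth_on S (\<lambda>x. \<Sum>i\<in>I. f i x)"
  using assms(2)
  by (induction I rule: infinite_finite_induct) (auto intro: smooth_on_const smooth_on_add[OF assms(1)])

lemma smooth_on_mult:
  fixes f g :: "'a::euclidean_space \<Rightarrow> 'b::real_normed_algebra"
  shows "open S \<Longrightarrow> smooth_on S f \<Longrightarrow> smooth_on S g \<Longrightarrow> smooth_on S (\<lambda>x. f x * g x)"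
  by (rule smooth_on_bilinear[OF bounded_bilinear_mult])

lemma smooth_on_prod:
  fixes f :: "'i \<Rightarrow> 'a::euclidean_space \<Rightarrow> 'b::real_normed_field"
  assumes "open S" "\<And>i. i \<in> I \<Longrightarrow> smooth_on S (f i)"
  shows "smooth_on S (\<lambda>x. \<Prod>i\<in>I. f i x)"
  using assms(2)
  by (induction I rule: infinite_finite_induct) (auto intro: smooth_on_const smooth_on_mult[OF assms(1)])

lemma smooth_on_vec:
  fixes f :: "'a::euclidean_space \<Rightarrow> 'b::real_normed_vector^'n"
  assumes "open S" "\<And>i. smooth_on S (\<lambda>x. f x $ i)"
  shows "smooth_on S f"
proof -
  have "bounded_linear (axis i :: 'b \<Rightarrow> 'b^'n)" for i
    by (rule bounded_linear_intro[of _ 1]) (auto simp: axis_def vec_eq_iff norm_vec_def L2_set_def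
        if_distrib[of norm] if_distrib[of "\<lambda>x. x\<^sup>2"] cong: if_cong)
  then have "smooth_on S (\<lambda>x. \<Sum>i\<in>UNIV. axis i (f x $ i))"
    by (intro smooth_on_sum assms smooth_on_bounded_linear[of "axis _"])
  moreover have "(\<Sum>i\<in>UNIV. axis i (y $ i)) = y" for y :: "'b^'n"
    by (simp add: vec_eq_iff axis_def)
  ultimately show ?thesis by simp
qed

section \<open>Maps on a subset that extend smoothly near each of its points\<close>

lemma smooth_mapE:
  assumes "smooth_map M f" "x \<in> M"
  obtains U F where "open U" "x \<in> U" "smooth_on U F" "\<And>y. y \<in> U \<Longrightarrow> y \<in> M \<Longrightarrow> F y = f y"
  using assms unfolding smooth_map_def by (metis IntI)

lemma smooth_mapI:
  assumes "\<And>x. x \<in> M \<Longrightarrow> \<exists>U F. open U \<and> x \<in> U \<and> smooth_on U F \<and> (\<forall>y\<in>U \<inter> M. F y = f y)"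
  shows "smooth_map M f"
  using assms unfolding smooth_map_def by blast

lemma smooth_map_smooth_on: "smooth_on U f \<Longrightarrow> open U \<Longrightarrow> M \<subseteq> U \<Longrightarrow> smooth_map M f"
  unfolding smooth_map_def by blast

lemma smooth_map_cong:
  "smooth_map M f \<Longrightarrow> (\<And>x. x \<in> M \<Longrightarrow> f x = g x) \<Longrightarrow> smooth_map M g"
  unfolding smooth_map_def by (metis IntD2)

text \<open>Each map comes with its own local extension around a point, so the operation is formed
  on the common neighbourhood. \<open>comb\<close> isolates what has to be known about the operation
  on open sets.\<close>

lemma smooth_map_combine:
  fixes M :: "'a::euclidean_space set"
  assumes "smooth_map M f" "smooth_map M g"
    and comb: "\<And>(U::'a set) F G. open U \<Longrightarrow> smooth_on U F \<Longrightarrow> smooth_on U G \<Longrightarrow> smooth_on U (\<lambda>x. h (F x) (G x))"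
  shows "smooth_map M (\<lambda>x. h (f x) (g x))"
proof (rule smooth_mapI)
  fix x assume x: "x \<in> M"
  obtain U F where U: "open U" "x \<in> U" "smooth_on U F" "\<And>y. y \<in> U \<Longrightarrow> y \<in> M \<Longrightarrow> F y = f y"
    using smooth_mapE[OF assms(1) x] by metis
  obtain V G where V: "open V" "x \<in> V" "smooth_on V G" "\<And>y. y \<in> V \<Longrightarrow> y \<in> M \<Longrightarrow> G y = g y"
    using smooth_mapE[OF assms(2) x] by metis
  have "smooth_on (U \<inter> V) (\<lambda>x. h (F x) (G x))"
    by (rule comb) (use U V in \<open>auto intro: smooth_on_subset\<close>)
  with U V show "\<exists>U F. open U \<and> x \<in> U \<and> smooth_on U F \<and> (\<forall>y\<in>U \<inter> M. F y = h (f y) (g y))"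
    by (intro exI[of _ "U \<inter> V"] exI[of _ "\<lambda>x. h (F x) (G x)"]) auto
qed

lemma smooth_map_const: "smooth_map M (\<lambda>x. c)"
  by (rule smooth_map_smooth_on[of UNIV]) (auto intro: smooth_on_const)

lemma smooth_map_add:
  "smooth_map M f \<Longrightarrow> smooth_map M g \<Longrightarrow> smooth_map M (\<lambda>x. f x + g x)"
  by (erule (1) smooth_map_combine) (rule smooth_on_add)

lemma smooth_map_bilinear:
  "bounded_bilinear B \<Longrightarrow> smooth_map M f \<Longrightarrow> smooth_map M g \<Longrightarrow> smooth_map M (\<lambda>x. B (f x) (g x))"
  by (rule smooth_map_combine) (auto intro: smooth_on_bilinear)

lemmas smooth_map_mult = smooth_map_bilinear[OF bounded_bilinear_mult]
lemmas smooth_map_scaleR = smooth_map_bilinear[OF bounded_bilinear_scaleR]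

lemma smooth_map_bounded_linear:
  "bounded_linear L \<Longrightarrow> smooth_map M f \<Longrightarrow> smooth_map M (\<lambda>x. L (f x))"
  by (rule smooth_map_combine[where g = f]) (auto intro: smooth_on_bounded_linear)

lemma smooth_map_sum:
  "(\<And>i. i \<in> I \<Longrightarrow> smooth_map M (f i)) \<Longrightarrow> smooth_map M (\<lambda>x. \<Sum>i\<in>I. f i x)"
  by (induction I rule: infinite_finite_induct) (auto intro: smooth_map_const smooth_map_add)

lemma smooth_map_power:
  fixes f :: "'a::euclidean_space \<Rightarrow> 'b::real_normed_algebra_1"
  shows "smooth_map M f \<Longrightarrow> smooth_map M (\<lambda>x. f x ^ k)"
  by (induction k) (auto intro: smooth_map_const smooth_map_mult)

text \<open>The local extension may vanish off \<open>M\<close>; its zeros are cut away from the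
  neighbourhood.\<close>

lemma smooth_map_inverse:
  fixes f :: "'a::euclidean_space \<Rightarrow> 'b::real_normed_field"
  assumes "smooth_map M f" "\<And>x. x \<in> M \<Longrightarrow> f x \<noteq> 0"
  shows "smooth_map M (\<lambda>x. inverse (f x))"
proof (rule smooth_mapI)
  fix x assume x: "x \<in> M"
  obtain U F where U: "open U" "x \<in> U" "smooth_on U F" "\<And>y. y \<in> U \<Longrightarrow> y \<in> M \<Longrightarrow> F y = f y"
    using smooth_mapE[OF assms(1) x] by metis
  let ?V = "U \<inter> F -` (- {0})"
  have "open ?V"
    using U by (intro continuous_open_preimage smooth_on_imp_continuous_on) auto
  moreover have "smooth_on ?V (\<lambda>x. inverse (F x))"
    using \<open>open ?V\<close> U by (intro smooth_on_inverse) (auto intro: smooth_on_subset)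
  ultimately show "\<exists>U G. open U \<and> x \<in> U \<and> smooth_on U G \<and> (\<forall>y\<in>U \<inter> M. G y = inverse (f y))"
    using U x assms(2) by (intro exI[of _ ?V] exI[of _ "\<lambda>x. inverse (F x)"]) auto
qed

section \<open>Differentials along a submanifold\<close>

text \<open>The chain rule gives \<open>F' v\<close> along every admissible curve, for one local
  extension \<open>F\<close>. Membership in the tangent space supplies at least one curve, which
  makes the value of the \<open>THE\<close> unique.\<close>

lemma diff_along_eq:
  assumes v: "v \<in> tangent_space M x" and U: "open U" "x \<in> U"
    and F: "(F has_derivative F') (at x)" "\<And>y. y \<in> U \<Longrightarrow> y \<in> M \<Longrightarrow> F y = f y"
  shows "diff_along M f x v = F' v"
proof -
  have der: "((\<lambda>t. f (\<gamma> t)) has_vector_derivative F' v) (at 0)" if \<gamma>: "curve_through M x v \<gamma>" for \<gamma>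
  proof -
    obtain e where e: "e > 0" "\<gamma> ` {-e<..<e} \<subseteq> M" and x: "\<gamma> 0 = x"
      and \<gamma>': "(\<gamma> has_derivative (\<lambda>t. t *\<^sub>R v)) (at 0)"
      using \<gamma> unfolding curve_through_def has_vector_derivative_def by blast
    have "((\<lambda>t. F (\<gamma> t)) has_derivative (\<lambda>t. F' (t *\<^sub>R v))) (at 0)"
      using has_derivative_compose[OF \<gamma>', of F F'] F(1) x by simp
    moreover have "(\<lambda>t. F' (t *\<^sub>R v)) = (\<lambda>t. t *\<^sub>R F' v)"
      using has_derivative_linear[OF F(1)] by (simp add: linear_scale)
    ultimately have "((\<lambda>t. F (\<gamma> t)) has_derivative (\<lambda>t. t *\<^sub>R F' v)) (at 0)" by simp
    \<comment> \<open>\<open>F\<close> and \<open>f\<close> agree only on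
      \<open>U \<inter> M\<close>, so the curve has to stay in \<open>U\<close> for small
      \<open>t\<close>; continuity ensures this.\<close>
    moreover have "eventually (\<lambda>t. F (\<gamma> t) = f (\<gamma> t)) (nhds 0)"
    proof -
      have "isCont \<gamma> 0" using \<gamma>' has_derivative_continuous by blast
      then have "eventually (\<lambda>t. \<gamma> t \<in> U) (nhds 0)"
        using U x by (simp add: continuous_at_open eventually_nhds)
      moreover have "eventually (\<lambda>t. t \<in> {-e<..<e}) (nhds (0::real))"
        using e by (intro eventually_nhds_in_open) auto
      ultimately show ?thesis by eventually_elim (rule F(2), use e(2) in auto)
    qed
    ultimately show ?thesis
      unfolding has_vector_derivative_def
      by (elim has_derivative_transform_eventually)
        (auto simp: eventually_at_filter dest: eventually_nhds_x_imp_x elim: eventually_mono)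
  qed
  obtain \<gamma> where \<gamma>: "curve_through M x v \<gamma>" using v by (auto simp: tangent_space_def)
  show ?thesis unfolding diff_along_def
  proof (rule the_equality)
    show "d = F' v"
      if "\<forall>\<gamma>. curve_through M x v \<gamma> \<longrightarrow> ((\<lambda>t. f (\<gamma> t)) has_vector_derivative d) (at 0)" for d
      using that \<gamma> der[OF \<gamma>] vector_derivative_unique_at by metis
  qed (use der in simp)
qed

lemma diff_along_smooth_on:
  "v \<in> tangent_space M x \<Longrightarrow> open U \<Longrightarrow> x \<in> U \<Longrightarrow> smooth_on U f \<Longrightarrow>
    diff_along M f x v = frechet_derivative f (at x) v"
  by (rule diff_along_eq) (auto intro: smooth_on_has_derivative)

text \<open>One linear map \<open>F'\<close> represents the differential on the whole tangent space,
  so rules for \<open>diff_along\<close> reduce to rules for \<open>has_derivative\<close>.\<close>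

lemma smooth_map_has_derivative:
  assumes "smooth_map M f" "x \<in> M"
  obtains U F F' where "open U" "x \<in> U" "(F has_derivative F') (at x)"
    "\<And>y. y \<in> U \<Longrightarrow> y \<in> M \<Longrightarrow> F y = f y"
    "\<And>v. v \<in> tangent_space M x \<Longrightarrow> diff_along M f x v = F' v"
proof -
  obtain U F where U: "open U" "x \<in> U" "smooth_on U F" "\<And>y. y \<in> U \<Longrightarrow> y \<in> M \<Longrightarrow> F y = f y"
    using smooth_mapE[OF assms] by metis
  have F': "(F has_derivative frechet_derivative F (at x)) (at x)"
    using U by (intro smooth_on_has_derivative)
  show thesis
    by (rule that[OF U(1,2) F' U(4)]) (auto intro: diff_along_eq[OF _ U(1,2) F' U(4)])
qed

text \<open>This is how identities that hold only on the manifold, such as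
  \<open>P y (V y) = V y\<close> or \<open>det z = 1\<close>, enter a differentiation.\<close>

lemma diff_along_cong:
  assumes "smooth_map M f" "x \<in> M" "v \<in> tangent_space M x" "\<And>y. y \<in> M \<Longrightarrow> f y = h y"
  shows "diff_along M h x v = diff_along M f x v"
proof (rule smooth_map_has_derivative[OF assms(1,2)])
  fix U F F'
  assume "open U" "x \<in> U" "(F has_derivative F') (at x)" "\<And>y. y \<in> U \<Longrightarrow> y \<in> M \<Longrightarrow> F y = f y"
    and f': "\<And>v. v \<in> tangent_space M x \<Longrightarrow> diff_along M f x v = F' v"
  then have "diff_along M h x v = F' v"
    using assms(4) by (intro diff_along_eq[OF assms(3), of U F]) auto
  with f' assms(3) show ?thesis by simp
qed

lemma diff_along_const: "v \<in> tangent_space M x \<Longrightarrow> diff_along M (\<lambda>y. c) x v = 0"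
  by (rule diff_along_eq[of _ _ _ UNIV "\<lambda>y. c"]) auto

lemma diff_along_bilinear:
  assumes B: "bounded_bilinear B" and fh: "smooth_map M f" "smooth_map M h"
    and x: "x \<in> M" "v \<in> tangent_space M x"
  shows "diff_along M (\<lambda>y. B (f y) (h y)) x v =
    B (f x) (diff_along M h x v) + B (diff_along M f x v) (h x)"
proof (rule smooth_map_has_derivative[OF fh(1) x(1)], rule smooth_map_has_derivative[OF fh(2) x(1)])
  fix U F F' V H H'
  assume F: "open U" "x \<in> U" "(F has_derivative F') (at x)" "\<And>y. y \<in> U \<Longrightarrow> y \<in> M \<Longrightarrow> F y = f y"
    and f': "\<And>v. v \<in> tangent_space M x \<Longrightarrow> diff_along M f x v = F' v"
    and H: "open V" "x \<in> V" "(H has_derivative H') (at x)" "\<And>y. y \<in> V \<Longrightarrow> y \<in> M \<Longrightarrow> H y = h y"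
    and h': "\<And>v. v \<in> tangent_space M x \<Longrightarrow> diff_along M h x v = H' v"
  have "diff_along M (\<lambda>y. B (f y) (h y)) x v = B (F x) (H' v) + B (F' v) (H x)"
    by (rule diff_along_eq[OF x(2), of "U \<inter> V" "\<lambda>y. B (F y) (H y)"])
      (use F H in \<open>auto intro: bounded_bilinear.FDERIV[OF B]\<close>)
  then show ?thesis using F H f' h' x by simp
qed

lemma diff_along_bounded_linear:
  assumes L: "bounded_linear L" and f: "smooth_map M f"
    and x: "x \<in> M" "v \<in> tangent_space M x"
  shows "diff_along M (\<lambda>y. L (f y)) x v = L (diff_along M f x v)"
proof (rule smooth_map_has_derivative[OF f x(1)])
  fix U F F'
  assume F: "open U" "x \<in> U" "(F has_derivative F') (at x)" "\<And>y. y \<in> U \<Longrightarrow> y \<in> M \<Longrightarrow> F y = f y"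
    and f': "\<And>v. v \<in> tangent_space M x \<Longrightarrow> diff_along M f x v = F' v"
  have "diff_along M (\<lambda>y. L (f y)) x v = L (F' v)"
    by (rule diff_along_eq[OF x(2), of U "\<lambda>y. L (F y)"])
      (use F in \<open>auto intro: bounded_linear.has_derivative[OF L]\<close>)
  then show ?thesis using f' x by simp
qed

lemma diff_along_add:
  assumes fh: "smooth_map M f" "smooth_map M h" and x: "x \<in> M" "v \<in> tangent_space M x"
  shows "diff_along M (\<lambda>y. f y + h y) x v = diff_along M f x v + diff_along M h x v"
proof (rule smooth_map_has_derivative[OF fh(1) x(1)], rule smooth_map_has_derivative[OF fh(2) x(1)])
  fix U F F' V H H'
  assume F: "open U" "x \<in> U" "(F has_derivative F') (at x)" "\<And>y. y \<in> U \<Longrightarrow> y \<in> M \<Longrightarrow> F y = f y"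
    and f': "\<And>v. v \<in> tangent_space M x \<Longrightarrow> diff_along M f x v = F' v"
    and H: "open V" "x \<in> V" "(H has_derivative H') (at x)" "\<And>y. y \<in> V \<Longrightarrow> y \<in> M \<Longrightarrow> H y = h y"
    and h': "\<And>v. v \<in> tangent_space M x \<Longrightarrow> diff_along M h x v = H' v"
  have "diff_along M (\<lambda>y. f y + h y) x v = F' v + H' v"
    by (rule diff_along_eq[OF x(2), of "U \<inter> V" "\<lambda>y. F y + H y"])
      (use F H in \<open>auto intro: has_derivative_add\<close>)
  then show ?thesis using f' h' x by simp
qed

lemma diff_along_sum:
  assumes f: "\<And>i. i \<in> I \<Longrightarrow> smooth_map M (f i)" and x: "x \<in> M" "v \<in> tangent_space M x"
  shows "diff_along M (\<lambda>y. \<Sum>i\<in>I. f i y) x v = (\<Sum>i\<in>I. diff_along M (f i) x v)"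
  using f
proof (induction I rule: infinite_finite_induct)
  case (insert i I)
  then show ?case by (simp add: diff_along_add x smooth_map_sum)
qed (auto simp: diff_along_const x)

text \<open>Smoothness of \<open>frechet_derivative\<close> is known for a fixed direction. The
  moving direction \<open>V y\<close> is therefore expanded in the ambient basis, with smooth
  coefficients.\<close>

lemma diff_along_smooth_map:
  assumes f: "smooth_map M f" and V: "V \<in> vector_fields M"
  shows "smooth_map M (\<lambda>x. diff_along M f x (V x))"
proof (rule smooth_mapI)
  fix x assume x: "x \<in> M"
  have V': "smooth_map M V" "\<And>y. y \<in> M \<Longrightarrow> V y \<in> tangent_space M y"
    using V by (auto simp: vector_fields_def)
  obtain U F where U: "open U" "x \<in> U" "smooth_on U F" "\<And>y. y \<in> U \<Longrightarrow> y \<in> M \<Longrightarrow> F y = f y"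
    using smooth_mapE[OF f x] by metis
  obtain U' G where U': "open U'" "x \<in> U'" "smooth_on U' G"
      "\<And>y. y \<in> U' \<Longrightarrow> y \<in> M \<Longrightarrow> G y = V y"
    using smooth_mapE[OF V'(1) x] by metis
  let ?h = "\<lambda>y. \<Sum>b\<in>Basis. (G y \<bullet> b) *\<^sub>R frechet_derivative F (at y) b"
  have op: "open (U \<inter> U')" using U U' by auto
  have "smooth_on (U \<inter> U') ?h"
    using U(3) U'(3) by (intro smooth_on_sum op smooth_on_bilinear[OF bounded_bilinear_scaleR]
      smooth_on_bounded_linear[OF bounded_linear_inner_left] smooth_on_frechet_derivative)
      (auto intro: smooth_on_subset)
  moreover have "?h y = diff_along M f y (V y)" if y: "y \<in> U \<inter> U' \<inter> M" for y
  proof -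
    have F': "(F has_derivative frechet_derivative F (at y)) (at y)"
      using U y by (intro smooth_on_has_derivative) auto
    have "diff_along M f y (V y) = frechet_derivative F (at y) (V y)"
      using U y V' by (intro diff_along_eq[OF _ U(1) _ F']) auto
    also have "\<dots> = frechet_derivative F (at y) (\<Sum>b\<in>Basis. (V y \<bullet> b) *\<^sub>R b)"
      by (simp add: euclidean_representation)
    also have "\<dots> = ?h y"
      using has_derivative_linear[OF F'] U' y by (simp add: linear_sum linear_scale)
    finally show ?thesis ..
  qed
  ultimately show "\<exists>U F. open U \<and> x \<in> U \<and> smooth_on U F \<and>
      (\<forall>y\<in>U \<inter> M. F y = diff_along M f y (V y))"
    using U U' op by (intro exI[of _ "U \<inter> U'"] exI[of _ ?h]) auto
qed

section \<open>The Levi-Civita connection of an embedded submanifold\<close>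

text \<open>The defect of the expansion lies in the span of \<open>B\<close> and is orthogonal to
  \<open>B\<close>, hence to itself.\<close>

lemma orthonormal_expansion:
  fixes B :: "'a::euclidean_space set"
  assumes on: "\<And>b c. b \<in> B \<Longrightarrow> c \<in> B \<Longrightarrow> b \<bullet> c = (if b = c then 1 else 0)" and w: "w \<in> span B"
  shows "w = (\<Sum>e\<in>B. (w \<bullet> e) *\<^sub>R e)"
proof -
  have "pairwise orthogonal B"
    unfolding pairwise_def orthogonal_def using on by presburger
  then have fin: "finite B" by (rule pairwise_orthogonal_imp_finite)
  let ?u = "w - (\<Sum>e\<in>B. (w \<bullet> e) *\<^sub>R e)"
  have "?u \<in> span B"
    by (intro span_diff span_sum span_scale w span_base)
  moreover have "orthogonal ?u b" if b: "b \<in> B" for b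
  proof -
    have "(\<Sum>e\<in>B. (w \<bullet> e) *\<^sub>R e) \<bullet> b = (\<Sum>e\<in>B. if e = b then w \<bullet> b else 0)"
      unfolding inner_sum_left by (rule sum.cong) (use on[OF _ b] in auto)
    then show ?thesis using b fin by (simp add: orthogonal_def inner_diff_left)
  qed
  ultimately have "orthogonal ?u ?u" by (rule orthogonal_to_span)
  then show ?thesis by (simp add: orthogonal_self)
qed

lemma orthonormal_basis_at_inner:
  assumes g: "\<And>v w. g x v w = v \<bullet> w" and T: "subspace (tangent_space M x)"
  shows "\<exists>B. orthonormal_basis_at M g x B"
proof (rule orthonormal_basis_subspace[OF T])
  fix B
  assume B: "pairwise orthogonal B" "\<And>b. b \<in> B \<Longrightarrow> norm b = 1" "span B = tangent_space M x"
  have "b \<bullet> c = (if b = c then 1 else 0)" if "b \<in> B" "c \<in> B" for b c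
    using B(1) B(2)[OF that(1)] that unfolding pairwise_def orthogonal_def norm_eq_1 by auto
  then show ?thesis using B(3) by (auto simp: orthonormal_basis_at_def g)
qed

text \<open>For tangent \<open>v\<close> and \<open>w\<close>, the derivative of
  \<open>P y w\<close> at \<open>x\<close> along \<open>v\<close> is the value of the second
  fundamental form. Its symmetry is a general fact on submanifolds; it is an assumption here because
  an explicit \<open>P\<close> lets it be read off. Smoothness on the whole ambient space spares the
  choice of extensions of \<open>P\<close>.\<close>

locale embedded_manifold =
  fixes M :: "'a::euclidean_space set"
    and g :: "'a \<Rightarrow> 'a \<Rightarrow> 'a \<Rightarrow> real"
    and P :: "'a \<Rightarrow> 'a \<Rightarrow> 'a"
  assumes metric: "x \<in> M \<Longrightarrow> g x v w = v \<bullet> w"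
    and tangent: "x \<in> M \<Longrightarrow> tangent_space M x = {v. P x v = v}"
    and P_idem: "x \<in> M \<Longrightarrow> P x (P x v) = P x v"
    and P_selfadjoint: "x \<in> M \<Longrightarrow> P x v \<bullet> w = v \<bullet> P x w"
    and P_linear: "linear (P x)"
    and P_smooth: "smooth_on UNIV (\<lambda>x. P x v)"
    and second_fundamental_form_sym: "x \<in> M \<Longrightarrow> P x v = v \<Longrightarrow> P x w = w \<Longrightarrow>
      frechet_derivative (\<lambda>y. P y w) (at x) v = frechet_derivative (\<lambda>y. P y v) (at x) w"
begin

lemma P_tangent: "x \<in> M \<Longrightarrow> P x v \<in> tangent_space M x"
  by (simp add: tangent P_idem)

lemma tangent_subspace: "x \<in> M \<Longrightarrow> subspace (tangent_space M x)"
  using P_linear[of x] by (auto simp: tangent subspace_def linear_add linear_scale linear_0)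

lemma P_expand: "P x v = (\<Sum>b\<in>Basis. (v \<bullet> b) *\<^sub>R P x b)"
proof -
  have "P x v = P x (\<Sum>b\<in>Basis. (v \<bullet> b) *\<^sub>R b)" by (simp add: euclidean_representation)
  also have "\<dots> = (\<Sum>b\<in>Basis. (v \<bullet> b) *\<^sub>R P x b)"
    by (simp add: linear_sum[OF P_linear] linear_scale[OF P_linear])
  finally show ?thesis .
qed

lemma P_smooth_map: "smooth_map M (\<lambda>x. P x v)"
  by (rule smooth_map_smooth_on[OF P_smooth]) auto

lemma P_vector_field:
  assumes "smooth_map M V"
  shows "(\<lambda>x. P x (V x)) \<in> vector_fields M"
proof -
  have "smooth_map M (\<lambda>x. P x (V x))"
    by (subst P_expand) (intro smooth_map_sum smooth_map_scaleR P_smooth_map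
        smooth_map_bounded_linear[OF bounded_linear_inner_left] assms)
  then show ?thesis by (auto simp: vector_fields_def P_tangent)
qed

lemma vector_fieldD:
  assumes "V \<in> vector_fields M"
  shows "smooth_map M V" "x \<in> M \<Longrightarrow> V x \<in> tangent_space M x" "x \<in> M \<Longrightarrow> P x (V x) = V x"
  using assms by (auto simp: vector_fields_def tangent)

lemma diff_along_linear:
  assumes f: "smooth_map M f" and x: "x \<in> M"
    and uv: "u \<in> tangent_space M x" "v \<in> tangent_space M x"
  shows "diff_along M f x (r *\<^sub>R u + s *\<^sub>R v) = r *\<^sub>R diff_along M f x u + s *\<^sub>R diff_along M f x v"
proof (rule smooth_map_has_derivative[OF f x])
  fix U F F'
  assume F: "(F has_derivative F') (at x)"
    and f': "\<And>v. v \<in> tangent_space M x \<Longrightarrow> diff_along M f x v = F' v"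
  have "r *\<^sub>R u + s *\<^sub>R v \<in> tangent_space M x"
    using tangent_subspace[OF x] uv by (simp add: subspace_add subspace_scale)
  then show ?thesis
    using has_derivative_linear[OF F] f' uv by (simp add: linear_add linear_scale)
qed

lemma diff_along_P_expand:
  assumes f: "smooth_map M f" and x: "x \<in> M"
  shows "diff_along M f x (P x v) = (\<Sum>b\<in>Basis. (v \<bullet> b) *\<^sub>R diff_along M f x (P x b))"
proof (rule smooth_map_has_derivative[OF f x])
  fix U F F'
  assume F: "(F has_derivative F') (at x)"
    and f': "\<And>v. v \<in> tangent_space M x \<Longrightarrow> diff_along M f x v = F' v"
  have "F' (P x v) = (\<Sum>b\<in>Basis. (v \<bullet> b) *\<^sub>R F' (P x b))"
    using has_derivative_linear[OF F] by (subst P_expand) (simp add: linear_sum linear_scale)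
  then show ?thesis by (simp add: f' P_tangent[OF x])
qed

lemma second_fundamental_form_expand:
  "frechet_derivative (\<lambda>y. P y w) (at x) v =
    (\<Sum>b\<in>Basis. (w \<bullet> b) *\<^sub>R frechet_derivative (\<lambda>y. P y b) (at x) v)"
proof -
  have "((\<lambda>y. P y b) has_derivative frechet_derivative (\<lambda>y. P y b) (at x)) (at x)" for b
    using smooth_on_has_derivative[OF P_smooth] by blast
  then have "((\<lambda>y. \<Sum>b\<in>Basis. (w \<bullet> b) *\<^sub>R P y b) has_derivative
      (\<lambda>v. \<Sum>b\<in>Basis. (w \<bullet> b) *\<^sub>R frechet_derivative (\<lambda>y. P y b) (at x) v)) (at x)"
    by (intro has_derivative_sum has_derivative_scaleR_right)
  then have "((\<lambda>y. P y w) has_derivative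
      (\<lambda>v. \<Sum>b\<in>Basis. (w \<bullet> b) *\<^sub>R frechet_derivative (\<lambda>y. P y b) (at x) v)) (at x)"
    by (simp flip: P_expand)
  from frechet_derivative_at[OF this] show ?thesis by metis
qed

text \<open>Differentiating \<open>V y = P y (V y)\<close> yields the Gauss formula: the second
  fundamental form as normal part, plus the tangent part.\<close>

lemma diff_along_vector_field:
  assumes V: "V \<in> vector_fields M" and x: "x \<in> M" and v: "v \<in> tangent_space M x"
  shows "diff_along M V x v =
    frechet_derivative (\<lambda>y. P y (V x)) (at x) v + P x (diff_along M V x v)"
proof -
  note V' = vector_fieldD[OF V]
  have sm: "smooth_map M (\<lambda>y. (V y \<bullet> b) *\<^sub>R P y b)" for b
    by (intro smooth_map_scaleR P_smooth_map smooth_map_bounded_linear[OF bounded_linear_inner_left] V')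
  have "diff_along M V x v = diff_along M (\<lambda>y. \<Sum>b\<in>Basis. (V y \<bullet> b) *\<^sub>R P y b) x v"
    by (rule diff_along_cong[OF V'(1) x v, symmetric]) (simp add: V' flip: P_expand)
  also have "\<dots> = (\<Sum>b\<in>Basis. diff_along M (\<lambda>y. (V y \<bullet> b) *\<^sub>R P y b) x v)"
    by (rule diff_along_sum[OF sm x v])
  also have "\<dots> = (\<Sum>b\<in>Basis. (V x \<bullet> b) *\<^sub>R frechet_derivative (\<lambda>y. P y b) (at x) v +
      (diff_along M V x v \<bullet> b) *\<^sub>R P x b)"
  proof (rule sum.cong[OF refl])
    fix b :: 'a
    have "diff_along M (\<lambda>y. (V y \<bullet> b) *\<^sub>R P y b) x v =
      (V x \<bullet> b) *\<^sub>R diff_along M (\<lambda>y. P y b) x v + diff_along M (\<lambda>y. V y \<bullet> b) x v *\<^sub>R P x b"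
      by (intro diff_along_bilinear[OF bounded_bilinear_scaleR _ _ x v] P_smooth_map
          smooth_map_bounded_linear[OF bounded_linear_inner_left] V')
    then show "diff_along M (\<lambda>y. (V y \<bullet> b) *\<^sub>R P y b) x v =
      (V x \<bullet> b) *\<^sub>R frechet_derivative (\<lambda>y. P y b) (at x) v + (diff_along M V x v \<bullet> b) *\<^sub>R P x b"
      by (simp add: diff_along_bounded_linear[OF bounded_linear_inner_left V'(1) x v]
          diff_along_smooth_on[OF v open_UNIV _ P_smooth])
  qed
  also have "\<dots> = frechet_derivative (\<lambda>y. P y (V x)) (at x) v + P x (diff_along M V x v)"
    by (simp only: sum.distrib flip: P_expand second_fundamental_form_expand)
  finally show ?thesis .
qed

text \<open>The normal parts of the two derivatives agree by symmetry of the second fundamental form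
  and cancel in the bracket.\<close>

lemma P_lie_bracket:
  assumes V: "V \<in> vector_fields M" and W: "W \<in> vector_fields M" and x: "x \<in> M"
  shows "P x (diff_along M W x (V x)) - P x (diff_along M V x (W x)) = lie_bracket M V W x"
proof -
  have "diff_along M W x (V x) - P x (diff_along M W x (V x)) =
      frechet_derivative (\<lambda>y. P y (W x)) (at x) (V x)"
    using diff_along_vector_field[OF W x vector_fieldD(2)[OF V x]] by (simp only: diff_eq_eq)
  also have "\<dots> = frechet_derivative (\<lambda>y. P y (V x)) (at x) (W x)"
    by (rule second_fundamental_form_sym[OF x vector_fieldD(3)[OF V x] vector_fieldD(3)[OF W x]])
  also have "\<dots> = diff_along M V x (W x) - P x (diff_along M V x (W x))"
    using diff_along_vector_field[OF V x vector_fieldD(2)[OF W x]] by (simp only: eq_diff_eq)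
  finally show ?thesis by (simp add: lie_bracket_def algebra_simps)
qed

lemma diff_along_metric:
  assumes V: "smooth_map M V" and W: "smooth_map M W" and x: "x \<in> M" "v \<in> tangent_space M x"
  shows "diff_along M (\<lambda>y. g y (V y) (W y)) x v = V x \<bullet> diff_along M W x v + diff_along M V x v \<bullet> W x"
proof -
  have "diff_along M (\<lambda>y. g y (V y) (W y)) x v = diff_along M (\<lambda>y. V y \<bullet> W y) x v"
    by (rule diff_along_cong[OF smooth_map_bilinear[OF bounded_bilinear_inner V W] x])
      (simp add: metric)
  then show ?thesis by (simp add: diff_along_bilinear[OF bounded_bilinear_inner V W x])
qed

lemma P_inner: "x \<in> M \<Longrightarrow> w \<in> tangent_space M x \<Longrightarrow> P x v \<bullet> w = v \<bullet> w"
  by (simp add: P_selfadjoint tangent)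

lemma is_levi_civita_projection:
  "is_levi_civita M g (\<lambda>x v Y. P x (diff_along M Y x v))"
  unfolding is_levi_civita_def
proof (intro conjI allI ballI impI)
  fix X Y assume "X \<in> vector_fields M" "Y \<in> vector_fields M"
  then show "smooth_map M (\<lambda>x. P x (diff_along M Y x (X x)))"
    by (intro vector_fieldD P_vector_field diff_along_smooth_map)
next
  fix f :: "'a \<Rightarrow> real" and Y x v
  assume f: "smooth_map M f" and Y: "Y \<in> vector_fields M"
    and x: "x \<in> M" "v \<in> tangent_space M x"
  show "P x (diff_along M (\<lambda>y. f y *\<^sub>R Y y) x v) =
      diff_along M f x v *\<^sub>R Y x + f x *\<^sub>R P x (diff_along M Y x v)"
    using diff_along_bilinear[OF bounded_bilinear_scaleR f vector_fieldD(1)[OF Y] x]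
    by (simp add: linear_add[OF P_linear] linear_scale[OF P_linear] vector_fieldD(3)[OF Y x(1)])
next
  fix Y Z x v
  assume "Y \<in> vector_fields M" "Z \<in> vector_fields M" "x \<in> M" "v \<in> tangent_space M x"
  then show "diff_along M (\<lambda>y. g y (Y y) (Z y)) x v =
      g x (P x (diff_along M Y x v)) (Z x) + g x (Y x) (P x (diff_along M Z x v))"
    by (simp add: diff_along_metric vector_fieldD metric P_inner inner_commute[of "Y x"])
qed (simp_all add: P_tangent diff_along_linear diff_along_add vector_fieldD P_lie_bracket
    linear_add[OF P_linear] linear_scale[OF P_linear])

text \<open>The difference of two Levi-Civita connections is symmetric in its first two arguments by
  torsion-freeness and skew in its last two by metric compatibility, so it vanishes.\<close>

lemma is_levi_civita_unique:
  assumes D: "is_levi_civita M g D" and D': "is_levi_civita M g D'"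
    and Y: "Y \<in> vector_fields M" and x: "x \<in> M" and v: "v \<in> tangent_space M x"
  shows "D x v Y = D' x v Y"
proof -
  define S where "S X Y Z = g x (D x (X x) Y - D' x (X x) Y) (Z x)" for X Y and Z :: "'a \<Rightarrow> 'a"
  have tan: "E x (X x) Y \<in> tangent_space M x"
    if E: "is_levi_civita M g E" and X: "X \<in> vector_fields M" and Y: "Y \<in> vector_fields M" for E X Y
  proof -
    have "\<forall>Y\<in>vector_fields M. \<forall>x\<in>M. \<forall>v\<in>tangent_space M x. E x v Y \<in> tangent_space M x"
      using E unfolding is_levi_civita_def by (elim conjE)
    then show ?thesis using vector_fieldD(2)[OF X x] Y x by blast
  qed
  have tor: "E x (X x) Y - E x (Y x) X = lie_bracket M X Y x"
    if E: "is_levi_civita M g E" and XY: "X \<in> vector_fields M" "Y \<in> vector_fields M" for E X Y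
  proof -
    have "\<forall>X\<in>vector_fields M. \<forall>Y\<in>vector_fields M. \<forall>x\<in>M.
        E x (X x) Y - E x (Y x) X = lie_bracket M X Y x"
      using E unfolding is_levi_civita_def by (elim conjE)
    then show ?thesis using XY x by blast
  qed
  have comp: "diff_along M (\<lambda>y. g y (Y y) (Z y)) x (X x) = g x (E x (X x) Y) (Z x) + g x (Y x) (E x (X x) Z)"
    if E: "is_levi_civita M g E" and X: "X \<in> vector_fields M"
      and YZ: "Y \<in> vector_fields M" "Z \<in> vector_fields M" for E X Y Z
  proof -
    have "\<forall>Y\<in>vector_fields M. \<forall>Z\<in>vector_fields M. \<forall>x\<in>M. \<forall>v\<in>tangent_space M x.
        diff_along M (\<lambda>y. g y (Y y) (Z y)) x v = g x (E x v Y) (Z x) + g x (Y x) (E x v Z)"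
      using E unfolding is_levi_civita_def by (elim conjE)
    then show ?thesis using vector_fieldD(2)[OF X x] YZ x by blast
  qed
  have sym: "S X Y Z = S Y X Z" if "X \<in> vector_fields M" "Y \<in> vector_fields M" for X Y Z
  proof -
    have "D x (X x) Y - D' x (X x) Y = D x (Y x) X - D' x (Y x) X"
      using tor[OF D that] tor[OF D' that] by (simp add: algebra_simps)
    then show ?thesis by (simp add: S_def)
  qed
  have skew: "S X Y Z = - S X Z Y"
    if "X \<in> vector_fields M" "Y \<in> vector_fields M" "Z \<in> vector_fields M" for X Y Z
    using comp[OF D that] comp[OF D' that] x
    by (simp add: S_def metric inner_diff_left inner_diff_right inner_commute)
  \<comment> \<open>Projected constant vectors are smooth tangent fields with the prescribed values
    \<open>v\<close> and \<open>D x v Y - D' x v Y\<close> at \<open>x\<close>; thus the pointwise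
    claim becomes one about fields.\<close>
  define X where "X = (\<lambda>y. P y v)"
  define Z where "Z = (\<lambda>y. P y (D x v Y - D' x v Y))"
  have X: "X \<in> vector_fields M" and Z: "Z \<in> vector_fields M"
    unfolding X_def Z_def by (auto intro: P_vector_field smooth_map_const)
  have Xx: "X x = v" using x v by (simp add: X_def tangent)
  have Zx: "Z x = D x v Y - D' x v Y"
    using tan[OF D X Y] tan[OF D' X Y] x tangent_subspace[OF x]
    by (simp add: Xx Z_def tangent linear_diff[OF P_linear])
  \<comment> \<open>Three symmetric and three skew exchanges, taken alternately, lead back to
    \<open>S X Y Z\<close> with the opposite sign.\<close>
  have "S X Y Z = 0"
    using sym[OF X Y, of Z] skew[OF Y X Z] sym[OF Y Z, of X] skew[OF Z Y X] sym[OF Z X, of Y]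
      skew[OF X Z Y] by simp
  then show ?thesis using x by (simp add: S_def Xx Zx metric)
qed

lemma levi_civita_eq:
  "Y \<in> vector_fields M \<Longrightarrow> x \<in> M \<Longrightarrow> v \<in> tangent_space M x \<Longrightarrow>
    levi_civita M g x v Y = P x (diff_along M Y x v)"
  unfolding levi_civita_def
  by (rule is_levi_civita_unique[OF someI[of "is_levi_civita M g", OF is_levi_civita_projection]
        is_levi_civita_projection])

text \<open>The projected basis vectors are a global smooth frame that is in general linearly
  dependent but satisfies Parseval's identity; an orthonormal tangent frame need not exist globally
  on a submanifold.\<close>

definition frame_deriv :: "'a \<Rightarrow> ('a \<Rightarrow> 'b::real_normed_vector) \<Rightarrow> 'a \<Rightarrow> 'b" where
  "frame_deriv c f x = diff_along M f x (P x c)"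

lemma frame_deriv_smooth: "smooth_map M f \<Longrightarrow> smooth_map M (frame_deriv c f)"
  unfolding frame_deriv_def
  by (intro diff_along_smooth_map P_vector_field smooth_map_const)

lemma frame_deriv_cong:
  "smooth_map M f \<Longrightarrow> x \<in> M \<Longrightarrow> (\<And>y. y \<in> M \<Longrightarrow> f y = h y) \<Longrightarrow> frame_deriv c h x = frame_deriv c f x"
  unfolding frame_deriv_def by (rule diff_along_cong) (auto intro: P_tangent)

lemma frame_deriv_sum_inner:
  "smooth_map M f \<Longrightarrow> x \<in> M \<Longrightarrow>
    (\<Sum>b\<in>Basis. frame_deriv b f x *\<^sub>R b) \<bullet> w = diff_along M f x (P x w)"
  by (subst diff_along_P_expand)
    (simp_all add: frame_deriv_def inner_sum_left mult.commute inner_commute[of w])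

lemma frame_deriv_sum_tangent:
  "smooth_map M f \<Longrightarrow> x \<in> M \<Longrightarrow> (\<Sum>b\<in>Basis. frame_deriv b f x *\<^sub>R b) \<in> tangent_space M x"
  by (simp add: tangent) (rule euclidean_eqI, simp add: P_selfadjoint frame_deriv_sum_inner P_idem,
      simp add: frame_deriv_def)

text \<open>A tangent vector G satisfies \<open>G \<bullet> b = G \<bullet> P x b\<close>, which for
  the gradient is the derivative along \<open>P x b\<close>.\<close>

lemma gradient_eq:
  assumes f: "smooth_map M f" and x: "x \<in> M"
  shows "gradient M g f x = (\<Sum>b\<in>Basis. frame_deriv b f x *\<^sub>R b)"
proof -
  let ?G = "\<Sum>b\<in>Basis. frame_deriv b f x *\<^sub>R b"
  note tan = frame_deriv_sum_tangent[OF f x]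
  have eq: "?G \<bullet> w = diff_along M f x w" if "w \<in> tangent_space M x" for w
    using frame_deriv_sum_inner[OF f x, of w] that by (simp add: tangent[OF x])
  show ?thesis unfolding gradient_def metric[OF x]
  proof (rule the_equality)
    fix v assume v: "v \<in> tangent_space M x \<and> (\<forall>w\<in>tangent_space M x. v \<bullet> w = diff_along M f x w)"
    have "v - ?G \<in> tangent_space M x"
      using v tan by (intro subspace_diff[OF tangent_subspace[OF x]]) auto
    then have "(v - ?G) \<bullet> (v - ?G) = 0"
      using v eq by (subst inner_diff_left) simp
    then show "v = ?G" by simp
  qed (use tan eq in auto)
qed

lemma gradient_vector_field:
  assumes f: "smooth_map M f"
  shows "gradient M g f \<in> vector_fields M"
proof -
  have "smooth_map M (\<lambda>x. \<Sum>b\<in>Basis. frame_deriv b f x *\<^sub>R b)"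
    by (intro smooth_map_sum smooth_map_scaleR frame_deriv_smooth f smooth_map_const)
  then show ?thesis
    unfolding vector_fields_def
    by (auto simp: gradient_eq[OF f] frame_deriv_sum_tangent[OF f] intro: smooth_map_cong)
qed

text \<open>A trace can be taken over an orthonormal basis of the tangent space or, with projections
  inserted, over the ambient one. This removes the basis chosen by \<open>SOME\<close>.\<close>

lemma divergence_eq:
  assumes V: "V \<in> vector_fields M" and x: "x \<in> M"
  shows "divergence M g V x = (\<Sum>b\<in>Basis. frame_deriv b V x \<bullet> b)"
proof -
  let ?T = "tangent_space M x"
  define B where "B = (SOME B. orthonormal_basis_at M g x B)"
  have B: "orthonormal_basis_at M g x B"
    unfolding B_def
    by (rule someI_ex, rule orthonormal_basis_at_inner)
      (simp_all add: metric x tangent_subspace)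
  then have span: "span B = ?T" unfolding orthonormal_basis_at_def by (rule conjunct1)
  have on: "b \<bullet> c = (if b = c then 1 else 0)" if "b \<in> B" "c \<in> B" for b c
    using B that unfolding orthonormal_basis_at_def metric[OF x] by blast
  have BT: "b \<in> ?T" if "b \<in> B" for b using span_base[OF that] span by simp
  have expand: "w = (\<Sum>e\<in>B. (w \<bullet> e) *\<^sub>R e)" if "w \<in> ?T" for w
    by (rule orthonormal_expansion[OF on]) (simp_all add: span that)
  have dV: "diff_along M V x w = (\<Sum>b\<in>Basis. (w \<bullet> b) *\<^sub>R frame_deriv b V x)" if "w \<in> ?T" for w
    using diff_along_P_expand[OF vector_fieldD(1)[OF V] x, of w] that
    by (simp add: frame_deriv_def tangent[OF x])
  \<comment> \<open>Expanding the tangent vector \<open>P x c\<close> in \<open>B\<close> replaces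
    the unknown basis by the projection.\<close>
  have coeff: "b \<bullet> (\<Sum>e\<in>B. (e \<bullet> c) *\<^sub>R e) = b \<bullet> P x c" for b c
  proof -
    have "P x c = (\<Sum>e\<in>B. (P x c \<bullet> e) *\<^sub>R e)" by (rule expand[OF P_tangent[OF x]])
    also have "\<dots> = (\<Sum>e\<in>B. (e \<bullet> c) *\<^sub>R e)"
      by (rule sum.cong) (simp_all only: P_inner[OF x BT] inner_commute[of c])
    finally show ?thesis by simp
  qed
  have "divergence M g V x = (\<Sum>e\<in>B. diff_along M V x e \<bullet> e)"
    unfolding divergence_def B_def[symmetric]
    by (rule sum.cong) (simp_all add: levi_civita_eq[OF V x BT] metric[OF x] P_inner[OF x BT])
  also have "\<dots> = (\<Sum>e\<in>B. \<Sum>b\<in>Basis. (e \<bullet> b) * (frame_deriv b V x \<bullet> e))"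
    by (rule sum.cong) (simp_all add: dV[OF BT] inner_sum_left)
  also have "\<dots> = (\<Sum>b\<in>Basis. frame_deriv b V x \<bullet> (\<Sum>e\<in>B. (e \<bullet> b) *\<^sub>R e))"
    by (subst sum.swap) (simp add: inner_sum_right)
  also have "\<dots> = (\<Sum>b\<in>Basis. frame_deriv b V x \<bullet> P x b)"
    by (simp only: coeff)
  \<comment> \<open>Symmetry of \<open>P x\<close> moves the projection into the direction of
    differentiation, where idempotence absorbs it.\<close>
  also have "\<dots> = (\<Sum>b\<in>Basis. (\<Sum>c\<in>Basis. (P x b \<bullet> c) *\<^sub>R frame_deriv c V x) \<bullet> b)"
  proof -
    have P_sym: "P x b \<bullet> c = P x c \<bullet> b" for b c
      using P_selfadjoint[OF x, of b c] by (simp only: inner_commute)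
    have "(\<Sum>b\<in>Basis. (\<Sum>c\<in>Basis. (P x b \<bullet> c) *\<^sub>R frame_deriv c V x) \<bullet> b) =
      (\<Sum>c\<in>Basis. \<Sum>b\<in>Basis. (P x c \<bullet> b) * (frame_deriv c V x \<bullet> b))"
      unfolding inner_sum_left inner_scaleR_left by (subst sum.swap) (simp only: P_sym)
    also have "\<dots> = (\<Sum>c\<in>Basis. frame_deriv c V x \<bullet> P x c)"
      by (subst (2) inner_commute, subst (2) euclidean_inner) (rule refl)
    finally show ?thesis ..
  qed
  also have "\<dots> = (\<Sum>b\<in>Basis. frame_deriv b V x \<bullet> b)"
    unfolding dV[OF P_tangent[OF x], symmetric] by (simp add: frame_deriv_def)
  finally show ?thesis .
qed

text \<open>The coordinates of the gradient are frame derivatives of \<open>f\<close>, and taking a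
  coordinate commutes with differentiation.\<close>

lemma divergence_gradient:
  assumes f: "smooth_map M f" and x: "x \<in> M"
  shows "divergence M g (gradient M g f) x = (\<Sum>b\<in>Basis. frame_deriv b (frame_deriv b f) x)"
proof -
  have "frame_deriv b (gradient M g f) x \<bullet> b = frame_deriv b (frame_deriv b f) x"
    if b: "b \<in> Basis" for b
  proof -
    have "frame_deriv b (gradient M g f) x \<bullet> b = frame_deriv b (\<lambda>y. gradient M g f y \<bullet> b) x"
      unfolding frame_deriv_def
      by (rule diff_along_bounded_linear[symmetric])
        (auto intro: bounded_linear_inner_left vector_fieldD gradient_vector_field f x P_tangent)
    also have "\<dots> = frame_deriv b (frame_deriv b f) x"
      by (rule frame_deriv_cong[OF frame_deriv_smooth[OF f] x])
        (use b in \<open>simp add: gradient_eq[OF f] inner_sum_left inner_Basis if_distrib cong: if_cong\<close>)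
    finally show ?thesis .
  qed
  then show ?thesis by (simp add: divergence_eq[OF gradient_vector_field[OF f] x])
qed

lemma frame_deriv_bounded_linear:
  "bounded_linear L \<Longrightarrow> smooth_map M f \<Longrightarrow> x \<in> M \<Longrightarrow>
    frame_deriv c (\<lambda>y. L (f y)) x = L (frame_deriv c f x)"
  unfolding frame_deriv_def by (rule diff_along_bounded_linear) (auto intro: P_tangent)

text \<open>Real and imaginary parts are linear maps that commute with the frame derivatives, so one
  complex-valued second derivative carries both divergences.\<close>

lemma tau_eq:
  assumes f: "smooth_map M f" and x: "x \<in> M"
  shows "tau M g f x = (\<Sum>b\<in>Basis. frame_deriv b (frame_deriv b f) x)"
proof -
  have "divergence M g (gradient M g (\<lambda>y. L (f y))) x =
      L (\<Sum>b\<in>Basis. frame_deriv b (frame_deriv b f) x)"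
    if L: "bounded_linear L" for L :: "complex \<Rightarrow> real"
  proof -
    have "frame_deriv b (frame_deriv b (\<lambda>y. L (f y))) x = L (frame_deriv b (frame_deriv b f) x)" for b
    proof -
      have "frame_deriv b (frame_deriv b (\<lambda>y. L (f y))) x = frame_deriv b (\<lambda>y. L (frame_deriv b f y)) x"
        by (rule frame_deriv_cong[OF smooth_map_bounded_linear[OF L frame_deriv_smooth[OF f]] x])
          (simp add: frame_deriv_bounded_linear[OF L f])
      then show ?thesis by (simp add: frame_deriv_bounded_linear[OF L frame_deriv_smooth[OF f] x])
    qed
    then show ?thesis
      by (simp add: divergence_gradient[OF smooth_map_bounded_linear[OF L f] x]
          linear_sum[OF bounded_linear.linear[OF L]])
  qed
  from this[OF bounded_linear_Re] this[OF bounded_linear_Im] show ?thesis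
    unfolding tau_def by (simp add: complex_eq_iff)
qed

lemma kappa_eq:
  assumes f: "smooth_map M f" and h: "smooth_map M h" and x: "x \<in> M"
  shows "kappa M g f h x = (\<Sum>b\<in>Basis. frame_deriv b f x * frame_deriv b h x)"
proof -
  have ip: "g x (gradient M g (\<lambda>y. L (f y)) x) (gradient M g (\<lambda>y. K (h y)) x) =
      (\<Sum>b\<in>Basis. L (frame_deriv b f x) * K (frame_deriv b h x))"
    if L: "bounded_linear L" and K: "bounded_linear K" for L K :: "complex \<Rightarrow> real"
    unfolding gradient_eq[OF smooth_map_bounded_linear[OF L f] x]
      gradient_eq[OF smooth_map_bounded_linear[OF K h] x]
      frame_deriv_bounded_linear[OF L f x] frame_deriv_bounded_linear[OF K h x] metric[OF x]
    by (simp add: inner_sum_left inner_sum_right inner_Basis if_distrib mult.commute cong: if_cong)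
  show ?thesis
    unfolding kappa_def Let_def
    by (simp add: ip bounded_linear_Re bounded_linear_Im complex_eq_iff sum_subtractf sum.distrib)
qed

end

section \<open>Product, inverse and power rules for \<tau> and \<kappa>\<close>

context embedded_manifold
begin

lemma frame_deriv_const: "x \<in> M \<Longrightarrow> frame_deriv c (\<lambda>y. k) x = 0"
  by (simp add: frame_deriv_def diff_along_const P_tangent)

lemma frame_deriv_add:
  "smooth_map M f \<Longrightarrow> smooth_map M h \<Longrightarrow> x \<in> M \<Longrightarrow>
    frame_deriv c (\<lambda>y. f y + h y) x = frame_deriv c f x + frame_deriv c h x"
  by (simp add: frame_deriv_def diff_along_add P_tangent)

lemma frame_deriv_mult:
  fixes f h :: "'a \<Rightarrow> 'b::real_normed_field"
  shows "smooth_map M f \<Longrightarrow> smooth_map M h \<Longrightarrow> x \<in> M \<Longrightarrow>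
    frame_deriv c (\<lambda>y. f y * h y) x = f x * frame_deriv c h x + frame_deriv c f x * h x"
  by (simp add: frame_deriv_def diff_along_bilinear[OF bounded_bilinear_mult] P_tangent)

lemma kappa_commute:
  "smooth_map M f \<Longrightarrow> smooth_map M h \<Longrightarrow> x \<in> M \<Longrightarrow> kappa M g f h x = kappa M g h f x"
  by (simp add: kappa_eq mult.commute)

lemma kappa_cong:
  assumes "smooth_map M f" "smooth_map M h" "x \<in> M"
    "\<And>y. y \<in> M \<Longrightarrow> f y = f' y" "\<And>y. y \<in> M \<Longrightarrow> h y = h' y"
  shows "kappa M g f' h' x = kappa M g f h x"
  using assms smooth_map_cong[OF assms(1,4)] smooth_map_cong[OF assms(2,5)]
    frame_deriv_cong[OF assms(1,3,4)] frame_deriv_cong[OF assms(2,3,5)]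
  by (simp add: kappa_eq)

lemma kappa_const: "smooth_map M h \<Longrightarrow> x \<in> M \<Longrightarrow> kappa M g (\<lambda>y. k) h x = 0"
  by (simp add: kappa_eq smooth_map_const frame_deriv_const)

lemma kappa_add:
  "smooth_map M f \<Longrightarrow> smooth_map M f' \<Longrightarrow> smooth_map M h \<Longrightarrow> x \<in> M \<Longrightarrow>
    kappa M g (\<lambda>y. f y + f' y) h x = kappa M g f h x + kappa M g f' h x"
  by (simp add: kappa_eq smooth_map_add frame_deriv_add sum.distrib distrib_right)

lemma kappa_mult:
  "smooth_map M f \<Longrightarrow> smooth_map M f' \<Longrightarrow> smooth_map M h \<Longrightarrow> x \<in> M \<Longrightarrow>
    kappa M g (\<lambda>y. f y * f' y) h x = f x * kappa M g f' h x + f' x * kappa M g f h x"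
  by (simp add: kappa_eq smooth_map_mult frame_deriv_mult sum.distrib sum_distrib_left algebra_simps)

lemma kappa_sum:
  "(\<And>i. i \<in> I \<Longrightarrow> smooth_map M (f i)) \<Longrightarrow> smooth_map M h \<Longrightarrow> x \<in> M \<Longrightarrow>
    kappa M g (\<lambda>y. \<Sum>i\<in>I. f i y) h x = (\<Sum>i\<in>I. kappa M g (f i) h x)"
  by (induction I rule: infinite_finite_induct) (simp_all add: kappa_const kappa_add smooth_map_sum)

lemma tau_cong:
  assumes f: "smooth_map M f" and x: "x \<in> M" and eq: "\<And>y. y \<in> M \<Longrightarrow> f y = h y"
  shows "tau M g h x = tau M g f x"
proof -
  have "frame_deriv b (frame_deriv b h) x = frame_deriv b (frame_deriv b f) x" for b
    by (rule frame_deriv_cong[OF frame_deriv_smooth[OF f] x])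
      (rule frame_deriv_cong[OF f _ eq, symmetric])
  then show ?thesis by (simp add: tau_eq f x smooth_map_cong[OF f eq])
qed

lemma tau_const: "x \<in> M \<Longrightarrow> tau M g (\<lambda>y. k) x = 0"
  using frame_deriv_cong[OF smooth_map_const[of M 0], of x "frame_deriv _ (\<lambda>y. k)"]
  by (simp add: tau_eq smooth_map_const frame_deriv_const)

lemma tau_add:
  assumes f: "smooth_map M f" and h: "smooth_map M h" and x: "x \<in> M"
  shows "tau M g (\<lambda>y. f y + h y) x = tau M g f x + tau M g h x"
proof -
  have "frame_deriv b (frame_deriv b (\<lambda>y. f y + h y)) x =
      frame_deriv b (frame_deriv b f) x + frame_deriv b (frame_deriv b h) x" for b
  proof -
    have "frame_deriv b (frame_deriv b (\<lambda>y. f y + h y)) x =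
        frame_deriv b (\<lambda>y. frame_deriv b f y + frame_deriv b h y) x"
      by (rule frame_deriv_cong)
        (simp_all add: f h x frame_deriv_add smooth_map_add frame_deriv_smooth)
    then show ?thesis by (simp add: f h x frame_deriv_add frame_deriv_smooth)
  qed
  then show ?thesis by (simp add: tau_eq f h x smooth_map_add sum.distrib)
qed

lemma tau_mult:
  assumes f: "smooth_map M f" and h: "smooth_map M h" and x: "x \<in> M"
  shows "tau M g (\<lambda>y. f y * h y) x = f x * tau M g h x + 2 * kappa M g f h x + h x * tau M g f x"
proof -
  have "frame_deriv b (frame_deriv b (\<lambda>y. f y * h y)) x =
      f x * frame_deriv b (frame_deriv b h) x + 2 * (frame_deriv b f x * frame_deriv b h x) +
      h x * frame_deriv b (frame_deriv b f) x" for b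
  proof -
    have "frame_deriv b (frame_deriv b (\<lambda>y. f y * h y)) x =
        frame_deriv b (\<lambda>y. f y * frame_deriv b h y + frame_deriv b f y * h y) x"
      by (rule frame_deriv_cong)
        (simp_all add: f h x frame_deriv_mult smooth_map_add smooth_map_mult frame_deriv_smooth)
    then show ?thesis
      by (simp add: f h x frame_deriv_add frame_deriv_mult frame_deriv_smooth smooth_map_mult)
  qed
  then show ?thesis
    by (simp add: tau_eq kappa_eq f h x smooth_map_mult sum.distrib sum_distrib_left)
qed

lemma tau_cmult: "smooth_map M f \<Longrightarrow> x \<in> M \<Longrightarrow> tau M g (\<lambda>y. k * f y) x = k * tau M g f x"
  by (simp add: tau_mult smooth_map_const tau_const kappa_const)

lemma kappa_cmult:
  "smooth_map M f \<Longrightarrow> smooth_map M h \<Longrightarrow> x \<in> M \<Longrightarrow> kappa M g (\<lambda>y. k * f y) h x = k * kappa M g f h x"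
  by (simp add: kappa_mult smooth_map_const kappa_const)

lemma tau_sum:
  "(\<And>i. i \<in> I \<Longrightarrow> smooth_map M (f i)) \<Longrightarrow> x \<in> M \<Longrightarrow>
    tau M g (\<lambda>y. \<Sum>i\<in>I. f i y) x = (\<Sum>i\<in>I. tau M g (f i) x)"
  by (induction I rule: infinite_finite_induct) (simp_all add: tau_const tau_add smooth_map_sum)

text \<open>The product rule is applied to \<open>f * inverse f = 1\<close>, whose \<kappa> with any
  function is 0; \<tau> of the inverse comes from the same identity.\<close>

lemma kappa_inverse:
  assumes f: "smooth_map M f" and nz: "\<And>y. y \<in> M \<Longrightarrow> f y \<noteq> 0" and h: "smooth_map M h" and x: "x \<in> M"
  shows "kappa M g (\<lambda>y. inverse (f y)) h x = - (inverse (f x))\<^sup>2 * kappa M g f h x"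
proof -
  note i = smooth_map_inverse[OF f nz]
  have "0 = kappa M g (\<lambda>y. f y * inverse (f y)) h x"
    by (subst kappa_cong[OF smooth_map_const[of M 1] h x]) (simp_all add: nz kappa_const h x)
  also have "\<dots> = f x * kappa M g (\<lambda>y. inverse (f y)) h x + inverse (f x) * kappa M g f h x"
    by (rule kappa_mult[OF f i h x])
  finally have "f x * kappa M g (\<lambda>y. inverse (f y)) h x = - (inverse (f x) * kappa M g f h x)"
    by (simp only: eq_neg_iff_add_eq_0)
  moreover have "kappa M g (\<lambda>y. inverse (f y)) h x =
      inverse (f x) * (f x * kappa M g (\<lambda>y. inverse (f y)) h x)"
    using nz[OF x] by simp
  ultimately show ?thesis by (simp add: power2_eq_square)
qed

lemma tau_inverse:
  assumes f: "smooth_map M f" and nz: "\<And>y. y \<in> M \<Longrightarrow> f y \<noteq> 0" and x: "x \<in> M"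
  shows "tau M g (\<lambda>y. inverse (f y)) x =
    2 * (inverse (f x))^3 * kappa M g f f x - (inverse (f x))\<^sup>2 * tau M g f x"
proof -
  note i = smooth_map_inverse[OF f nz]
  have "0 = tau M g (\<lambda>y. f y * inverse (f y)) x"
    by (subst tau_cong[OF smooth_map_const[of M 1] x]) (simp_all add: nz tau_const x)
  also have "\<dots> = f x * tau M g (\<lambda>y. inverse (f y)) x +
      2 * kappa M g f (\<lambda>y. inverse (f y)) x + inverse (f x) * tau M g f x"
    by (rule tau_mult[OF f i x])
  also have "kappa M g f (\<lambda>y. inverse (f y)) x = - (inverse (f x))\<^sup>2 * kappa M g f f x"
    by (simp add: kappa_commute[OF f i x] kappa_inverse[OF f nz f x])
  finally have "f x * tau M g (\<lambda>y. inverse (f y)) x =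
      2 * (inverse (f x))\<^sup>2 * kappa M g f f x - inverse (f x) * tau M g f x"
    by (simp add: algebra_simps)
  moreover have "tau M g (\<lambda>y. inverse (f y)) x = inverse (f x) * (f x * tau M g (\<lambda>y. inverse (f y)) x)"
    using nz[OF x] by simp
  ultimately show ?thesis by (simp add: right_diff_distrib power2_eq_square power3_eq_cube mult_ac)
qed

text \<open>By the product rule, \<kappa> of \<open>\<phi> ^ k\<close> and \<open>\<psi> ^ l\<close>
  has the factor k l mu, and raising the exponent from k adds lam + 2 k mu to the eigenvalue of
  \<tau>, which is k lam + k (k - 1) mu. The induction carries only its existence.\<close>

lemma eigenfamily_power:
  assumes smooth: "\<And>\<phi>. \<phi> \<in> E \<Longrightarrow> smooth_map M \<phi>"
    and tau: "\<And>\<phi> x. \<phi> \<in> E \<Longrightarrow> x \<in> M \<Longrightarrow> tau M g \<phi> x = lam * \<phi> x"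
    and kappa: "\<And>\<phi> \<psi> x. \<phi> \<in> E \<Longrightarrow> \<psi> \<in> E \<Longrightarrow> x \<in> M \<Longrightarrow> kappa M g \<phi> \<psi> x = mu * \<phi> x * \<psi> x"
  shows "eigenfamily M g ((\<lambda>\<phi> x. \<phi> x ^ k) ` E)"
proof -
  note sm = smooth smooth_map_power
  have kap1: "kappa M g (\<lambda>y. \<phi> y ^ k) \<psi> x = (of_nat k * mu) * \<phi> x ^ k * \<psi> x"
    if "\<phi> \<in> E" "\<psi> \<in> E" "x \<in> M" for \<phi> \<psi> x k
    using that by (induction k) (simp_all add: kappa_const kappa_mult sm kappa algebra_simps)
  have kap2: "kappa M g (\<lambda>y. \<phi> y ^ k) (\<lambda>y. \<psi> y ^ l) x = (of_nat k * of_nat l * mu) * \<phi> x ^ k * \<psi> x ^ l"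
    if "\<phi> \<in> E" "\<psi> \<in> E" "x \<in> M" for \<phi> \<psi> x k l
  proof (induction l)
    case 0
    then show ?case
      using that by (simp add: kappa_commute[of "\<lambda>y. \<phi> y ^ k" "\<lambda>y. 1"] sm smooth_map_const kappa_const)
  next
    case (Suc l)
    have "kappa M g (\<lambda>y. \<phi> y ^ k) (\<lambda>y. \<psi> y ^ Suc l) x = kappa M g (\<lambda>y. \<psi> y ^ Suc l) (\<lambda>y. \<phi> y ^ k) x"
      using that by (intro kappa_commute sm) auto
    also have "\<dots> = \<psi> x * kappa M g (\<lambda>y. \<psi> y ^ l) (\<lambda>y. \<phi> y ^ k) x + \<psi> x ^ l * kappa M g \<psi> (\<lambda>y. \<phi> y ^ k) x"
      using that by (simp add: kappa_mult sm)
    also have "\<dots> = \<psi> x * kappa M g (\<lambda>y. \<phi> y ^ k) (\<lambda>y. \<psi> y ^ l) x + \<psi> x ^ l * kappa M g (\<lambda>y. \<phi> y ^ k) \<psi> x"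
      using that by (simp add: kappa_commute[of "\<lambda>y. \<phi> y ^ k"] sm)
    finally show ?case using that Suc by (simp add: kap1 algebra_simps)
  qed
  have "\<exists>lam'. \<forall>\<phi>\<in>E. \<forall>x\<in>M. tau M g (\<lambda>y. \<phi> y ^ k) x = lam' * \<phi> x ^ k"
  proof (induction k)
    case 0
    then show ?case by (intro exI[of _ 0]) (simp add: tau_const)
  next
    case (Suc k)
    then obtain lam' where "\<forall>\<phi>\<in>E. \<forall>x\<in>M. tau M g (\<lambda>y. \<phi> y ^ k) x = lam' * \<phi> x ^ k" by blast
    then have "\<forall>\<phi>\<in>E. \<forall>x\<in>M. tau M g (\<lambda>y. \<phi> y ^ Suc k) x = (lam' + 2 * of_nat k * mu + lam) * \<phi> x ^ Suc k"
      by (simp add: tau_mult sm tau kap1 kappa_commute[of _ "\<lambda>y. _ y ^ k"] algebra_simps)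
    then show ?case by blast
  qed
  then obtain lam' where lam': "\<And>\<phi> x. \<phi> \<in> E \<Longrightarrow> x \<in> M \<Longrightarrow> tau M g (\<lambda>y. \<phi> y ^ k) x = lam' * \<phi> x ^ k"
    by blast
  show ?thesis unfolding eigenfamily_def
    by (intro conjI exI[of _ lam'] exI[of _ "of_nat k * of_nat k * mu"])
      (auto simp: lam' kap2 sm)
qed

end

section \<open>Quotients of linear forms on matrices\<close>

text \<open>The entry \<open>j\<close> of the row vector p^t z. The factors a_j and b_\<beta> in the
  numerators and the denominator are constants that are split off.\<close>

definition row_form :: "complex^'n \<Rightarrow> 'n \<Rightarrow> complex^'n^'n \<Rightarrow> complex" where
  "row_form p j z = (\<Sum>i\<in>UNIV. p $ i * z $ i $ j)"

lemma bounded_linear_entry: "bounded_linear (\<lambda>z::'a::real_normed_vector^'n^'m. z $ i $ j)"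
  using bounded_linear_compose[OF bounded_linear_vec_nth[of j] bounded_linear_vec_nth[of i]]
  by (simp add: o_def)

lemma smooth_map_entry: "smooth_map M (\<lambda>z::complex^'n^'m. z $ i $ j)"
  by (rule smooth_map_smooth_on[of UNIV]) (auto intro: smooth_on_linear bounded_linear_entry)

lemma smooth_map_row_form: "smooth_map M (row_form p j)"
  unfolding row_form_def[abs_def]
  by (intro smooth_map_sum smooth_map_mult smooth_map_const smooth_map_entry)

text \<open>Relatively open subsets of both groups satisfy these formulas, each group with its own
  constants, so the computation with quotients is done once.\<close>

locale unitary_type = embedded_manifold M g P
  for M :: "(complex^'n::finite^'n) set" and g P +
  fixes l c :: complex
  assumes tau_entry: "z \<in> M \<Longrightarrow> tau M g (\<lambda>z. z $ i $ j) z = l * z $ i $ j"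
    and kappa_entry: "z \<in> M \<Longrightarrow> kappa M g (\<lambda>z. z $ i $ j) (\<lambda>z. z $ i' $ j') z =
      - z $ i $ j' * z $ i' $ j + c * z $ i $ j * z $ i' $ j'"
begin

lemma tau_row_form: "z \<in> M \<Longrightarrow> tau M g (row_form p j) z = l * row_form p j z"
  unfolding row_form_def[abs_def]
  by (simp add: tau_sum tau_cmult tau_entry smooth_map_mult smooth_map_const smooth_map_entry
      sum_distrib_left mult.left_commute)

lemma kappa_row_form:
  assumes z: "z \<in> M"
  shows "kappa M g (row_form p j) (row_form q k) z =
    - row_form p k z * row_form q j z + c * row_form p j z * row_form q k z"
proof -
  have 1: "kappa M g (row_form q k) (\<lambda>z. z $ i $ j) z =
      - z $ i $ k * row_form q j z + c * z $ i $ j * row_form q k z" for i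
    unfolding row_form_def[abs_def]
    by (simp add: kappa_sum kappa_cmult kappa_entry z smooth_map_mult smooth_map_const smooth_map_entry
        sum_distrib_left sum.distrib sum_negf sum_subtractf algebra_simps)
  have "kappa M g (row_form p j) (row_form q k) z =
      (\<Sum>i\<in>UNIV. p $ i * kappa M g (row_form q k) (\<lambda>z. z $ i $ j) z)"
    unfolding row_form_def[of p, abs_def]
    by (simp add: kappa_sum kappa_cmult z smooth_map_mult smooth_map_const smooth_map_entry
        smooth_map_row_form kappa_commute[of "row_form q k"])
  also have "\<dots> = - row_form p k z * row_form q j z + c * row_form p j z * row_form q k z"
    unfolding 1 by (simp add: row_form_def[of p] sum_distrib_left sum_distrib_right sum_subtractf
        sum.distrib sum_negf algebra_simps)
  finally show ?thesis .
qed

end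

section \<open>Differences, and 2 x 2 minors of row forms\<close>

context embedded_manifold
begin

lemma kappa_diff:
  assumes "smooth_map M f" "smooth_map M f'" "smooth_map M h" "x \<in> M"
  shows "kappa M g (\<lambda>y. f y - f' y) h x = kappa M g f h x - kappa M g f' h x"
  using kappa_add[OF assms(1) smooth_map_mult[OF smooth_map_const[of M "-1"] assms(2)] assms(3,4)]
    kappa_cmult[OF assms(2-4), of "-1"]
  by simp

lemma tau_diff:
  assumes "smooth_map M f" "smooth_map M h" "x \<in> M"
  shows "tau M g (\<lambda>y. f y - h y) x = tau M g f x - tau M g h x"
  using tau_add[OF assms(1) smooth_map_mult[OF smooth_map_const[of M "-1"] assms(2)] assms(3)]
    tau_cmult[OF assms(2,3), of "-1"]
  by simp

end

lemma smooth_map_diff: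
  fixes f h :: "'a::euclidean_space \<Rightarrow> 'b::real_normed_algebra_1"
  shows "smooth_map M f \<Longrightarrow> smooth_map M h \<Longrightarrow> smooth_map M (\<lambda>x. f x - h x)"
  using smooth_map_add[of M f "\<lambda>x. - 1 * h x"] smooth_map_mult[OF smooth_map_const[of M "- 1"], of h]
  by simp

text \<open>The minor in the columns \<beta> and \<open>j\<close> of the matrix with the rows p^t z
  and q^t z. It is alternating in the columns, which is what the swapped product in \<kappa> acts
  on.\<close>

definition row_minor :: "complex^'n \<Rightarrow> complex^'n \<Rightarrow> 'n \<Rightarrow> 'n \<Rightarrow> complex^'n^'n \<Rightarrow> complex" where
  "row_minor p q \<beta> j z = row_form p \<beta> z * row_form q j z - row_form p j z * row_form q \<beta> z"

lemma smooth_map_row_minor: "smooth_map M (row_minor p q \<beta> j)"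
  unfolding row_minor_def[abs_def]
  by (intro smooth_map_diff smooth_map_mult smooth_map_row_form)

context unitary_type
begin

text \<open>The values of \<tau> on the single factors give 2 l. The cross terms give 2 (1 + c),
  since exchanging the columns of a minor changes its sign.\<close>

lemma tau_row_minor:
  assumes z: "z \<in> M"
  shows "tau M g (row_minor p q \<beta> j) z = (2 * l + 2 * c + 2) * row_minor p q \<beta> j z"
  unfolding row_minor_def[abs_def]
  by (simp add: tau_diff tau_mult tau_row_form kappa_row_form z smooth_map_mult smooth_map_row_form
      algebra_simps)

text \<open>The vector \<open>r\<close> stays free because \<kappa> of two minors is opened into row
  forms of both \<open>p\<close> and \<open>q\<close>.\<close>

lemma kappa_row_minor_row_form:
  assumes z: "z \<in> M"
  shows "kappa M g (row_minor p q \<beta> j) (row_form r k) z =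
    row_form p \<beta> z * (c * row_form q j z * row_form r k z - row_form q k z * row_form r j z)
    + row_form q j z * (c * row_form p \<beta> z * row_form r k z - row_form p k z * row_form r \<beta> z)
    - row_form p j z * (c * row_form q \<beta> z * row_form r k z - row_form q k z * row_form r \<beta> z)
    - row_form q \<beta> z * (c * row_form p j z * row_form r k z - row_form p k z * row_form r j z)"
  unfolding row_minor_def[abs_def]
  by (simp add: kappa_diff kappa_mult kappa_row_form z smooth_map_mult smooth_map_row_form algebra_simps)

lemma kappa_row_minor_denominator:
  "z \<in> M \<Longrightarrow> kappa M g (row_minor p q \<beta> j) (row_form q \<beta>) z =
    (2 * c - 1) * row_minor p q \<beta> j z * row_form q \<beta> z"
  by (simp add: kappa_row_minor_row_form) (simp add: row_minor_def algebra_simps)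

text \<open>The scalar parts give 4 c, the product of the degrees times c. In the swapped parts the
  minor in the columns \<open>j\<close> and \<open>k\<close> appears with the factor u_\<beta>
  v_\<beta> - v_\<beta> u_\<beta> = 0, because both minors share the column \<beta>; what remains is
  twice the negative product of the minors.\<close>

lemma kappa_row_minor:
  assumes z: "z \<in> M"
  shows "kappa M g (row_minor p q \<beta> j) (row_minor p q \<beta> k) z =
    (4 * c - 2) * row_minor p q \<beta> j z * row_minor p q \<beta> k z"
proof -
  have "kappa M g (row_form r m) (row_minor p q \<beta> k) z = kappa M g (row_minor p q \<beta> k) (row_form r m) z"
    for r m by (rule kappa_commute[OF smooth_map_row_form smooth_map_row_minor z])
  then have "kappa M g (\<lambda>z. row_form p \<beta> z * row_form q j z - row_form p j z * row_form q \<beta> z)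
      (row_minor p q \<beta> k) z = (4 * c - 2) * row_minor p q \<beta> j z * row_minor p q \<beta> k z"
    by (simp add: kappa_diff kappa_mult z smooth_map_mult smooth_map_row_form smooth_map_row_minor
        kappa_row_minor_row_form) (simp add: row_minor_def algebra_simps)
  moreover have "row_minor p q \<beta> j =
      (\<lambda>z. row_form p \<beta> z * row_form q j z - row_form p j z * row_form q \<beta> z)"
    by (rule ext) (rule row_minor_def)
  ultimately show ?thesis by metis
qed

section \<open>Quotients with a nowhere vanishing denominator\<close>

context
  fixes p q :: "complex^'n" and \<beta> :: 'n
  assumes nz: "\<And>z. z \<in> M \<Longrightarrow> row_form q \<beta> z \<noteq> 0"
begin

private abbreviation (input) "w \<equiv> \<lambda>z. inverse (row_form q \<beta> z)"

lemma smooth_map_inverse_row_form: "smooth_map M w"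
  by (rule smooth_map_inverse[OF smooth_map_row_form nz])

lemma kappa_inverse_row_form_left:
  "smooth_map M h \<Longrightarrow> z \<in> M \<Longrightarrow> kappa M g w h z = - (w z)\<^sup>2 * kappa M g (row_form q \<beta>) h z"
  by (rule kappa_inverse[OF smooth_map_row_form nz])

lemma tau_inverse_row_form:
  assumes z: "z \<in> M"
  shows "tau M g w z = (2 * c - 2 - l) * w z"
proof -
  have "tau M g w z = 2 * (w z)^3 * kappa M g (row_form q \<beta>) (row_form q \<beta>) z -
      (w z)\<^sup>2 * tau M g (row_form q \<beta>) z"
    by (rule tau_inverse[OF smooth_map_row_form nz z])
  also have "\<dots> = (2 * c - 2 - l) * w z"
    unfolding kappa_row_form[OF z] tau_row_form[OF z]
    using nz[OF z] by (simp add: field_simps power2_eq_square power3_eq_cube)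
  finally show ?thesis .
qed

text \<open>The cross term contributes u_\<beta> v_j, the - 2 in \<tau> of the inverse contributes -
  u_j v_\<beta>, and together they form the minor; the terms with \<open>l\<close> and
  \<open>c\<close> cancel.\<close>

lemma tau_quotient:
  assumes z: "z \<in> M"
  shows "tau M g (\<lambda>z. row_form p j z * w z) z = 2 * row_minor p q \<beta> j z * (w z)\<^sup>2"
proof -
  have kap: "kappa M g (row_form p j) w z = - (w z)\<^sup>2 *
      (- row_form q j z * row_form p \<beta> z + c * row_form q \<beta> z * row_form p j z)"
    by (simp add: kappa_commute[OF smooth_map_row_form smooth_map_inverse_row_form z]
        kappa_inverse_row_form_left[OF smooth_map_row_form z] kappa_row_form z)
  show ?thesis
    unfolding tau_mult[OF smooth_map_row_form smooth_map_inverse_row_form z] kap tau_row_form[OF z]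
      tau_inverse_row_form[OF z]
    using nz[OF z] by (simp add: row_minor_def field_simps power2_eq_square)
qed

lemma kappa_minor_inverse_row_form:
  assumes z: "z \<in> M"
  shows "kappa M g (row_minor p q \<beta> j) w z = (1 - 2 * c) * row_minor p q \<beta> j z * w z"
proof -
  have "kappa M g (row_minor p q \<beta> j) w z = - (w z)\<^sup>2 * kappa M g (row_minor p q \<beta> j) (row_form q \<beta>) z"
    unfolding kappa_commute[OF smooth_map_row_minor smooth_map_inverse_row_form z]
      kappa_inverse_row_form_left[OF smooth_map_row_minor z]
      kappa_commute[OF smooth_map_row_form smooth_map_row_minor z] ..
  also have "\<dots> = (1 - 2 * c) * row_minor p q \<beta> j z * w z"
    unfolding kappa_row_minor_denominator[OF z] using nz[OF z] by (simp add: field_simps power2_eq_square)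
  finally show ?thesis .
qed

lemma kappa_inverse_row_form:
  assumes z: "z \<in> M"
  shows "kappa M g w w z = (c - 1) * (w z)\<^sup>2"
proof -
  have "kappa M g w w z = - (w z)\<^sup>2 * (- (w z)\<^sup>2 * kappa M g (row_form q \<beta>) (row_form q \<beta>) z)"
    unfolding kappa_inverse_row_form_left[OF smooth_map_inverse_row_form z]
      kappa_commute[OF smooth_map_row_form smooth_map_inverse_row_form z]
      kappa_inverse_row_form_left[OF smooth_map_row_form z] ..
  also have "\<dots> = (c - 1) * (w z)\<^sup>2"
    unfolding kappa_row_form[OF z] using nz[OF z] by (simp add: field_simps power2_eq_square)
  finally show ?thesis .
qed

text \<open>The coefficients are 2 (2 c - 2 - l) from \<tau> of the inverse, 2 (c - 1) from \<kappa>
  of the inverse with itself, 4 (1 - 2 c) from the cross term and 2 l + 2 c + 2 from \<tau> of the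
  minor. They add up to 0.\<close>

lemma tau_minor_quotient:
  assumes z: "z \<in> M"
  shows "tau M g (\<lambda>z. row_minor p q \<beta> j z * (w z * w z)) z = 0"
proof -
  note sm = smooth_map_row_minor smooth_map_inverse_row_form smooth_map_mult
  have "kappa M g (row_minor p q \<beta> j) (\<lambda>z. w z * w z) z =
      kappa M g (\<lambda>z. w z * w z) (row_minor p q \<beta> j) z"
    by (rule kappa_commute) (simp_all only: sm z)
  also have "\<dots> = 2 * w z * kappa M g (row_minor p q \<beta> j) w z"
    unfolding kappa_mult[OF smooth_map_inverse_row_form smooth_map_inverse_row_form smooth_map_row_minor z]
      kappa_commute[OF smooth_map_row_minor smooth_map_inverse_row_form z] by simp
  finally have kap: "kappa M g (row_minor p q \<beta> j) (\<lambda>z. w z * w z) z =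
      2 * w z * kappa M g (row_minor p q \<beta> j) w z" .
  have "tau M g (\<lambda>z. row_minor p q \<beta> j z * (w z * w z)) z =
      row_minor p q \<beta> j z * (2 * w z * tau M g w z + 2 * kappa M g w w z)
      + 4 * w z * kappa M g (row_minor p q \<beta> j) w z
      + w z * w z * tau M g (row_minor p q \<beta> j) z"
    unfolding tau_mult[OF smooth_map_row_minor smooth_map_mult[OF smooth_map_inverse_row_form
        smooth_map_inverse_row_form] z] kap
      tau_mult[OF smooth_map_inverse_row_form smooth_map_inverse_row_form z] by simp
  also have "\<dots> = 0"
    unfolding tau_inverse_row_form[OF z] kappa_inverse_row_form[OF z]
      kappa_minor_inverse_row_form[OF z] tau_row_minor[OF z]
    by (simp add: algebra_simps power2_eq_square)
  finally show ?thesis .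
qed

text \<open>The coefficients are 4 c - 2 from the minors, 2 (1 - 2 c) from each of the two cross
  terms and 4 (c - 1) from the inverse squares, with sum - 2.\<close>

lemma kappa_minor_quotient:
  assumes z: "z \<in> M"
  shows "kappa M g (\<lambda>z. row_minor p q \<beta> j z * (w z * w z)) (\<lambda>z. row_minor p q \<beta> k z * (w z * w z)) z =
    - 2 * (row_minor p q \<beta> j z * (w z * w z)) * (row_minor p q \<beta> k z * (w z * w z))"
proof -
  note w = smooth_map_inverse_row_form and N = smooth_map_row_minor
  have exp: "kappa M g (\<lambda>z. row_minor p q \<beta> i z * (w z * w z)) h z =
      row_minor p q \<beta> i z * (2 * w z * kappa M g w h z) + w z * w z * kappa M g (row_minor p q \<beta> i) h z"
    if h: "smooth_map M h" for i h
    unfolding kappa_mult[OF N smooth_map_mult[OF w w] h z] kappa_mult[OF w w h z] by simp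
  let ?H = "\<lambda>z. row_minor p q \<beta> k z * (w z * w z)"
  have H: "smooth_map M ?H" by (intro smooth_map_mult w N)
  have "kappa M g w ?H z = kappa M g ?H w z" "kappa M g (row_minor p q \<beta> j) ?H z = kappa M g ?H (row_minor p q \<beta> j) z"
    by (rule kappa_commute[OF w H z], rule kappa_commute[OF N H z])
  note this[unfolded exp[OF w] exp[OF N] kappa_inverse_row_form[OF z] kappa_row_minor[OF z]
      kappa_commute[OF w N z] kappa_minor_inverse_row_form[OF z]]
  then show ?thesis
    unfolding exp[OF H] by (simp add: algebra_simps power2_eq_square)
qed

end

end

section \<open>Projections onto the tangent spaces of the unitary groups\<close>

lemma conj_transpose_conj_transpose [simp]: "conj_transpose (conj_transpose A) = A"
  by (simp add: conj_transpose_def vec_eq_iff)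

lemma conj_transpose_mult: "conj_transpose (A ** B) = conj_transpose B ** conj_transpose A"
  by (simp add: conj_transpose_def matrix_matrix_mult_def vec_eq_iff mult.commute)

lemma conj_transpose_mat [simp]: "conj_transpose (mat c) = mat (cnj c)"
  by (simp add: conj_transpose_def mat_def vec_eq_iff)

lemma conj_transpose_diff [simp]:
  "conj_transpose (A - B) = conj_transpose A - conj_transpose B"
  by (simp add: conj_transpose_def vec_eq_iff)

lemma conj_transpose_add [simp]:
  "conj_transpose (A + B) = conj_transpose A + conj_transpose B"
  by (simp add: conj_transpose_def vec_eq_iff)

lemma conj_transpose_minus [simp]: "conj_transpose (- A) = - conj_transpose A"
  by (simp add: conj_transpose_def vec_eq_iff)

lemma conj_transpose_scaleR [simp]: "conj_transpose (r *\<^sub>R A) = r *\<^sub>R conj_transpose A"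
  by (simp add: conj_transpose_def vec_eq_iff)

lemma bounded_linear_conj_transpose:
  "bounded_linear (conj_transpose :: complex^'n^'m \<Rightarrow> complex^'m^'n)"
  by (intro linear_conv_bounded_linear[THEN iffD1] linearI) simp_all

lemma matrix_mult_scaleR:
  fixes A :: "complex^'n^'m" and B :: "complex^'k^'n"
  shows "(r *\<^sub>R A) ** B = r *\<^sub>R (A ** B)" "A ** (r *\<^sub>R B) = r *\<^sub>R (A ** B)"
  by (simp_all add: matrix_matrix_mult_def vec_eq_iff scaleR_sum_right)

lemma matrix_mult_minus:
  fixes A :: "complex^'n^'m" and B :: "complex^'k^'n"
  shows "(- A) ** B = - (A ** B)" "A ** (- B) = - (A ** B)"
  by (simp_all add: matrix_matrix_mult_def vec_eq_iff sum_negf)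

lemma matrix_mult_diff:
  fixes A :: "complex^'n^'m" and B :: "complex^'k^'n"
  shows "(A - A') ** B = A ** B - A' ** B" "A ** (B - B') = A ** B - A ** B'"
  by (simp_all add: matrix_matrix_mult_def vec_eq_iff algebra_simps sum_subtractf)

lemma matrix_add_rdist: "(A + A') ** B = A ** B + A' ** B"
  for A :: "complex^'n^'m" and B :: "complex^'k^'n"
  by (simp add: matrix_matrix_mult_def vec_eq_iff distrib_right sum.distrib)

lemma matrix_inv_unique:
  fixes A :: "'a::field^'n^'n"
  assumes "A ** B = mat 1"
  shows "matrix_inv A = B"
proof -
  have "B ** A = mat 1" using assms by (simp add: matrix_left_right_inverse)
  then have "\<exists>C. A ** C = mat 1 \<and> C ** A = mat 1" using assms by blast
  then have "A ** matrix_inv A = mat 1 \<and> matrix_inv A ** A = mat 1"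
    unfolding matrix_inv_def by (rule someI_ex)
  then have "matrix_inv A ** (A ** B) = B" by (simp add: matrix_mul_assoc)
  then show ?thesis using assms by simp
qed

lemma bounded_bilinear_matrix_mult:
  "bounded_bilinear ((**) :: complex^'n^'m \<Rightarrow> complex^'k^'n \<Rightarrow> complex^'k^'m)"
  by (intro bilinear_conv_bounded_bilinear[THEN iffD1])
    (auto simp: bilinear_def matrix_add_ldistrib matrix_add_rdist matrix_mult_scaleR intro!: linearI)

lemma matrix_mult_mat_commute: "A ** mat c = mat c ** (A :: complex^'n^'n)"
  by (simp add: matrix_matrix_mult_def mat_def vec_eq_iff if_distrib if_distribR mult.commute cong: if_cong)

lemma mat_mult_nth: "(mat c ** A) $ i $ j = c * (A :: complex^'m^'n) $ i $ j"
  by (simp add: matrix_matrix_mult_def mat_def if_distrib if_distribR cong: if_cong)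

lemma mat_mult_mat: "mat c ** mat d = (mat (c * d) :: complex^'n^'n)"
  by (simp add: vec_eq_iff mat_mult_nth) (simp add: mat_def)

text \<open>The ambient Euclidean inner product is the very form that defines the metric at the
  identity.\<close>

lemma inner_eq_trace: "A \<bullet> B = Re (trace (A ** conj_transpose B))" for A B :: "complex^'n^'n"
  by (simp add: inner_vec_def trace_def matrix_matrix_mult_def conj_transpose_def inner_complex_def)

lemma inner_conj_transpose: "conj_transpose A \<bullet> B = A \<bullet> conj_transpose B" for A B :: "complex^'n^'n"
  by (simp add: inner_vec_def conj_transpose_def inner_complex_def) (rule sum.swap)

lemma inner_matrix_mult_left: "(A ** B) \<bullet> C = B \<bullet> (conj_transpose A ** C)" for A B C :: "complex^'n^'n"
  by (simp add: inner_eq_trace conj_transpose_mult matrix_mul_assoc)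
    (metis matrix_mul_assoc trace_mul_sym)

lemma inner_matrix_mult_right: "(B ** A) \<bullet> C = B \<bullet> (C ** conj_transpose A)" for A B C :: "complex^'n^'n"
  by (simp add: inner_eq_trace conj_transpose_mult matrix_mul_assoc)

lemma unitary_group_iff:
  "z \<in> unitary_group \<longleftrightarrow> z ** conj_transpose z = mat 1 \<and> conj_transpose z ** z = mat 1"
  by (auto simp: unitary_group_def matrix_left_right_inverse)

lemma unitary_cancel:
  assumes "z \<in> unitary_group"
  shows "z ** (conj_transpose z ** A) = A" "conj_transpose z ** (z ** A) = A"
    "A ** z ** conj_transpose z = A" "A ** conj_transpose z ** z = A"
  using assms by (simp_all add: unitary_group_iff matrix_mul_assoc)
    (simp_all add: unitary_group_iff flip: matrix_mul_assoc)

text \<open>For unitary \<open>x\<close> the translation back to the identity is multiplication by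
  the conjugate transpose, an isometry of the ambient space.\<close>

lemma left_inv_metric_unitary:
  assumes "x \<in> unitary_group"
  shows "left_inv_metric x v w = v \<bullet> w"
proof -
  have "matrix_inv x = conj_transpose x"
    using assms by (metis matrix_inv_unique unitary_group_iff)
  then show ?thesis
    by (simp add: left_inv_metric_def inner_matrix_mult_left unitary_cancel[OF assms] flip: inner_eq_trace)
qed

text \<open>For unitary \<open>z\<close> this is a self-adjoint real-linear involution. Its -1
  eigenspace is the tangent space of U(n) at \<open>z\<close>, its +1 eigenspace the normal
  space.\<close>

definition adj_conj :: "complex^'n^'n \<Rightarrow> complex^'n^'n \<Rightarrow> complex^'n^'n" where
  "adj_conj z b = z ** conj_transpose b ** z"

text \<open>Take \<open>e = 0\<close> for \<open>U(n)\<close> and \<open>e = 1/n\<close> for \<open>SU(n)\<close>, where the direction \<open>\<i> z\<close>, of squared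
  norm \<open>n\<close>, is normal as well.\<close>

definition unitary_proj :: "real \<Rightarrow> complex^'n^'n \<Rightarrow> complex^'n^'n \<Rightarrow> complex^'n^'n" where
  "unitary_proj e z b =
    (1/2) *\<^sub>R (b - adj_conj z b) - (e * (b \<bullet> (mat \<i> ** z))) *\<^sub>R (mat \<i> ** z)"

lemma linear_adj_conj: "linear (adj_conj z)"
  by (rule linearI) (simp_all add: adj_conj_def matrix_add_ldistrib matrix_add_rdist matrix_mult_scaleR)

lemma linear_unitary_proj: "linear (unitary_proj e z)"
  by (rule linearI) (simp_all add: unitary_proj_def linear_add[OF linear_adj_conj]
      linear_scale[OF linear_adj_conj] inner_add_left algebra_simps)

lemma adj_conj_selfadjoint: "adj_conj z b \<bullet> c = b \<bullet> adj_conj z c"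
  unfolding adj_conj_def inner_matrix_mult_right[of "z ** conj_transpose b"] inner_matrix_mult_left[of z]
    inner_conj_transpose
  by (simp add: conj_transpose_mult matrix_mul_assoc)

text \<open>\<open>adj_conj z\<close> is conjugate-linear, so multiplication by \<i> exchanges its
  two eigenspaces; in particular \<i> z is tangent to U(n), since \<open>z\<close> is
  normal.\<close>

lemma adj_conj_mat: "adj_conj z (mat \<i> ** b) = - (mat \<i> ** adj_conj z b)"
proof -
  have "mat (- \<i>) ** z = - (mat \<i> ** z)"
    by (simp add: vec_eq_iff mat_mult_nth)
  then show ?thesis
    by (simp add: adj_conj_def conj_transpose_mult matrix_mult_minus flip: matrix_mul_assoc)
      (metis matrix_mul_assoc matrix_mult_mat_commute)
qed

lemma adj_conj_adj_conj: "z \<in> unitary_group \<Longrightarrow> adj_conj z (adj_conj z b) = b"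
  by (simp add: adj_conj_def conj_transpose_mult matrix_mul_assoc unitary_cancel)
    (simp add: unitary_group_iff)

lemma adj_conj_self: "z \<in> unitary_group \<Longrightarrow> adj_conj z z = z"
  by (simp add: adj_conj_def unitary_group_iff)

lemma inner_mat_i: "(mat \<i> ** a) \<bullet> b = - (a \<bullet> (mat \<i> ** b))" for a b :: "complex^'n^'n"
  by (simp add: inner_vec_def mat_mult_nth inner_complex_def sum_negf[symmetric] sum.distrib algebra_simps)

lemma mat_i_mat_i: "mat \<i> ** (mat \<i> ** a) = - a" for a :: "complex^'n^'n"
  by (simp add: vec_eq_iff mat_mult_nth flip: mult.assoc)

lemma inner_unitary_self: "z \<in> unitary_group \<Longrightarrow> z \<bullet> z = CARD('n)" for z :: "complex^'n^'n"
  by (simp add: inner_eq_trace unitary_group_iff trace_I)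

lemma inner_mat_i_self: "z \<in> unitary_group \<Longrightarrow> (mat \<i> ** z) \<bullet> (mat \<i> ** z) = CARD('n)" for z :: "complex^'n^'n"
  by (simp add: inner_mat_i mat_i_mat_i inner_unitary_self)

lemma unitary_proj_selfadjoint: "unitary_proj e z b \<bullet> c = b \<bullet> unitary_proj e z c"
  by (simp add: unitary_proj_def inner_diff_left inner_diff_right adj_conj_selfadjoint
      inner_commute[of "mat \<i> ** z" c])

lemma adj_conj_unitary_proj:
  assumes "z \<in> unitary_group"
  shows "adj_conj z (unitary_proj e z b) = - unitary_proj e z b"
  by (simp add: unitary_proj_def linear_diff[OF linear_adj_conj] linear_scale[OF linear_adj_conj]
      linear_add[OF linear_adj_conj] adj_conj_mat adj_conj_adj_conj adj_conj_self assms algebra_simps)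

lemma inner_unitary_proj_mat_i:
  fixes z :: "complex^'n^'n" and e :: real
  assumes "z \<in> unitary_group" "e = 1 / CARD('n)"
  shows "unitary_proj e z b \<bullet> (mat \<i> ** z) = 0"
  using assms
  by (simp add: unitary_proj_def inner_diff_left adj_conj_selfadjoint adj_conj_mat adj_conj_self
      inner_mat_i_self)

text \<open>The factor \<open>e\<close> in the last condition serves both groups: the condition is
  void for e = 0 and means orthogonality to \<i> z for e = 1/n.\<close>

lemma unitary_proj_fixed_iff:
  fixes z :: "complex^'n^'n" and e :: real
  assumes z: "z \<in> unitary_group" and e: "e = 0 \<or> e = 1 / CARD('n)"
  shows "unitary_proj e z v = v \<longleftrightarrow> adj_conj z v = - v \<and> e * (v \<bullet> (mat \<i> ** z)) = 0"
proof
  assume "unitary_proj e z v = v"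
  then show "adj_conj z v = - v \<and> e * (v \<bullet> (mat \<i> ** z)) = 0"
    using adj_conj_unitary_proj[OF z, of e v] inner_unitary_proj_mat_i[OF z, of e v] e by auto
qed (auto simp: unitary_proj_def scaleR_2[symmetric])

lemma unitary_proj_idem:
  fixes z :: "complex^'n^'n" and e :: real
  assumes z: "z \<in> unitary_group" and e: "e = 0 \<or> e = 1 / CARD('n)"
  shows "unitary_proj e z (unitary_proj e z b) = unitary_proj e z b"
  unfolding unitary_proj_fixed_iff[OF assms]
  using adj_conj_unitary_proj[OF z] inner_unitary_proj_mat_i[OF z] e by auto

definition unitary_proj_deriv ::
    "real \<Rightarrow> complex^'n^'n \<Rightarrow> complex^'n^'n \<Rightarrow> complex^'n^'n \<Rightarrow> complex^'n^'n" where
  "unitary_proj_deriv e z b v =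
    - ((1/2) *\<^sub>R (v ** conj_transpose b ** z + z ** conj_transpose b ** v))
    - ((e * (b \<bullet> (mat \<i> ** v))) *\<^sub>R (mat \<i> ** z) + (e * (b \<bullet> (mat \<i> ** z))) *\<^sub>R (mat \<i> ** v))"

lemma has_derivative_unitary_proj:
  "((\<lambda>z. unitary_proj e z b) has_derivative unitary_proj_deriv e z b) (at z)"
proof -
  note mm = bounded_bilinear_matrix_mult
  have K: "((\<lambda>z. mat \<i> ** z) has_derivative (\<lambda>v. mat \<i> ** v)) (at z)"
    by (intro bounded_linear_imp_has_derivative bounded_bilinear.bounded_linear_right[OF mm])
  have "((\<lambda>z. z ** conj_transpose b) has_derivative (\<lambda>v. v ** conj_transpose b)) (at z)"
    by (intro bounded_linear_imp_has_derivative bounded_bilinear.bounded_linear_left[OF mm])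
  from bounded_bilinear.FDERIV[OF mm this has_derivative_ident]
  have J: "((\<lambda>z. adj_conj z b) has_derivative
      (\<lambda>v. z ** conj_transpose b ** v + v ** conj_transpose b ** z)) (at z)"
    by (simp add: adj_conj_def)
  have eK: "((\<lambda>z. e * (b \<bullet> (mat \<i> ** z))) has_derivative (\<lambda>v. e * (b \<bullet> (mat \<i> ** v)))) (at z)"
    by (intro has_derivative_mult_right has_derivative_inner_right K)
  have "((\<lambda>z. unitary_proj e z b) has_derivative (\<lambda>v.
      (1/2) *\<^sub>R (0 - (z ** conj_transpose b ** v + v ** conj_transpose b ** z)) -
      ((e * (b \<bullet> (mat \<i> ** z))) *\<^sub>R (mat \<i> ** v) + (e * (b \<bullet> (mat \<i> ** v))) *\<^sub>R (mat \<i> ** z)))) (at z)"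
    unfolding unitary_proj_def[abs_def]
    by (intro has_derivative_diff has_derivative_scaleR_right has_derivative_scaleR
        has_derivative_const J K eK)
  moreover have "(\<lambda>v. (1/2) *\<^sub>R (0 - (z ** conj_transpose b ** v + v ** conj_transpose b ** z)) -
      ((e * (b \<bullet> (mat \<i> ** z))) *\<^sub>R (mat \<i> ** v) + (e * (b \<bullet> (mat \<i> ** v))) *\<^sub>R (mat \<i> ** z))) =
      unitary_proj_deriv e z b"
    by (simp add: unitary_proj_deriv_def fun_eq_iff algebra_simps)
  ultimately show ?thesis by simp
qed

lemma smooth_on_unitary_proj: "smooth_on UNIV (\<lambda>z. unitary_proj e z b)"
proof -
  note mm = smooth_on_bilinear[OF bounded_bilinear_matrix_mult open_UNIV]
  have id: "smooth_on UNIV (\<lambda>z::complex^'n^'n. z)"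
    by (rule smooth_on_linear) auto
  have "smooth_on UNIV (\<lambda>z. (1/2) *\<^sub>R (b + (- 1) *\<^sub>R adj_conj z b) +
      (- e * ((mat \<i> ** z) \<bullet> b)) *\<^sub>R (mat \<i> ** z))"
    unfolding adj_conj_def
    by (intro smooth_on_add smooth_on_bilinear[OF bounded_bilinear_scaleR] smooth_on_const
        open_UNIV mm id smooth_on_mult smooth_on_bounded_linear[OF bounded_linear_inner_left])
  then show ?thesis by (simp add: unitary_proj_def[abs_def] inner_commute)
qed

text \<open>Tangency rewrites the conjugate transpose of b as - z* b z*, which turns the quadratic
  terms into the symmetric expression (v z* w + w z* v) / 2. The terms with \<open>e\<close> vanish:
  \<i> v and \<i> w are normal to U(n), and \<open>e\<close> times a component along \<i> z is 0 by
  tangency.\<close>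

lemma unitary_proj_deriv_sym:
  fixes z :: "complex^'n^'n" and e :: real
  assumes z: "z \<in> unitary_group" and e: "e = 0 \<or> e = 1 / CARD('n)"
    and v: "unitary_proj e z v = v" and w: "unitary_proj e z w = w"
  shows "unitary_proj_deriv e z w v = unitary_proj_deriv e z v w"
proof -
  note vw = v[unfolded unitary_proj_fixed_iff[OF z e]] w[unfolded unitary_proj_fixed_iff[OF z e]]
  \<comment> \<open>Multiplication by \<i> moves \<open>c\<close> into the +1 eigenspace of a
    self-adjoint map, while \<open>b\<close> lies in the -1 eigenspace.\<close>
  have orth: "b \<bullet> (mat \<i> ** c) = 0" if "adj_conj z b = - b" "adj_conj z c = - c" for b c
  proof -
    have "- b \<bullet> (mat \<i> ** c) = b \<bullet> adj_conj z (mat \<i> ** c)"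
      using that by (metis adj_conj_selfadjoint)
    also have "\<dots> = b \<bullet> (mat \<i> ** c)" using that by (simp add: adj_conj_mat matrix_mult_minus)
    finally show ?thesis by simp
  qed
  have ct: "conj_transpose b = - (conj_transpose z ** b ** conj_transpose z)" if "adj_conj z b = - b" for b
  proof -
    have "conj_transpose b = conj_transpose z ** adj_conj z b ** conj_transpose z"
      by (simp add: adj_conj_def unitary_cancel[OF z] matrix_mul_assoc)
        (simp add: z[unfolded unitary_group_iff])
    then show ?thesis using that by (simp add: matrix_mult_minus)
  qed
  have "v ** conj_transpose w ** z + z ** conj_transpose w ** v =
      - (v ** conj_transpose z ** w + w ** conj_transpose z ** v)"
    using vw by (simp add: ct matrix_mult_minus matrix_mul_assoc unitary_cancel[OF z])
      (simp add: z[unfolded unitary_group_iff])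
  moreover have "w ** conj_transpose v ** z + z ** conj_transpose v ** w =
      - (w ** conj_transpose z ** v + v ** conj_transpose z ** w)"
    using vw by (simp add: ct matrix_mult_minus matrix_mul_assoc unitary_cancel[OF z])
      (simp add: z[unfolded unitary_group_iff])
  ultimately show ?thesis
    using vw by (auto simp: unitary_proj_deriv_def orth add.commute)
qed

section \<open>Sums over an orthonormal basis of matrices\<close>

lemma sum_Basis_vec:
  "(\<Sum>b\<in>(Basis :: ('b::euclidean_space^'n) set). F b) = (\<Sum>i\<in>UNIV. \<Sum>u\<in>Basis. F (axis i u))"
proof -
  have B: "(Basis :: ('b^'n) set) = (\<lambda>(i, u). axis i u) ` (UNIV \<times> Basis)"
    by (auto simp: Basis_vec_def)
  have inj: "inj_on (\<lambda>(i, u). axis i u :: 'b^'n) (UNIV \<times> Basis)"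
    by (auto simp: inj_on_def axis_eq_axis)
  have "(\<Sum>b\<in>(Basis :: ('b^'n) set). F b) = (\<Sum>(i, u)\<in>UNIV \<times> Basis. F (axis i u))"
    unfolding B sum.reindex[OF inj] by (simp add: case_prod_unfold)
  then show ?thesis by (simp add: sum.cartesian_product)
qed

lemma sum_Basis_matrix:
  "(\<Sum>b\<in>(Basis :: (complex^'n^'m) set). F b) =
    (\<Sum>r\<in>UNIV. \<Sum>s\<in>UNIV. F (axis r (axis s 1)) + F (axis r (axis s \<i>)))"
  by (simp add: sum_Basis_vec Basis_complex_def)

text \<open>The basis consists of the matrix units E and of \<i> E, whose contributions cancel as 1
  + \<i>^2 = 0.\<close>

lemma sum_Basis_entry_entry: "(\<Sum>b\<in>(Basis :: (complex^'n^'m) set). b $ i $ j * b $ k $ l) = 0"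
  unfolding sum_Basis_matrix by (intro sum.neutral ballI) (auto simp: axis_def)

lemma sum_Basis_cnj_cnj: "(\<Sum>b\<in>(Basis :: (complex^'n^'m) set). cnj (b $ i $ j) * cnj (b $ k $ l)) = 0"
  using arg_cong[OF sum_Basis_entry_entry[of i j k l], of cnj] by simp

text \<open>With one conjugate the contributions of E and \<i> E are equal, hence the 2.\<close>

lemma sum_Basis_entry_cnj:
  "(\<Sum>b\<in>(Basis :: (complex^'n^'m) set). b $ i $ j * cnj (b $ k $ l)) =
    (if i = k then if j = l then 2 else 0 else 0)"
proof -
  have "(\<Sum>b\<in>(Basis :: (complex^'n^'m) set). b $ i $ j * cnj (b $ k $ l)) =
      (\<Sum>r\<in>UNIV. \<Sum>s\<in>UNIV. if r = i then if s = j then if i = k then if j = l then 2 else 0 else 0 else 0 else 0)"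
    unfolding sum_Basis_matrix by (intro sum.cong refl) (auto simp: axis_def)
  also have "\<dots> = (\<Sum>r\<in>UNIV. if r = i then if i = k then if j = l then 2 else 0 else 0 else 0)"
    by (intro sum.cong refl) (simp add: sum.delta)
  finally show ?thesis by simp
qed

lemma sum_Basis_inner_linear: "linear L \<Longrightarrow> (\<Sum>b\<in>Basis. (b \<bullet> c) *\<^sub>R L b) = L c"
  for c :: "'a::euclidean_space"
  using linear_sum[of L "\<lambda>b. (b \<bullet> c) *\<^sub>R b" Basis]
  by (simp add: linear_scale euclidean_representation inner_commute[of _ c])

lemma sum_Basis_mult_conj_transpose:
  "(\<Sum>b\<in>(Basis :: (complex^'n^'m) set). b ** conj_transpose b) = mat (2 * of_nat CARD('n))"
proof -
  have "(\<Sum>b\<in>(Basis :: (complex^'n^'m) set). \<Sum>l\<in>UNIV. b $ i $ l * cnj (b $ j $ l)) =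
      (if i = j then 2 * of_nat CARD('n) else 0)" for i j
    by (subst sum.swap) (simp add: sum_Basis_entry_cnj)
  then show ?thesis
    by (simp add: vec_eq_iff matrix_matrix_mult_def conj_transpose_def mat_def)
qed

lemma sum_Basis_conj_transpose_mult:
  "(\<Sum>b\<in>(Basis :: (complex^'n^'m) set). conj_transpose b ** b) = mat (2 * of_nat CARD('m))"
proof -
  have "(\<Sum>b\<in>(Basis :: (complex^'n^'m) set). \<Sum>l\<in>UNIV. b $ l $ j * cnj (b $ l $ i)) =
      (if i = j then 2 * of_nat CARD('m) else 0)" for i j
    by (subst sum.swap) (simp add: sum_Basis_entry_cnj)
  then show ?thesis
    by (simp add: vec_eq_iff matrix_matrix_mult_def conj_transpose_def mat_def mult.commute)
qed

lemma sum_Basis_conj_transpose_conj_transpose: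
  "(\<Sum>b\<in>(Basis :: (complex^'n^'m) set). conj_transpose b ** A ** conj_transpose b) = 0"
proof -
  have "(\<Sum>b\<in>(Basis :: (complex^'n^'m) set). \<Sum>s\<in>UNIV. (\<Sum>r\<in>UNIV. cnj (b $ r $ i) * A $ r $ s) * cnj (b $ j $ s)) = 0"
    (is "?S = 0") for i j
  proof -
    have "?S = (\<Sum>s\<in>UNIV. \<Sum>r\<in>UNIV. A $ r $ s *
        (\<Sum>b\<in>(Basis :: (complex^'n^'m) set). cnj (b $ r $ i) * cnj (b $ j $ s)))"
      unfolding sum_distrib_left sum_distrib_right
      by (subst sum.swap, rule sum.cong[OF refl], subst sum.swap) (simp add: mult_ac)
    then show ?thesis by (simp add: sum_Basis_cnj_cnj)
  qed
  then show ?thesis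
    by (simp add: vec_eq_iff matrix_matrix_mult_def conj_transpose_def)
qed

text \<open>The sum is the trace of the product of a skew map, multiplication by \<i>, and a
  self-adjoint one, so it equals its own negative.\<close>

lemma sum_unitary_proj_skew:
  "(\<Sum>b\<in>Basis. b \<bullet> (mat \<i> ** unitary_proj e z b)) = 0" (is "?S = 0")
  for z :: "complex^'n^'n"
proof -
  let ?P = "unitary_proj e z"
  have skew: "(mat \<i> ** b) \<bullet> c = - ((mat \<i> ** c) \<bullet> b)" for b c :: "complex^'n^'n"
    by (subst inner_mat_i) (simp only: inner_commute)
  have P_sym: "?P b \<bullet> c = ?P c \<bullet> b" for b c
    by (subst unitary_proj_selfadjoint) (rule inner_commute)
  have S: "b \<bullet> (mat \<i> ** ?P b) = - ((mat \<i> ** b) \<bullet> ?P b)" for b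
    by (subst inner_commute) (rule skew)
  also have "- ((mat \<i> ** b) \<bullet> ?P b) = (\<Sum>c\<in>Basis. ((mat \<i> ** c) \<bullet> b) * (?P c \<bullet> b))" for b
    by (subst euclidean_inner, subst skew, subst P_sym) (simp add: sum_negf)
  finally have "?S = (\<Sum>b\<in>Basis. \<Sum>c\<in>Basis. ((mat \<i> ** c) \<bullet> b) * (?P c \<bullet> b))" by simp
  also have "\<dots> = (\<Sum>c\<in>Basis. (mat \<i> ** c) \<bullet> ?P c)"
    by (subst sum.swap) (simp only: euclidean_inner[symmetric])
  also have "\<dots> = - ?S" by (simp only: S sum_negf minus_minus)
  finally show ?thesis by simp
qed

text \<open>Entrywise this is \<tau> of the matrix coordinates. Each of the two quadratic terms sums
  to (n - e) z, which the factor - 1/2 turns into the result; the terms along \<i> z add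
  nothing.\<close>

lemma sum_unitary_proj_deriv:
  fixes z :: "complex^'n^'n" and e :: real
  assumes z: "z \<in> unitary_group" and e: "e = 0 \<or> e = 1 / CARD('n)"
  shows "(\<Sum>b\<in>Basis. unitary_proj_deriv e z b (unitary_proj e z b)) = (e - CARD('n)) *\<^sub>R z"
proof -
  let ?K = "mat \<i> ** z" and ?n = "real CARD('n)" and ?P = "unitary_proj e z"
  note mm = bounded_bilinear_matrix_mult
  note sums = bounded_bilinear.sum_left[OF mm] bounded_bilinear.sum_right[OF mm]
  \<comment> \<open>\<i> z is unitary as well, so its products with its conjugate transpose
    disappear.\<close>
  have K: "?K ** conj_transpose ?K = mat 1" "conj_transpose ?K ** ?K = mat 1"
    using z by (simp_all add: conj_transpose_mult matrix_mul_assoc unitary_group_iff)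
      (simp_all add: unitary_cancel[OF z] mat_mult_mat z[unfolded unitary_group_iff] flip: matrix_mul_assoc)
  have mat: "mat (2 * of_nat CARD('n)) ** A = (2 * ?n) *\<^sub>R A" for A :: "complex^'n^'n"
    by (simp add: vec_eq_iff mat_mult_nth) (simp add: scaleR_conv_of_real)
  have T1: "(\<Sum>b\<in>Basis. ?P b ** conj_transpose b ** z) = (?n - e) *\<^sub>R z"
  proof -
    have "?P b ** conj_transpose b ** z = (1/2) *\<^sub>R (b ** conj_transpose b ** z) -
        (1/2) *\<^sub>R (z ** (conj_transpose b ** z ** conj_transpose b) ** z) -
        e *\<^sub>R (b \<bullet> ?K) *\<^sub>R (?K ** conj_transpose b ** z)" for b
      by (simp add: unitary_proj_def adj_conj_def matrix_mult_diff matrix_mult_scaleR matrix_mul_assoc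
          scaleR_right_diff_distrib)
    then have "(\<Sum>b\<in>Basis. ?P b ** conj_transpose b ** z) =
        (1/2) *\<^sub>R ((\<Sum>b\<in>(Basis :: (complex^'n^'n) set). b ** conj_transpose b) ** z) -
        (1/2) *\<^sub>R (z ** (\<Sum>b\<in>(Basis :: (complex^'n^'n) set). conj_transpose b ** z ** conj_transpose b) ** z) -
        e *\<^sub>R (\<Sum>b\<in>Basis. (b \<bullet> ?K) *\<^sub>R (?K ** conj_transpose b ** z))"
      by (simp add: sum_subtractf sums scaleR_sum_right)
    also have "(\<Sum>b\<in>Basis. (b \<bullet> ?K) *\<^sub>R (?K ** conj_transpose b ** z)) = ?K ** conj_transpose ?K ** z"
      by (rule sum_Basis_inner_linear[of "\<lambda>b. ?K ** conj_transpose b ** z"])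
        (rule linearI, simp_all add: matrix_add_ldistrib matrix_add_rdist matrix_mult_scaleR)
    finally show ?thesis
      by (simp add: sum_Basis_mult_conj_transpose sum_Basis_conj_transpose_conj_transpose mat K
          scaleR_left_diff_distrib)
  qed
  have T2: "(\<Sum>b\<in>Basis. z ** conj_transpose b ** ?P b) = (?n - e) *\<^sub>R z"
  proof -
    have "z ** conj_transpose b ** ?P b = (1/2) *\<^sub>R (z ** (conj_transpose b ** b)) -
        (1/2) *\<^sub>R (z ** (conj_transpose b ** z ** conj_transpose b) ** z) -
        e *\<^sub>R (b \<bullet> ?K) *\<^sub>R (z ** conj_transpose b ** ?K)" for b
      by (simp add: unitary_proj_def adj_conj_def matrix_mult_diff matrix_mult_scaleR matrix_mul_assoc
          scaleR_right_diff_distrib)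
    then have "(\<Sum>b\<in>Basis. z ** conj_transpose b ** ?P b) =
        (1/2) *\<^sub>R (z ** (\<Sum>b\<in>(Basis :: (complex^'n^'n) set). conj_transpose b ** b)) -
        (1/2) *\<^sub>R (z ** (\<Sum>b\<in>(Basis :: (complex^'n^'n) set). conj_transpose b ** z ** conj_transpose b) ** z) -
        e *\<^sub>R (\<Sum>b\<in>Basis. (b \<bullet> ?K) *\<^sub>R (z ** conj_transpose b ** ?K))"
      by (simp add: sum_subtractf sums scaleR_sum_right)
    also have "(\<Sum>b\<in>Basis. (b \<bullet> ?K) *\<^sub>R (z ** conj_transpose b ** ?K)) = z ** conj_transpose ?K ** ?K"
      by (rule sum_Basis_inner_linear[of "\<lambda>b. z ** conj_transpose b ** ?K"])
        (rule linearI, simp_all add: matrix_add_ldistrib matrix_add_rdist matrix_mult_scaleR)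
    finally show ?thesis
      by (simp add: sum_Basis_conj_transpose_mult sum_Basis_conj_transpose_conj_transpose
          matrix_mult_mat_commute mat K scaleR_left_diff_distrib flip: matrix_mul_assoc[of z "conj_transpose _"])
  qed
  have T4: "(\<Sum>b\<in>Basis. (e * (b \<bullet> ?K)) *\<^sub>R (mat \<i> ** ?P b)) = 0"
  proof -
    have "(\<Sum>b\<in>Basis. (b \<bullet> ?K) *\<^sub>R (mat \<i> ** ?P b)) = mat \<i> ** ?P ?K"
      by (rule sum_Basis_inner_linear[of "\<lambda>b. mat \<i> ** ?P b"])
        (rule linearI, simp_all add: matrix_add_ldistrib matrix_mult_scaleR linear_add[OF linear_unitary_proj]
          linear_scale[OF linear_unitary_proj])
    moreover have "?P ?K = (1 - e * ?n) *\<^sub>R ?K"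
      by (simp add: unitary_proj_def adj_conj_mat adj_conj_self z inner_mat_i_self scaleR_left_diff_distrib
          flip: scaleR_2)
    ultimately have "(\<Sum>b\<in>Basis. (b \<bullet> ?K) *\<^sub>R (mat \<i> ** ?P b)) = - ((1 - e * ?n) *\<^sub>R z)"
      by (simp add: matrix_mult_scaleR mat_i_mat_i)
    then have "(\<Sum>b\<in>Basis. (e * (b \<bullet> ?K)) *\<^sub>R (mat \<i> ** ?P b)) = - ((e * (1 - e * ?n)) *\<^sub>R z)"
      by (simp flip: scaleR_scaleR scaleR_sum_right)
    \<comment> \<open>Both admissible values of \<open>e\<close> are roots of e (1 - e n).\<close>
    then show ?thesis using e by auto
  qed
  have T3: "(\<Sum>b\<in>Basis. (e * (b \<bullet> (mat \<i> ** ?P b))) *\<^sub>R ?K) = 0"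
    by (simp add: sum_unitary_proj_skew flip: scaleR_sum_left sum_distrib_left)
  have "(\<Sum>b\<in>Basis. unitary_proj_deriv e z b (?P b)) =
      - ((1/2) *\<^sub>R ((\<Sum>b\<in>Basis. ?P b ** conj_transpose b ** z) + (\<Sum>b\<in>Basis. z ** conj_transpose b ** ?P b)))
      - ((\<Sum>b\<in>Basis. (e * (b \<bullet> (mat \<i> ** ?P b))) *\<^sub>R ?K) + (\<Sum>b\<in>Basis. (e * (b \<bullet> ?K)) *\<^sub>R (mat \<i> ** ?P b)))"
    by (simp only: unitary_proj_deriv_def sum_subtractf sum_negf sum.distrib scaleR_sum_right[symmetric])
  also have "\<dots> = (e - ?n) *\<^sub>R z"
    unfolding T1 T2 T3 T4 by (simp add: scaleR_left_diff_distrib flip: scaleR_2)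
  finally show ?thesis .
qed

lemma adj_conj_nth:
  "adj_conj z b $ i $ j = (\<Sum>x\<in>UNIV. z $ i $ snd x * z $ fst x $ j * cnj (b $ fst x $ snd x))"
proof -
  have "adj_conj z b $ i $ j = (\<Sum>r\<in>UNIV. \<Sum>s\<in>UNIV. z $ i $ s * z $ r $ j * cnj (b $ r $ s))"
    by (simp add: adj_conj_def matrix_matrix_mult_def conj_transpose_def sum_distrib_left sum_distrib_right mult_ac)
  then show ?thesis by (simp add: sum.cartesian_product case_prod_unfold)
qed

lemma sum_Basis_entry_adj_conj:
  "(\<Sum>b\<in>Basis. b $ i $ j * adj_conj z b $ k $ l) = 2 * z $ k $ j * z $ i $ l"
  for z :: "complex^'n^'n"
proof -
  have "(\<Sum>b\<in>Basis. b $ i $ j * adj_conj z b $ k $ l) =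
      (\<Sum>x\<in>UNIV. z $ k $ snd x * z $ fst x $ l *
        (\<Sum>b\<in>(Basis :: (complex^'n^'n) set). b $ i $ j * cnj (b $ fst x $ snd x)))"
    unfolding adj_conj_nth sum_distrib_left by (subst sum.swap) (simp add: mult_ac)
  also have "\<dots> = (\<Sum>x\<in>UNIV. if x = (i, j) then 2 * z $ k $ j * z $ i $ l else 0)"
    by (rule sum.cong) (auto simp: sum_Basis_entry_cnj)
  finally show ?thesis by simp
qed

lemma sum_Basis_adj_conj_adj_conj:
  "(\<Sum>b\<in>Basis. adj_conj z b $ i $ j * adj_conj z b $ k $ l) = 0"
  for z :: "complex^'n^'n"
proof -
  have "(\<Sum>b\<in>Basis. adj_conj z b $ i $ j * adj_conj z b $ k $ l) =
      (\<Sum>x\<in>UNIV. \<Sum>y\<in>UNIV. (z $ i $ snd x * z $ fst x $ j) * (z $ k $ snd y * z $ fst y $ l) *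
        (\<Sum>b\<in>(Basis :: (complex^'n^'n) set). cnj (b $ fst x $ snd x) * cnj (b $ fst y $ snd y)))"
  proof -
    have "(\<Sum>b\<in>Basis. adj_conj z b $ i $ j * adj_conj z b $ k $ l) =
        (\<Sum>b\<in>Basis. \<Sum>x\<in>UNIV. \<Sum>y\<in>UNIV. (z $ i $ snd x * z $ fst x $ j * cnj (b $ fst x $ snd x)) *
          (z $ k $ snd y * z $ fst y $ l * cnj (b $ fst y $ snd y)))"
      unfolding adj_conj_nth by (simp only: sum_product)
    then show ?thesis
      unfolding sum_distrib_left
      by (simp only:) (subst sum.swap, rule sum.cong[OF refl], subst sum.swap, simp add: mult_ac)
  qed
  then show ?thesis by (simp add: sum_Basis_cnj_cnj)
qed

text \<open>\<open>R\<close> is the projection for U(n), and it fixes \<open>?K\<close>. The part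
  with \<open>R\<close> alone gives the swapped product; the others are multiples of a product of
  two entries of \<open>?K\<close>, where \<i>^2 reverses the sign.\<close>

lemma sum_unitary_proj_entries:
  fixes z :: "complex^'n^'n" and e :: real
  assumes z: "z \<in> unitary_group" and e: "e = 0 \<or> e = 1 / CARD('n)"
  shows "(\<Sum>b\<in>Basis. unitary_proj e z b $ i $ j * unitary_proj e z b $ k $ l) =
    - z $ i $ l * z $ k $ j + of_real e * z $ i $ j * z $ k $ l"
proof -
  let ?K = "mat \<i> ** z"
  define R where "R b = (1/2) *\<^sub>R (b - adj_conj z b)" for b
  have R: "unitary_proj e z b = R b - (e * (b \<bullet> ?K)) *\<^sub>R ?K" for b
    by (simp add: unitary_proj_def R_def)
  have RK: "R ?K = ?K"
    by (simp add: R_def adj_conj_mat adj_conj_self z flip: scaleR_2)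
  have RR: "(\<Sum>b\<in>Basis. R b $ i $ j * R b $ k $ l) = - z $ i $ l * z $ k $ j"
  proof -
    have "R b $ i $ j * R b $ k $ l = (1/4) * (b $ i $ j * b $ k $ l - b $ i $ j * adj_conj z b $ k $ l
        - b $ k $ l * adj_conj z b $ i $ j + adj_conj z b $ i $ j * adj_conj z b $ k $ l)" for b
      by (simp add: R_def) (simp add: scaleR_conv_of_real algebra_simps)
    then have "(\<Sum>b\<in>Basis. R b $ i $ j * R b $ k $ l) = (1/4) * (\<Sum>b\<in>Basis. b $ i $ j * b $ k $ l
        - b $ i $ j * adj_conj z b $ k $ l - b $ k $ l * adj_conj z b $ i $ j
        + adj_conj z b $ i $ j * adj_conj z b $ k $ l)"
      by (simp only: sum_distrib_left)
    then show ?thesis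
      by (simp add: sum.distrib sum_subtractf sum_Basis_entry_entry sum_Basis_entry_adj_conj
          sum_Basis_adj_conj_adj_conj)
  qed
  have RKs: "(\<Sum>b\<in>Basis. of_real (b \<bullet> ?K) * R b $ r $ s) = ?K $ r $ s" for r s
  proof -
    have "linear (\<lambda>b. R b $ r $ s)"
      by (rule linearI) (simp_all add: R_def linear_add[OF linear_adj_conj] linear_scale[OF linear_adj_conj]
          algebra_simps)
    from sum_Basis_inner_linear[OF this, of ?K] show ?thesis
      by (simp add: RK scaleR_conv_of_real)
  qed
  have KK: "(\<Sum>b\<in>Basis. (b \<bullet> ?K)\<^sup>2) = CARD('n)"
    using euclidean_inner[of ?K ?K] by (simp add: inner_mat_i_self[OF z] power2_eq_square inner_commute)
  have "(\<Sum>b\<in>Basis. unitary_proj e z b $ i $ j * unitary_proj e z b $ k $ l) =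
      (\<Sum>b\<in>Basis. R b $ i $ j * R b $ k $ l) - of_real e * ?K $ k $ l * (\<Sum>b\<in>Basis. of_real (b \<bullet> ?K) * R b $ i $ j)
      - of_real e * ?K $ i $ j * (\<Sum>b\<in>Basis. of_real (b \<bullet> ?K) * R b $ k $ l)
      + of_real (e\<^sup>2) * ?K $ i $ j * ?K $ k $ l * of_real (\<Sum>b\<in>Basis. (b \<bullet> ?K)\<^sup>2)"
    unfolding sum_distrib_left of_real_sum sum_subtractf[symmetric] sum.distrib[symmetric]
    by (intro sum.cong refl) (simp add: R, simp add: scaleR_conv_of_real algebra_simps power2_eq_square)
  also have "\<dots> = - z $ i $ l * z $ k $ j + of_real (2 * e - e\<^sup>2 * CARD('n)) * z $ i $ j * z $ k $ l"
    unfolding RR RKs KK by (simp add: mat_mult_nth algebra_simps)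
  \<comment> \<open>The mixed terms contribute 2 e, the square of the component along
    \<open>?K\<close> takes back e^2 n, and e n is 0 or 1.\<close>
  also have "2 * e - e\<^sup>2 * CARD('n) = e"
    using e by (auto simp: power2_eq_square)
  finally show ?thesis .
qed

section \<open>Curves in the unitary groups\<close>

lemma smooth_on_det:
  fixes F :: "'a::euclidean_space \<Rightarrow> complex^'n^'n"
  assumes S: "open S" and F: "\<And>i j. smooth_on S (\<lambda>x. F x $ i $ j)"
  shows "smooth_on S (\<lambda>x. det (F x))"
  unfolding det_def by (intro smooth_on_sum smooth_on_mult smooth_on_prod smooth_on_const S F)

lemma smooth_on_entry:
  "open S \<Longrightarrow> smooth_on S F \<Longrightarrow> smooth_on S (\<lambda>x. F x $ i $ j)"
  by (rule smooth_on_bounded_linear[OF bounded_linear_entry])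

text \<open>Cramer's rule for the columns of the identity; it exhibits the inverse as a rational
  function of the entries.\<close>

lemma matrix_inv_nth:
  fixes A :: "'a::field^'n^'n"
  assumes "det A \<noteq> 0"
  shows "matrix_inv A $ k $ l = det (\<chi> i j. if j = k then axis l 1 $ i else A $ i $ j) / det A"
proof -
  obtain B where "A ** B = mat 1"
    using assms invertible_det_nz invertible_def by blast
  then have "A ** matrix_inv A = mat 1" using matrix_inv_unique by metis
  then have "A *v column l (matrix_inv A) = axis l 1"
    by (simp add: vec_eq_iff matrix_matrix_mult_def matrix_vector_mult_def column_def mat_def axis_def)
  then have "column l (matrix_inv A) =
      (\<chi> k. det (\<chi> i j. if j = k then axis l 1 $ i else A $ i $ j) / det A)"
    using cramer[OF assms] by blast
  then show ?thesis by (simp add: column_def vec_eq_iff)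
qed

lemma smooth_on_matrix_inv:
  fixes F :: "'a::euclidean_space \<Rightarrow> complex^'n^'n"
  assumes S: "open S" and F: "smooth_on S F" and nz: "\<And>x. x \<in> S \<Longrightarrow> det (F x) \<noteq> 0"
  shows "smooth_on S (\<lambda>x. matrix_inv (F x))"
proof (rule smooth_on_vec[OF S], rule smooth_on_vec[OF S])
  fix k l :: 'n
  note FS = smooth_on_entry[OF S F]
  have "smooth_on S (\<lambda>x. (\<chi> i j. if j = k then axis l 1 $ i else F x $ i $ j) $ i $ j)" for i j
    by (cases "j = k") (simp_all add: FS smooth_on_const)
  then have "smooth_on S (\<lambda>x. det (\<chi> i j. if j = k then axis l 1 $ i else F x $ i $ j) * inverse (det (F x)))"
    by (intro smooth_on_mult smooth_on_inverse smooth_on_det S FS nz)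
  then show "smooth_on S (\<lambda>x. matrix_inv (F x) $ k $ l)"
    by (rule smooth_on_cong[OF S]) (simp add: matrix_inv_nth nz divide_inverse)
qed

lemma det_conj_transpose: "det (conj_transpose A) = cnj (det A)" for A :: "complex^'n^'n"
proof -
  have "conj_transpose A = transpose (\<chi> i j. cnj (A $ i $ j))"
    by (simp add: conj_transpose_def transpose_def vec_eq_iff)
  then have "det (conj_transpose A) = det (\<chi> i j. cnj (A $ i $ j))" by (simp only: det_transpose)
  then show ?thesis by (simp add: det_def)
qed

text \<open>In the Leibniz formula a permutation other than the identity moves at least two points.
  With one factor differentiated, another off-diagonal entry of the identity matrix remains, which
  is 0.\<close>

lemma has_derivative_det_mat_1:
  "(det has_derivative trace) (at (mat 1 :: complex^'n^'n))"
proof -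
  let ?U = "UNIV :: 'n set"
  let ?D = "\<lambda>v::complex^'n^'n. \<Sum>p | p permutes ?U. of_int (sign p) *
    (\<Sum>i\<in>?U. v $ i $ p i * (\<Prod>j\<in>?U - {i}. (mat 1 :: complex^'n^'n) $ j $ p j))"
  have entry: "((\<lambda>A::complex^'n^'n. A $ i $ j) has_derivative (\<lambda>v. v $ i $ j)) (at (mat 1))" for i j
    by (rule bounded_linear_imp_has_derivative[OF bounded_linear_entry])
  have D: "(det has_derivative ?D) (at (mat 1))"
    unfolding det_def[abs_def]
    by (intro has_derivative_sum has_derivative_mult_right has_derivative_prod entry)
  have "?D v = trace v" for v
  proof -
    have zero: "(\<Sum>i\<in>?U. v $ i $ p i * (\<Prod>j\<in>?U - {i}. (mat 1 :: complex^'n^'n) $ j $ p j)) = 0"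
      if p: "p permutes ?U" "p \<noteq> id" for p
    proof (rule sum.neutral, rule ballI)
      fix i
      have "\<exists>j. j \<noteq> i \<and> p j \<noteq> j"
      proof (rule ccontr)
        assume "\<nexists>j. j \<noteq> i \<and> p j \<noteq> j"
        then have other: "p j = j" if "j \<noteq> i" for j using that by blast
        have "p i = i"
          using other[of "p i"] permutes_inj[OF p(1)] by (metis injD)
        with other have "p = id" by (metis eq_id_iff)
        with p show False by simp
      qed
      then show "v $ i $ p i * (\<Prod>j\<in>?U - {i}. (mat 1 :: complex^'n^'n) $ j $ p j) = 0"
        by (auto simp: mat_def)
    qed
    have "?D v = (\<Sum>p\<in>{id}. of_int (sign p) *
        (\<Sum>i\<in>?U. v $ i $ p i * (\<Prod>j\<in>?U - {i}. (mat 1 :: complex^'n^'n) $ j $ p j)))"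
      by (rule sum.mono_neutral_right) (auto simp: permutes_id zero)
    then show ?thesis by (simp add: trace_def mat_def sign_id)
  qed
  then have "?D = trace" by (rule ext)
  with D show ?thesis by simp
qed

text \<open>Multiplicativity of the determinant carries the derivative at \<open>x\<close> back to
  the identity.\<close>

lemma has_derivative_det_unitary:
  assumes x: "x \<in> unitary_group"
  shows "(det has_derivative (\<lambda>v. det x * trace (conj_transpose x ** v))) (at x)"
proof -
  have "((\<lambda>y. conj_transpose x ** y) has_derivative (\<lambda>v. conj_transpose x ** v)) (at x)"
    by (intro bounded_linear_imp_has_derivative bounded_bilinear.bounded_linear_right
        bounded_bilinear_matrix_mult)
  from has_derivative_compose[OF this, of det trace] has_derivative_det_mat_1
  have "((\<lambda>y. det (conj_transpose x ** y)) has_derivative (\<lambda>v. trace (conj_transpose x ** v))) (at x)"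
    using x by (simp add: unitary_group_iff)
  then have "((\<lambda>y. det x * det (conj_transpose x ** y)) has_derivative
      (\<lambda>v. det x * trace (conj_transpose x ** v))) (at x)"
    by (rule has_derivative_mult_right)
  moreover have "det x * det (conj_transpose x ** y) = det y" for y
    by (simp add: unitary_cancel[OF x] flip: det_mul)
  ultimately show ?thesis by simp
qed

lemma trace_conj_transpose: "trace (conj_transpose A) = cnj (trace A)"
  by (simp add: trace_def conj_transpose_def)

text \<open>The right-hand side is the linearised unitarity condition, the derivative of z z* along
  \<open>v\<close>.\<close>

lemma adj_conj_neg_iff:
  assumes x: "x \<in> unitary_group"
  shows "adj_conj x v = - v \<longleftrightarrow> x ** conj_transpose v + v ** conj_transpose x = 0"
proof -
  have "x ** conj_transpose v + v ** conj_transpose x = (adj_conj x v + v) ** conj_transpose x"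
    by (simp add: adj_conj_def matrix_add_rdist unitary_cancel[OF x])
  moreover have "A ** conj_transpose x = 0 \<longleftrightarrow> A = 0" for A :: "complex^'a^'a"
    using unitary_cancel(4)[OF x, of A] by (metis bounded_bilinear.zero_left[OF bounded_bilinear_matrix_mult])
  ultimately show ?thesis by (simp add: add_eq_0_iff2)
qed

text \<open>x* v is skew-Hermitian, so its trace is imaginary, and the imaginary part is the inner
  product with \<i> x. Hence linearising det = 1 gives orthogonality to \<i> x.\<close>

lemma trace_tangent:
  assumes x: "x \<in> unitary_group" and v: "adj_conj x v = - v"
  shows "trace (conj_transpose x ** v) = \<i> * (v \<bullet> (mat \<i> ** x))"
proof -
  have "v \<bullet> (mat \<i> ** x) = Re (trace (v ** (conj_transpose x ** mat (- \<i>))))"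
    by (simp add: inner_eq_trace conj_transpose_mult)
  also have "v ** (conj_transpose x ** mat (- \<i>)) = mat (- \<i>) ** (v ** conj_transpose x)"
    by (subst matrix_mul_assoc) (rule matrix_mult_mat_commute)
  also have "trace (mat (- \<i>) ** A) = - \<i> * trace A" for A :: "complex^'a^'a"
    by (simp add: trace_def mat_mult_nth sum_distrib_left)
  finally have im: "v \<bullet> (mat \<i> ** x) = Im (trace (conj_transpose x ** v))"
    by (simp add: trace_mul_sym[of v])
  have "trace (conj_transpose x ** v) = - trace (conj_transpose (conj_transpose x ** v))"
  proof -
    have "conj_transpose (conj_transpose x ** v) = - (conj_transpose x ** v)"
    proof -
      have "conj_transpose x ** (x ** conj_transpose v + v ** conj_transpose x) ** x = 0"
        using v unfolding adj_conj_neg_iff[OF x] by simp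
      then show ?thesis
        by (simp add: matrix_add_ldistrib matrix_add_rdist unitary_cancel[OF x] conj_transpose_mult
            matrix_mul_assoc)
          (simp add: x[unfolded unitary_group_iff] eq_neg_iff_add_eq_0)
    qed
    then show ?thesis by (simp add: trace_def sum_negf)
  qed
  from arg_cong[OF this, of Re] have "Re (trace (conj_transpose x ** v)) = 0"
    by (simp add: trace_conj_transpose)
  with im show ?thesis by (simp add: complex_eq_iff)
qed

lemma smooth_on_matrix_mult:
  fixes F G :: "'a::euclidean_space \<Rightarrow> complex^'n^'n"
  shows "open S \<Longrightarrow> smooth_on S F \<Longrightarrow> smooth_on S G \<Longrightarrow> smooth_on S (\<lambda>x. F x ** G x)"
  by (rule smooth_on_bilinear[OF bounded_bilinear_matrix_mult])

text \<open>The Cayley transform \<open>x (1 + t A) (1 - t A)\<inverse>\<close> of the skew-Hermitian matrix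
  \<open>A = x\<^sup>* v / 2\<close> avoids the matrix exponential.\<close>

lemma unitary_curve:
  fixes x v :: "complex^'n^'n"
  assumes x: "x \<in> unitary_group" and v: "adj_conj x v = - v"
  obtains \<gamma> S where "open S" "(0::real) \<in> S" "smooth_on S \<gamma>" "\<gamma> ` S \<subseteq> unitary_group" "\<gamma> 0 = x"
    "(\<gamma> has_vector_derivative v) (at 0)"
proof -
  \<comment> \<open>The two factors of the Cayley transform each contribute x A to the velocity at
    0, whence the 1/2.\<close>
  define A where "A = (1/2) *\<^sub>R (conj_transpose x ** v)"
  have A: "conj_transpose A = - A"
  proof -
    have "conj_transpose v ** x = conj_transpose x ** adj_conj x v"
      by (simp add: adj_conj_def matrix_mul_assoc x[unfolded unitary_group_iff])
    then show ?thesis by (simp add: A_def v conj_transpose_mult matrix_mult_minus)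
  qed
  define B where "B t = mat 1 + t *\<^sub>R A" for t :: real
  define S where "S = {t. det (B (- t)) \<noteq> 0}"
  define \<gamma> where "\<gamma> t = x ** (B t ** matrix_inv (B (- t)))" for t
  have B_smooth: "smooth_on UNIV (\<lambda>t. B (c * t))" for c
    unfolding B_def
    by (intro smooth_on_add smooth_on_const open_UNIV smooth_on_bilinear[OF bounded_bilinear_scaleR]
        smooth_on_linear bounded_linear_mult_right)
  note B_smooth' = B_smooth[of "-1", simplified] B_smooth[of 1, simplified]
  have "continuous_on UNIV (\<lambda>t. det (B (- t)))"
    by (intro smooth_on_imp_continuous_on smooth_on_det open_UNIV smooth_on_entry B_smooth')
  then have S: "open S"
    unfolding S_def by (intro open_Collect_neq) (auto intro: continuous_on_const)
  have B0: "B 0 = mat 1" by (simp add: B_def)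
  have S0: "0 \<in> S" by (simp add: S_def B0)
  have inv: "B (- t) ** matrix_inv (B (- t)) = mat 1" "matrix_inv (B (- t)) ** B (- t) = mat 1" if t: "t \<in> S" for t
  proof -
    obtain C where "B (- t) ** C = mat 1"
      using t invertible_det_nz invertible_def unfolding S_def by blast
    then show "B (- t) ** matrix_inv (B (- t)) = mat 1" using matrix_inv_unique by metis
    then show "matrix_inv (B (- t)) ** B (- t) = mat 1" by (simp add: matrix_left_right_inverse)
  qed
  have \<gamma>_smooth: "smooth_on S \<gamma>"
    unfolding \<gamma>_def
    by (intro smooth_on_matrix_mult S smooth_on_const smooth_on_matrix_inv smooth_on_subset[OF B_smooth'(1)]
        smooth_on_subset[OF B_smooth'(2)]) (auto simp: S_def)
  have unitary: "\<gamma> t \<in> unitary_group" if t: "t \<in> S" for t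
  proof -
    let ?G = "matrix_inv (B (- t))"
    have ct: "conj_transpose (B s) = B (- s)" for s by (simp add: B_def A)
    have comm: "B (- t) ** B t = B t ** B (- t)"
      by (simp add: B_def matrix_add_ldistrib matrix_add_rdist matrix_mult_diff matrix_mult_scaleR algebra_simps)
    have "?G ** (B (- t) ** B t) ** ?G = ?G ** (B t ** B (- t)) ** ?G" by (simp only: comm)
    then have GB: "B t ** ?G = ?G ** B t"
      by (simp add: matrix_mul_assoc inv[OF t]) (simp add: inv[OF t] flip: matrix_mul_assoc)
    have "B t ** conj_transpose ?G = mat 1"
      using arg_cong[OF inv(2)[OF t], of conj_transpose] by (simp add: conj_transpose_mult ct)
    then have "?G ** (B t ** conj_transpose ?G) ** B (- t) = mat 1" by (simp add: inv[OF t])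
    then have "(B t ** ?G) ** (conj_transpose ?G ** B (- t)) = mat 1"
      by (simp add: GB matrix_mul_assoc)
    then have "(B t ** ?G) ** conj_transpose (B t ** ?G) = mat 1"
      by (simp only: conj_transpose_mult ct)
    then show ?thesis
      using x unfolding unitary_group_def \<gamma>_def mem_Collect_eq conj_transpose_mult[of x]
      by (metis matrix_mul_assoc matrix_mul_rid)
  qed
  have "(\<gamma> has_vector_derivative v) (at 0)"
  proof -
    \<comment> \<open>The velocity exists by smoothness; differentiating
      \<open>\<gamma> t ** B (- t) = x ** B t\<close> identifies it without a derivative of the
      inverse.\<close>
    obtain d where d: "(\<gamma> has_vector_derivative d) (at 0)"
      using smooth_on_has_derivative[OF \<gamma>_smooth S0] differentiableI vector_derivative_works by blast
    have dB: "((\<lambda>t. B (c * t)) has_vector_derivative c *\<^sub>R A) (at 0)" for c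
      unfolding B_def by (auto intro!: derivative_eq_intros)
    have "((\<lambda>t. \<gamma> t ** B (- t)) has_vector_derivative \<gamma> 0 ** (- A) + d ** B 0) (at 0)"
      using bounded_bilinear.has_vector_derivative[OF bounded_bilinear_matrix_mult d dB[of "-1"]] by simp
    moreover have "((\<lambda>t. \<gamma> t ** B (- t)) has_vector_derivative x ** A) (at 0)"
    proof (rule has_vector_derivative_transform_within_open[OF _ S S0])
      show "((\<lambda>t. x ** B t) has_vector_derivative x ** A) (at 0)"
        using bounded_linear.has_vector_derivative[OF bounded_bilinear.bounded_linear_right[OF
            bounded_bilinear_matrix_mult] dB[of 1]] by simp
      show "x ** B t = \<gamma> t ** B (- t)" if "t \<in> S" for t
        using inv[OF that] by (simp add: \<gamma>_def flip: matrix_mul_assoc)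
    qed
    ultimately have "\<gamma> 0 ** (- A) + d ** B 0 = x ** A" by (rule vector_derivative_unique_at)
    moreover have "\<gamma> 0 = x"
      using inv[OF S0] by (simp add: \<gamma>_def B0)
    ultimately have "d = x ** A + x ** A" by (simp add: B0 matrix_mult_minus algebra_simps)
    also have "\<dots> = v"
      by (simp add: A_def matrix_mult_scaleR unitary_cancel[OF x] flip: scaleR_left.add)
    finally show ?thesis using d by simp
  qed
  moreover have "\<gamma> 0 = x" using inv[OF S0] by (simp add: \<gamma>_def B0)
  ultimately show thesis using that[OF S S0 \<gamma>_smooth _ _] unitary by blast
qed

text \<open>A unitary curve is multiplied by a diagonal matrix \<open>D t\<close> that carries the
  conjugate of its determinant in one place. Orthogonality to \<i> x makes the determinant
  stationary at 0, so the velocity stays \<open>v\<close>.\<close>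

lemma special_unitary_curve:
  fixes x v :: "complex^'n^'n"
  assumes x: "x \<in> special_unitary_group" and v: "adj_conj x v = - v" "v \<bullet> (mat \<i> ** x) = 0"
  obtains \<gamma> S where "open S" "(0::real) \<in> S" "smooth_on S \<gamma>" "\<gamma> ` S \<subseteq> special_unitary_group" "\<gamma> 0 = x"
    "(\<gamma> has_vector_derivative v) (at 0)"
proof -
  have xu: "x \<in> unitary_group" and dx: "det x = 1" using x by (auto simp: special_unitary_group_def)
  obtain \<gamma> S where S: "open S" "(0::real) \<in> S" and \<gamma>: "smooth_on S \<gamma>" "\<gamma> ` S \<subseteq> unitary_group" "\<gamma> 0 = x"
    "(\<gamma> has_vector_derivative v) (at 0)"
    using unitary_curve[OF xu v(1)] by metis
  \<comment> \<open>Any diagonal place serves for the correction.\<close>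
  define \<beta> :: 'n where "\<beta> = undefined"
  define L :: "complex \<Rightarrow> complex^'n^'n" where "L c = (\<chi> i j. if i = \<beta> \<and> j = \<beta> then c else 0)" for c
  have L: "bounded_linear L"
    by (intro linear_conv_bounded_linear[THEN iffD1] linearI) (auto simp: L_def vec_eq_iff)
  define D where "D t = mat 1 + L (cnj (det (\<gamma> t)) - 1)" for t
  have D_nth: "D t $ i $ j = (if i = j then if i = \<beta> then cnj (det (\<gamma> t)) else 1 else 0)" for t i j
    by (auto simp: D_def L_def mat_def)
  have det_unit: "det (\<gamma> t) * cnj (det (\<gamma> t)) = 1" if "t \<in> S" for t
  proof -
    have "det (\<gamma> t ** conj_transpose (\<gamma> t)) = 1"
      using that \<gamma>(2) unfolding unitary_group_def by auto
    then show ?thesis by (simp only: det_mul det_conj_transpose)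
  qed
  have "\<gamma> t ** D t \<in> special_unitary_group" if t: "t \<in> S" for t
  proof -
    have "D t ** conj_transpose (D t) = mat 1"
    proof -
      have "(D t ** conj_transpose (D t)) $ i $ j = mat 1 $ i $ j" for i j
      proof -
        have "(D t ** conj_transpose (D t)) $ i $ j = (\<Sum>k\<in>UNIV. D t $ i $ k * cnj (D t $ j $ k))"
          by (simp add: matrix_matrix_mult_def conj_transpose_def)
        also have "\<dots> = (\<Sum>k\<in>UNIV. if k = i then D t $ i $ i * cnj (D t $ j $ i) else 0)"
          by (rule sum.cong) (auto simp: D_nth)
        also have "\<dots> = mat 1 $ i $ j"
          using det_unit[OF t] by (simp add: D_nth mat_def mult.commute)
        finally show ?thesis .
      qed
      then show ?thesis by (simp add: vec_eq_iff)
    qed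
    moreover have "\<gamma> t ** conj_transpose (\<gamma> t) = mat 1"
      using t \<gamma>(2) unfolding unitary_group_def by auto
    ultimately have "\<gamma> t ** D t \<in> unitary_group"
      unfolding unitary_group_def mem_Collect_eq conj_transpose_mult
      by (metis matrix_mul_assoc matrix_mul_rid)
    moreover have "det (D t) = cnj (det (\<gamma> t))"
      by (subst det_diagonal) (simp_all add: D_nth)
    ultimately show ?thesis
      using det_unit[OF t] by (simp add: special_unitary_group_def det_mul)
  qed
  moreover have det_smooth: "smooth_on S (\<lambda>t. cnj (det (\<gamma> t)))"
    by (intro smooth_on_bounded_linear[OF bounded_linear_cnj] smooth_on_det smooth_on_entry S \<gamma>)
  have "smooth_on S D"
  proof -
    have "smooth_on S (\<lambda>t. mat 1 + L (cnj (det (\<gamma> t)) + (- 1)))"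
      by (intro smooth_on_add smooth_on_bounded_linear[OF L] smooth_on_const S det_smooth)
    then show ?thesis by (simp add: D_def[abs_def])
  qed
  then have "smooth_on S (\<lambda>t. \<gamma> t ** D t)"
    by (intro smooth_on_matrix_mult S \<gamma>)
  moreover have D0: "D 0 = mat 1"
    by (simp add: D_def L_def \<gamma>(3) dx) (simp add: vec_eq_iff)
  moreover have "((\<lambda>t. \<gamma> t ** D t) has_vector_derivative v) (at 0)"
  proof -
    have "((\<lambda>t. det (\<gamma> t)) has_derivative (\<lambda>t. det x * trace (conj_transpose x ** (t *\<^sub>R v)))) (at 0)"
      by (rule has_derivative_compose[OF \<gamma>(4)[unfolded has_vector_derivative_def]])
        (simp add: \<gamma>(3) has_derivative_det_unitary[OF xu])
    moreover have "det x * trace (conj_transpose x ** (t *\<^sub>R v)) =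
        t *\<^sub>R (det x * trace (conj_transpose x ** v))" for t
      by (simp add: matrix_mult_scaleR trace_def scaleR_sum_right[symmetric])
    ultimately have "((\<lambda>t. det (\<gamma> t)) has_vector_derivative det x * trace (conj_transpose x ** v)) (at 0)"
      unfolding has_vector_derivative_def by simp
    then have "((\<lambda>t. det (\<gamma> t)) has_vector_derivative 0) (at 0)"
      using trace_tangent[OF xu v(1)] v(2) by simp
    from bounded_linear.has_vector_derivative[OF bounded_linear_cnj this]
    have "((\<lambda>t. cnj (det (\<gamma> t))) has_vector_derivative 0) (at 0)" by (simp only: complex_cnj_zero)
    then have "((\<lambda>t. cnj (det (\<gamma> t)) - 1) has_vector_derivative 0) (at 0)"
      using has_vector_derivative_diff[OF _ has_vector_derivative_const[of 1], of "\<lambda>t. cnj (det (\<gamma> t))" 0]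
      by simp
    note LD = bounded_linear.has_vector_derivative[OF L this]
    have "(D has_vector_derivative 0) (at 0)"
      using has_vector_derivative_add[OF has_vector_derivative_const[of "mat 1"] LD]
      by (simp add: D_def[abs_def] linear_0[OF bounded_linear.linear[OF L]])
    from bounded_bilinear.has_vector_derivative[OF bounded_bilinear_matrix_mult \<gamma>(4) this]
    show ?thesis by (simp add: D0)
  qed
  ultimately show thesis
    using that[OF S, of "\<lambda>t. \<gamma> t ** D t"] \<gamma>(3) by auto
qed

section \<open>The eigenfamilies\<close>

text \<open>The curves are constructed on some open set around 0, whereas
  \<open>curve_through\<close> wants a symmetric interval mapped into the relatively open subset;
  continuity allows the shrinking.\<close>

lemma tangent_space_open_Int:
  assumes S: "open S" "(0::real) \<in> S" and \<gamma>: "smooth_on S \<gamma>" "\<gamma> ` S \<subseteq> N" "\<gamma> 0 = x"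
    "(\<gamma> has_vector_derivative v) (at 0)"
    and U: "open U" "x \<in> U"
  shows "v \<in> tangent_space (N \<inter> U) x"
proof -
  have "open (S \<inter> \<gamma> -` U)"
    by (rule continuous_open_preimage[OF smooth_on_imp_continuous_on[OF \<gamma>(1)] S(1) U(1)])
  moreover have "0 \<in> S \<inter> \<gamma> -` U" using S \<gamma> U by simp
  ultimately obtain e where e: "e > 0" "ball 0 e \<subseteq> S \<inter> \<gamma> -` U"
    using openE by blast
  have ball: "ball 0 e = {-e<..<e}" by (auto simp: dist_real_def)
  have "smooth_on {-e<..<e} \<gamma>" "\<gamma> ` {-e<..<e} \<subseteq> N \<inter> U"
    using e(2) \<gamma>(2) unfolding ball by (auto intro: smooth_on_subset[OF \<gamma>(1)])
  then show ?thesis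
    using e(1) \<gamma>(3,4) unfolding tangent_space_def curve_through_def by blast
qed

lemma tangent_space_adj_conj:
  assumes v: "v \<in> tangent_space M x" and M: "M \<subseteq> unitary_group" and x: "x \<in> M"
  shows "adj_conj x v = - v"
proof -
  let ?f = "\<lambda>z. z ** conj_transpose z"
  have "(?f has_derivative (\<lambda>v. x ** conj_transpose v + v ** conj_transpose x)) (at x)"
    by (rule bounded_bilinear.FDERIV[OF bounded_bilinear_matrix_mult has_derivative_ident
        bounded_linear_imp_has_derivative[OF bounded_linear_conj_transpose]])
  then have "diff_along M ?f x v = x ** conj_transpose v + v ** conj_transpose x"
    using v by (intro diff_along_eq[of _ _ _ UNIV ?f]) auto
  moreover have "diff_along M ?f x v = 0"
    unfolding diff_along_const[OF v, of "mat 1", symmetric]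
    by (rule diff_along_cong[OF smooth_map_const x v]) (use M in \<open>auto simp: unitary_group_def\<close>)
  ultimately show ?thesis
    using M x by (subst adj_conj_neg_iff) auto
qed

lemma tangent_space_unitary:
  assumes U: "open U" and x: "x \<in> unitary_group \<inter> U"
  shows "tangent_space (unitary_group \<inter> U) x = {v. unitary_proj 0 x v = v}"
proof -
  have xu: "x \<in> unitary_group" using x by simp
  show ?thesis
  proof (intro equalityI subsetI)
    fix v assume "v \<in> tangent_space (unitary_group \<inter> U) x"
    then have "adj_conj x v = - v" by (rule tangent_space_adj_conj) (use x in auto)
    then show "v \<in> {v. unitary_proj 0 x v = v}" by (simp add: unitary_proj_fixed_iff[OF xu])
  next
    fix v assume "v \<in> {v. unitary_proj 0 x v = v}"
    then have "adj_conj x v = - v" by (simp add: unitary_proj_fixed_iff[OF xu])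
    from unitary_curve[OF xu this] show "v \<in> tangent_space (unitary_group \<inter> U) x"
      using tangent_space_open_Int U x by (metis IntD2)
  qed
qed

text \<open>Besides unitarity, det is constant, and \<open>trace_tangent\<close> reads its vanishing
  differential as orthogonality to \<i> x; \<open>special_unitary_curve\<close> gives the
  converse.\<close>

lemma tangent_space_special_unitary:
  fixes x :: "complex^'n^'n"
  assumes U: "open U" and x: "x \<in> special_unitary_group \<inter> U"
  shows "tangent_space (special_unitary_group \<inter> U) x = {v. unitary_proj (1 / CARD('n)) x v = v}"
proof -
  have xu: "x \<in> unitary_group" and dx: "det x = 1"
    using x by (auto simp: special_unitary_group_def)
  show ?thesis
  proof (intro equalityI subsetI)
    let ?M = "special_unitary_group \<inter> U"
    fix v assume v: "v \<in> tangent_space ?M x"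
    then have adj: "adj_conj x v = - v"
      by (rule tangent_space_adj_conj) (use x in \<open>auto simp: special_unitary_group_def\<close>)
    have "diff_along ?M det x v = det x * trace (conj_transpose x ** v)"
      by (rule diff_along_eq[OF v open_UNIV _ has_derivative_det_unitary[OF xu]]) auto
    moreover have "diff_along ?M det x v = diff_along ?M (\<lambda>z. 1) x v"
      by (rule diff_along_cong[OF smooth_map_const x v]) (auto simp: special_unitary_group_def)
    ultimately have "v \<bullet> (mat \<i> ** x) = 0"
      using trace_tangent[OF xu adj] dx by (simp add: diff_along_const[OF v])
    with adj show "v \<in> {v. unitary_proj (1 / CARD('n)) x v = v}"
      by (simp add: unitary_proj_fixed_iff[OF xu])
  next
    fix v assume "v \<in> {v. unitary_proj (1 / CARD('n)) x v = v}"
    then have "adj_conj x v = - v" "v \<bullet> (mat \<i> ** x) = 0"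
      by (simp_all add: unitary_proj_fixed_iff[OF xu])
    from special_unitary_curve[OF _ this] x show "v \<in> tangent_space (special_unitary_group \<inter> U) x"
      using tangent_space_open_Int U by (metis IntD1 IntD2)
  qed
qed

lemma unitary_typeI:
  fixes M :: "(complex^'n::finite^'n) set" and e :: real
  assumes M: "M \<subseteq> unitary_group" and e: "e = 0 \<or> e = 1 / CARD('n)"
    and tangent: "\<And>x. x \<in> M \<Longrightarrow> tangent_space M x = {v. unitary_proj e x v = v}"
  shows "unitary_type M left_inv_metric (unitary_proj e) (of_real (e - CARD('n))) (of_real e)"
proof -
  have deriv: "frechet_derivative (\<lambda>y. unitary_proj e y b) (at x) = unitary_proj_deriv e x b" for x b
    using frechet_derivative_at[OF has_derivative_unitary_proj] by metis
  interpret embedded_manifold M left_inv_metric "unitary_proj e"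
  proof
    fix x v w assume x: "x \<in> M" and "unitary_proj e x v = v" "unitary_proj e x w = w"
    then show "frechet_derivative (\<lambda>y. unitary_proj e y w) (at x) v =
        frechet_derivative (\<lambda>y. unitary_proj e y v) (at x) w"
      unfolding deriv using M by (intro unitary_proj_deriv_sym[OF _ e]) auto
  qed (use M in \<open>auto simp: left_inv_metric_unitary tangent unitary_proj_idem[OF _ e]
        unitary_proj_selfadjoint linear_add[OF linear_unitary_proj]
        linear_scale[OF linear_unitary_proj] smooth_on_unitary_proj\<close>)
  have entry: "frame_deriv b (\<lambda>z. z $ i $ j) x = unitary_proj e x b $ i $ j" if "x \<in> M" for b i j x
    unfolding frame_deriv_def
    by (rule diff_along_eq[OF P_tangent[OF that] open_UNIV _
          bounded_linear_imp_has_derivative[OF bounded_linear_entry]]) auto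
  have entry2: "frame_deriv b (frame_deriv b (\<lambda>z. z $ i $ j)) x =
      unitary_proj_deriv e x b (unitary_proj e x b) $ i $ j" if x: "x \<in> M" for b i j x
  proof -
    have "frame_deriv b (frame_deriv b (\<lambda>z. z $ i $ j)) x = frame_deriv b (\<lambda>z. unitary_proj e z b $ i $ j) x"
      by (rule frame_deriv_cong[symmetric])
        (simp_all add: frame_deriv_smooth smooth_map_entry x entry)
    also have "\<dots> = unitary_proj_deriv e x b (unitary_proj e x b) $ i $ j"
      unfolding frame_deriv_def
      by (rule diff_along_eq[OF P_tangent[OF x] open_UNIV _
          bounded_linear.has_derivative[OF bounded_linear_entry has_derivative_unitary_proj]]) auto
    finally show ?thesis .
  qed
  show ?thesis
  proof
    fix z and i j :: 'n assume z: "z \<in> M"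
    then have zu: "z \<in> unitary_group" using M by auto
    have "tau M left_inv_metric (\<lambda>z. z $ i $ j) z =
        (\<Sum>b\<in>Basis. unitary_proj_deriv e z b (unitary_proj e z b)) $ i $ j"
      by (simp add: tau_eq smooth_map_entry z entry2)
    also have "\<dots> = of_real (e - CARD('n)) * z $ i $ j"
      unfolding sum_unitary_proj_deriv[OF zu e] vector_scaleR_component by (simp only: scaleR_conv_of_real)
    finally show "tau M left_inv_metric (\<lambda>z. z $ i $ j) z = of_real (e - CARD('n)) * z $ i $ j" .
  next
    fix z and i j i' j' :: 'n assume z: "z \<in> M"
    then have zu: "z \<in> unitary_group" using M by auto
    show "kappa M left_inv_metric (\<lambda>z. z $ i $ j) (\<lambda>z. z $ i' $ j') z =
      - z $ i $ j' * z $ i' $ j + of_real e * z $ i $ j * z $ i' $ j'"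
      by (simp add: kappa_eq smooth_map_entry z entry sum_unitary_proj_entries[OF zu e])
  qed
qed

text \<open>The family is given only by its values on \<open>M\<close>, up to constants
  \<open>s j\<close>, so that it may also be \<tau> formed on a larger manifold and then restricted.
  Constant factors preserve the equations with lam = 0 and mu = - 2.\<close>

lemma (in unitary_type) eigenfamily_minor_quotients:
  assumes nz: "\<And>z. z \<in> M \<Longrightarrow> row_form q \<beta> z \<noteq> 0"
    and F: "\<And>j z. z \<in> M \<Longrightarrow> F j z = s j * (row_minor p q \<beta> j z *
      (inverse (row_form q \<beta> z) * inverse (row_form q \<beta> z)))"
  shows "eigenfamily M g {\<lambda>z. F j z ^ k | j. j \<noteq> \<beta>}"
proof -
  define G where "G j z = row_minor p q \<beta> j z * (inverse (row_form q \<beta> z) * inverse (row_form q \<beta> z))" for j z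
  have G: "smooth_map M (G j)" for j
    unfolding G_def[abs_def]
    by (intro smooth_map_mult smooth_map_row_minor smooth_map_inverse_row_form nz)
  have sG: "smooth_map M (\<lambda>z. s j * G j z)" for j
    by (intro smooth_map_mult smooth_map_const G)
  have FG: "s j * G j z = F j z" if "z \<in> M" for j z using F[OF that] by (simp add: G_def)
  have tau: "tau M g (F j) z = 0 * F j z" if z: "z \<in> M" for j z
  proof -
    have "tau M g (F j) z = tau M g (\<lambda>z. s j * G j z) z"
      by (rule tau_cong[OF sG z FG])
    then show ?thesis
      using tau_minor_quotient[OF nz z] by (simp add: tau_cmult[OF G z]) (simp add: G_def[abs_def])
  qed
  have kappa: "kappa M g (F j) (F i) z = - 2 * F j z * F i z" if z: "z \<in> M" for i j z
  proof -
    have "kappa M g (F j) (F i) z = kappa M g (\<lambda>z. s j * G j z) (\<lambda>z. s i * G i z) z"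
      by (rule kappa_cong[OF sG sG z FG FG])
    also have "\<dots> = s j * s i * kappa M g (G j) (G i) z"
      by (simp add: kappa_cmult[OF G sG z] kappa_commute[OF G sG z] kappa_cmult[OF G G z]
          kappa_commute[OF G G z, of i])
    also have "kappa M g (G j) (G i) z = - 2 * G j z * G i z"
      using kappa_minor_quotient[OF nz z] by (simp add: G_def[abs_def])
    finally show ?thesis by (simp add: FG[OF z, symmetric])
  qed
  have "eigenfamily M g ((\<lambda>\<phi> x. \<phi> x ^ k) ` {F j | j. j \<noteq> \<beta>})"
  proof (rule eigenfamily_power[where lam = 0 and mu = "- 2"])
    show "smooth_map M \<phi>" if "\<phi> \<in> {F j | j. j \<noteq> \<beta>}" for \<phi>
      using that smooth_map_cong[OF sG FG] by auto
  qed (use tau kappa in auto)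
  moreover have "(\<lambda>\<phi> x. \<phi> x ^ k) ` {F j | j. j \<noteq> \<beta>} = {\<lambda>z. F j z ^ k | j. j \<noteq> \<beta>}"
    by auto
  ultimately show ?thesis by simp
qed

section \<open>Density of the domain, and the eigenfamilies on both groups\<close>

lemma row_form_mult: "row_form q j (z ** A) = (\<Sum>k\<in>UNIV. row_form q k z * A $ k $ j)"
  unfolding row_form_def matrix_matrix_mult_def
  by (simp add: sum_distrib_left sum_distrib_right mult.assoc) (rule sum.swap)

lemma row_form_mat_1: "row_form q j (mat 1) = q $ j"
  by (simp add: row_form_def mat_def if_distrib cong: if_cong)

text \<open>At a zero of \<open>Q\<close>, the derivative of \<open>Q\<close> along a suitable infinitesimal rotation of the columns
  is a nonzero entry of \<open>q\<^sup>t z\<close>.\<close>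

lemma unitary_group_subset_closure:
  fixes q :: "complex^'n"
  assumes q: "q \<noteq> 0"
  shows "unitary_group \<subseteq> closure {z \<in> unitary_group. row_form q \<beta> z \<noteq> 0}" (is "_ \<subseteq> closure ?W")
proof (rule subsetI, rule ccontr)
  fix z assume z: "z \<in> unitary_group" and ncl: "z \<notin> closure ?W"
  \<comment> \<open>Away from the closure the row form vanishes on a relatively open neighbourhood
    of \<open>z\<close>, so its differential at \<open>z\<close> is 0 on all tangent
    vectors.\<close>
  define V where "V = - closure ?W"
  have V: "open V" "z \<in> V" using ncl by (auto simp: V_def)
  have zero: "row_form q \<beta> y = 0" if "y \<in> unitary_group \<inter> V" for y
    using that closure_subset[of ?W] by (auto simp: V_def)
  \<comment> \<open>q^t z is not 0, as multiplication by z* recovers q.\<close>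
  obtain j where j: "row_form q j z \<noteq> 0"
  proof -
    have "\<exists>j. row_form q j z \<noteq> 0"
    proof (rule ccontr)
      assume "\<nexists>j. row_form q j z \<noteq> 0"
      then have "row_form q i (z ** conj_transpose z) = 0" for i
        by (simp add: row_form_mult)
      then have "q $ i = 0" for i
        using z by (simp add: unitary_group_iff row_form_mat_1)
      then show False using q by (simp add: vec_eq_iff)
    qed
    then show thesis using that by blast
  qed
  have j\<beta>: "j \<noteq> \<beta>" using j zero[of z] z V by auto
  \<comment> \<open>Generator of the rotations in the coordinates \<open>j\<close> and \<beta>: the
    column \<beta> of \<open>z ** A\<close> is the column \<open>j\<close> of
    \<open>z\<close>.\<close>
  define A :: "complex^'n^'n" where
    "A = (\<chi> r s. if r = j \<and> s = \<beta> then 1 else if r = \<beta> \<and> s = j then - 1 else 0)"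
  have A: "conj_transpose A = - A"
    using j\<beta> by (auto simp: A_def conj_transpose_def vec_eq_iff)
  have "adj_conj z (z ** A) = - (z ** A)"
    by (simp add: adj_conj_def conj_transpose_mult A matrix_mult_minus matrix_mul_assoc unitary_cancel[OF z])
  from unitary_curve[OF z this] have v: "z ** A \<in> tangent_space (unitary_group \<inter> V) z"
    using tangent_space_open_Int V by metis
  have "diff_along (unitary_group \<inter> V) (row_form q \<beta>) z (z ** A) = row_form q \<beta> (z ** A)"
  proof (rule diff_along_eq[OF v open_UNIV])
    show "(row_form q \<beta> has_derivative row_form q \<beta>) (at z)"
      unfolding row_form_def[abs_def]
      by (intro has_derivative_sum has_derivative_mult_right bounded_linear_imp_has_derivative
          bounded_linear_entry)
  qed auto
  moreover have "diff_along (unitary_group \<inter> V) (row_form q \<beta>) z (z ** A) = 0"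
    using diff_along_cong[OF smooth_map_const[of _ 0] _ v, of "row_form q \<beta>"] z V zero
    by (simp add: diff_along_const[OF v])
  moreover have "row_form q \<beta> (z ** A) = row_form q j z"
  proof -
    have "row_form q \<beta> (z ** A) = (\<Sum>k\<in>UNIV. if k = j then row_form q j z else 0)"
      unfolding row_form_mult by (rule sum.cong) (use j\<beta> in \<open>auto simp: A_def\<close>)
    then show ?thesis by simp
  qed
  ultimately show False using j by simp
qed

theorem proposition10p2:
  fixes \<beta> :: "'n::finite"
    and p q a b :: "complex^'n"
    and P f :: "'n \<Rightarrow> complex^'n^'n \<Rightarrow> complex"
    and Q :: "complex^'n^'n \<Rightarrow> complex"
    and W :: "(complex^'n^'n) set"
    and k :: nat
  assumes pq_independent: "p \<noteq> q" "vec.independent {p, q}"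
    and b_nonzero: "b $ \<beta> \<noteq> 0"
    and P: "\<And>j z. P j z = (\<Sum>i\<in>UNIV. p $ i * a $ j * z $ i $ j)"
    and Q: "\<And>z. Q z = (\<Sum>i\<in>UNIV. q $ i * b $ \<beta> * z $ i $ \<beta>)"
    and W: "W = {z \<in> unitary_group. Q z \<noteq> 0}"
    and f: "\<And>j z. f j z = P j z / Q z"
    and k_pos: "k > 0"
  shows "openin (top_of_set unitary_group) W \<and>
     unitary_group \<subseteq> closure W \<and>
     eigenfamily W left_inv_metric
           {\<lambda>z. tau W left_inv_metric (f j) z ^ k | j. j \<noteq> \<beta>} \<and>
     eigenfamily (W \<inter> special_unitary_group) left_inv_metric
           {\<lambda>z. tau W left_inv_metric (f j) z ^ k | j. j \<noteq> \<beta>} \<and>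
     eigenfamily (W \<inter> special_unitary_group) left_inv_metric
           {\<lambda>z. tau (W \<inter> special_unitary_group) left_inv_metric (f j) z ^ k | j. j \<noteq> \<beta>}"
proof -
  define U where "U = {z. row_form q \<beta> z \<noteq> 0}"
  let ?SW = "W \<inter> special_unitary_group"
  have Q': "Q z = b $ \<beta> * row_form q \<beta> z" for z
    by (simp add: Q row_form_def sum_distrib_left mult_ac)
  have P': "P j z = a $ j * row_form p j z" for j z
    by (simp add: P row_form_def sum_distrib_left mult_ac)
  have f': "f j = (\<lambda>z. (a $ j / b $ \<beta>) * (row_form p j z * inverse (row_form q \<beta> z)))" for j
    by (rule ext) (simp add: f P' Q' divide_inverse)
  have WU: "W = unitary_group \<inter> U" and SWU: "?SW = special_unitary_group \<inter> U"
    using b_nonzero by (auto simp: W U_def Q' special_unitary_group_def)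
  have "continuous_on UNIV (row_form q \<beta>)"
    unfolding row_form_def[abs_def] by (intro continuous_intros)
  then have U: "open U"
    unfolding U_def by (intro open_Collect_neq) auto
  \<comment> \<open>An independent set cannot contain 0; for q = 0 the domain would be
    empty.\<close>
  have q: "q \<noteq> 0" using pq_independent vec.dependent_zero[of "{p, q}"] by blast
  interpret W: unitary_type W left_inv_metric "unitary_proj 0" "of_real (0 - real CARD('n))" "of_real 0"
    by (rule unitary_typeI) (auto simp: WU tangent_space_unitary[OF U])
  interpret SW: unitary_type ?SW left_inv_metric "unitary_proj (1 / CARD('n))"
    "of_real (1 / real CARD('n) - real CARD('n))" "of_real (1 / real CARD('n))"
    unfolding SWU
  proof (rule unitary_typeI)
    show "special_unitary_group \<inter> U \<subseteq> unitary_group" by (auto simp: special_unitary_group_def)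
  qed (simp_all add: tangent_space_special_unitary[OF U])
  \<comment> \<open>Stated for any \<open>unitary_type\<close> inside \<open>U\<close>. As the
    result contains neither \<open>l\<close> nor \<open>c\<close>, \<tau> formed on \<open>W\<close>
    and \<tau> formed on \<open>?SW\<close> coincide on \<open>?SW\<close>.\<close>
  have tau_f: "tau M left_inv_metric (f j) z = (2 * a $ j / b $ \<beta>) * (row_minor p q \<beta> j z *
      (inverse (row_form q \<beta> z) * inverse (row_form q \<beta> z)))"
    if ut: "unitary_type M left_inv_metric Pr l c" and M: "M \<subseteq> U" and z: "z \<in> M" for M Pr l c j z
  proof -
    interpret unitary_type M left_inv_metric Pr l c by (rule ut)
    have nz: "row_form q \<beta> z \<noteq> 0" if "z \<in> M" for z using that M by (auto simp: U_def)
    have sm: "smooth_map M (\<lambda>z. row_form p j z * inverse (row_form q \<beta> z))"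
      by (intro smooth_map_mult smooth_map_row_form smooth_map_inverse_row_form nz)
    show ?thesis
      unfolding f' tau_cmult[OF sm z] using tau_quotient[OF nz z] by (simp add: power2_eq_square)
  qed
  have nzW: "row_form q \<beta> z \<noteq> 0" if "z \<in> W" for z using that by (auto simp: WU U_def)
  have tau_W: "tau W left_inv_metric (f j) z = (2 * a $ j / b $ \<beta>) * (row_minor p q \<beta> j z *
      (inverse (row_form q \<beta> z) * inverse (row_form q \<beta> z)))" if "z \<in> W" for j z
    by (rule tau_f[OF W.unitary_type_axioms _ that]) (simp add: WU)
  have tau_SW: "tau ?SW left_inv_metric (f j) z = (2 * a $ j / b $ \<beta>) * (row_minor p q \<beta> j z *
      (inverse (row_form q \<beta> z) * inverse (row_form q \<beta> z)))" if "z \<in> ?SW" for j z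
    by (rule tau_f[OF SW.unitary_type_axioms _ that]) (auto simp: WU)
  have "openin (top_of_set unitary_group) W"
    unfolding WU by (rule openin_open_Int[OF U])
  moreover have "unitary_group \<subseteq> closure W"
    using unitary_group_subset_closure[OF q, of \<beta>] by (simp add: WU U_def Collect_conj_eq)
  moreover have "eigenfamily W left_inv_metric {\<lambda>z. tau W left_inv_metric (f j) z ^ k | j. j \<noteq> \<beta>}"
    by (rule W.eigenfamily_minor_quotients[OF nzW tau_W])
  \<comment> \<open>The induced family may be read as the restricted functions, or as \<tau> formed
    anew on the smaller manifold; the common formula settles both readings.\<close>
  moreover have "eigenfamily ?SW left_inv_metric {\<lambda>z. tau W left_inv_metric (f j) z ^ k | j. j \<noteq> \<beta>}"
    by (rule SW.eigenfamily_minor_quotients[OF nzW tau_W]) auto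
  moreover have "eigenfamily ?SW left_inv_metric {\<lambda>z. tau ?SW left_inv_metric (f j) z ^ k | j. j \<noteq> \<beta>}"
    by (rule SW.eigenfamily_minor_quotients[OF nzW tau_SW]) auto
  ultimately show ?thesis by blast
qed

end
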